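(* Let $p$ be an odd prime, $K/\mathbb Q_p$ finite unramified with valuation ring $\mathcal O_K$, and $\xi=\sum_za_z[z]_{\mathrm{cyc}}$ a finite cyclotomic presentation with coefficients in $\mathcal O_K$, supported on roots of unity $z\in K$, $z\ne1$, of order prime to $p$. Write the exceptional component in the coordinate $Y=(1+p)^{s+1}-1$ as $$\mathcal M_{\mathcal I_{\xi,p},-1}(s)=a_{-1}Y^{-1}+a_0+a_1Y+\cdots.$$ If $a_{-1}\ne0$, then, after extending coefficients from $\mathcal O_K$ to its fraction field $K$, every finite Laurent jet $$a_{-1}Y^{-1}+b_0+b_1Y+\cdots+b_MY^M\qquad(b_0,\dots,b_M\in K)$$ with the same polar coefficient $a_{-1}$ is attained by a normalized finite linear refinement operator applied to $\xi$: there is $C=\sum_mc_mR_m$ (finite sum, $m\geq 1$ prime to $p$, $c_m\in K$, $\sum_mc_m=1$) such that the exceptional component of $\mathcal I_{C\xi,p}$ has this jet modulo $Y^{M+1}$. These exceptional jets may be prescribed simultaneously with arbitrary finite multiplier jets on all nonexceptional components (i.e. arbitrary values in $K$ for the coefficients $[Y^q]H_{C,e}$, $1\le e\le p-2$, $0\le q\le N$). Consequently, within the family of normalized finite linear refinement operators, after scalar extension to the fraction field, the exceptional residue (polar coefficient) is the only rigid finite Laurent coefficient of the exceptional component when it is nonzero.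
   Context: **Refinement.** For $m\ge1$ prime to $p$, $R_m[z]_{\mathrm{cyc}}=m\sum_{u^m=z}[u]_{\mathrm{cyc}}$, extended linearly, after passing to a finite unramified extension containing the required roots. For $C=\sum_mc_mR_m$ the multiplier on component $e$ is $H_{C,e}(Y)=\sum_mc_mm^e(1+Y)^{\ell_m}$, $\ell_m=\log_p\langle m\rangle/\log_p(1+p)\in\mathbb Z_p$, and one has $\mathcal M_{\mathcal I_{C\xi,p},j_e}(s)=H_{C,e}(Y_e)\mathcal M_{\mathcal I_{\xi,p},j_e}(s)$ with $j_e\equiv e-1\pmod{p-1}$, $Y_e=(1+p)^{s-(e-1)}-1$, $0\le e\le p-2$; $e=0$ is the exceptional component ($j=-1$), the others are nonexceptional. "Rigid" means unchanged by every operator of the family. **Pseudomeasure.** $G=\mathbb Z_p^\times$; $\Lambda_K(G)=\mathcal O_K[[G]][1/p]$ is the algebra of bounded $K$-valued measures under multiplicative convolution $\star$ (push-forward under $(x,y)\mapsto xy$); $\delta_u$ Dirac measure; $r_c=\delta_1-c\,\delta_c$ for odd $c>1$ prime to $p$; $\Sigma$ the multiplicative set generated by the $r_c$. $\lambda_{1/2,c}$ is the bounded measure on $\mathbb Z_p$ with $\int_{\mathbb Z_p}(1+T)^xd\lambda_{1/2,c}(x)=\frac{(1+T)^{1/2}}T-c\frac{(1+T)^{c/2}}{(1+T)^c-1}$; $\lambda^\times_{1/2,c}$ its restriction to $G$. $\mu_z(a+p^n\mathbb Z_p)=z^a/(1-z^{p^n})$ for $0\le a<p^n$ defines a measure on $\mathbb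 Z_p$; $\nu_\xi^\times=\sum a_zx^{-1}\mathbf 1_G\mu_z$; $\mathcal I_{\xi,p}=r_c^{-1}\star(\lambda^\times_{1/2,c}\star\nu^\times_\xi)\in\Sigma^{-1}\Lambda_K(G)$, independent of $c$. **Components.** Write $x=\omega(x)\langle x\rangle$ with $\omega(x)\in\mu_{p-1}$, $\langle x\rangle\in1+p\mathbb Z_p$. $\mathcal M_{\rho,j}(s)=\int_G\omega(x)^j\langle x\rangle^sd\rho(x)$ for $\rho\in\Lambda_K(G)$, and $\mathcal M_{A/r,j}=\mathcal M_{A,j}/\mathcal M_{r,j}$. The exceptional component of $\mathcal I_{\xi,p}$ has at most a simple pole, at $s=-1$, i.e. at $Y=0$. *)

theory Defs
  imports
    "HOL-Analysis.Elementary_Metric_Spaces"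
    "HOL-Computational_Algebra.Formal_Laurent_Series"
    "HOL-Computational_Algebra.Primes"
    "HOL-Library.Poly_Mapping"
begin

section \<open>The ambient valued field\<close>

text \<open>
  All fields live inside one algebraically closed field that is complete for a
  multiplicative ultrametric absolute value, namely \<open>dist x 0\<close> (for instance the
  completion of an algebraic closure of the field of p-adic numbers). It contains every
  finite unramified extension needed for the roots that occur in a refinement.
\<close>

class complete_ultrametric_field = alg_closed_field + field_char_0 + complete_space +
  assumes dist_eq_dist_diff: "dist x y = dist (x - y) 0"
    and dist_mult_zero: "dist (x * y) 0 = dist x 0 * dist y 0"
    and dist_add_zero_le_max: "dist (x + y) 0 \<le> max (dist x 0) (dist y 0)"

abbreviation absv :: "'k::complete_ultrametric_field \<Rightarrow> real"
  where "absv x \<equiv> dist x 0"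

text \<open>
  When \<open>absv (of_nat p) = 1 / p\<close>, the absolute value extends the p-adic one on the
  rationals; by completeness the closures of the rationals and of the integers
  are then the p-adic numbers and the p-adic integers.
\<close>

definition Qp :: "'k::complete_ultrametric_field set"
  where "Qp = closure \<rat>"

definition Zp :: "'k::complete_ultrametric_field set"
  where "Zp = closure \<int>"

definition Zp_units :: "'k::complete_ultrametric_field set"
  where "Zp_units = {x \<in> Zp. x \<noteq> 0 \<and> inverse x \<in> Zp}"

definition is_subfield :: "'k::complete_ultrametric_field set \<Rightarrow> bool"
  where "is_subfield K \<longleftrightarrow> 1 \<in> K \<and> (\<forall>x\<in>K. \<forall>y\<in>K. x - y \<in> K \<and> x * y \<in> K) \<and> (\<forall>x\<in>K. inverse x \<in> K)"

text \<open>
  Unramified means ramification index 1, i.e. equality of value groups; the residue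
  field extension is automatically separable since the residue fields are finite.
\<close>

definition finite_unramified :: "'k::complete_ultrametric_field set \<Rightarrow> bool"
  where "finite_unramified K \<longleftrightarrow>
    is_subfield K \<and> Qp \<subseteq> K \<and>
    (\<exists>B. finite B \<and> B \<subseteq> K \<and> (\<forall>x\<in>K. \<exists>q. (\<forall>b\<in>B. q b \<in> Qp) \<and> x = (\<Sum>b\<in>B. q b * b))) \<and>
    absv ` (K - {0}) = absv ` (Qp - {0 :: 'k})"

definition valuation_ring :: "'k::complete_ultrametric_field set \<Rightarrow> 'k set"
  where "valuation_ring K = {x \<in> K. absv x \<le> 1}"


section \<open>Bounded measures\<close>

definition Zp_coset :: "nat \<Rightarrow> nat \<Rightarrow> nat \<Rightarrow> 'k::complete_ultrametric_field set"
  where "Zp_coset p a n = (\<lambda>y. of_nat a + of_nat p ^ n * y) ` Zp"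

definition clopen_in :: "'k::complete_ultrametric_field set \<Rightarrow> 'k set \<Rightarrow> bool"
  where "clopen_in X U \<longleftrightarrow> openin (top_of_set X) U \<and> closedin (top_of_set X) U"

text \<open>
  Bounded measures on \<open>X\<close> are bounded finitely additive functions on the clopen subsets of
  \<open>X\<close>. They are given the value 0 on all other sets, so that
  equality of measures is equality of functions. Values are allowed in the whole ambient
  field, so that measures over different finite unramified extensions are treated together.
\<close>

definition bounded_measures ::
    "'k::complete_ultrametric_field set \<Rightarrow> ('k set \<Rightarrow> 'k) set"
  where "bounded_measures X = {\<mu>.
    (\<forall>U V. clopen_in X U \<longrightarrow> clopen_in X V \<longrightarrow> U \<inter> V = {} \<longrightarrow> \<mu> (U \<union> V) = \<mu> U + \<mu> V) \<and>
    (\<forall>U. \<not> clopen_in X U \<longrightarrow> \<mu> U = 0) \<and>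
    bounded (range \<mu>)}"

text \<open>
  Integration over \<open>X\<close>, where \<open>X\<close> is \<open>Zp\<close> or \<open>Zp_units\<close>, as the limit of Riemann sums over
  the cosets modulo \<open>p ^ n\<close>. For \<open>X = Zp_units\<close>, \<open>n \<ge> 1\<close>, the cosets of
  multiples of p do not meet \<open>X\<close> and contribute 0.
\<close>

definition padic_integral ::
    "nat \<Rightarrow> 'k::complete_ultrametric_field set \<Rightarrow> ('k \<Rightarrow> 'k) \<Rightarrow> ('k set \<Rightarrow> 'k) \<Rightarrow> 'k"
  where "padic_integral p X f \<mu> =
    lim (\<lambda>n. \<Sum>a<p ^ n. f (of_nat a) * \<mu> (Zp_coset p a n \<inter> X))"

definition dirac :: "'k::complete_ultrametric_field \<Rightarrow> 'k set \<Rightarrow> 'k"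
  where "dirac u U = (if clopen_in Zp_units U \<and> u \<in> U then 1 else 0)"

text \<open>
  Push-forward of the product measure under multiplication, the product measure being
  evaluated by integrating over its slices.
\<close>

definition measure_conv ::
    "nat \<Rightarrow> ('k::complete_ultrametric_field set \<Rightarrow> 'k) \<Rightarrow> ('k set \<Rightarrow> 'k) \<Rightarrow> 'k set \<Rightarrow> 'k"
  where "measure_conv p \<mu> \<nu> U =
    (if clopen_in Zp_units U
     then padic_integral p Zp_units (\<lambda>y. \<mu> {x \<in> Zp_units. x * y \<in> U}) \<nu> else 0)"

definition restrict_units ::
    "('k::complete_ultrametric_field set \<Rightarrow> 'k) \<Rightarrow> 'k set \<Rightarrow> 'k"
  where "restrict_units \<mu> U = (if clopen_in Zp_units U then \<mu> U else 0)"


section \<open>The p-adic functions\<close>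

definition teich :: "nat \<Rightarrow> 'k::complete_ultrametric_field \<Rightarrow> 'k"
  where "teich p x = (THE w. w ^ (p - 1) = 1 \<and> x / w \<in> Zp_coset p 1 1)"

definition principal :: "nat \<Rightarrow> 'k::complete_ultrametric_field \<Rightarrow> 'k"
  where "principal p x = x / teich p x"

definition padic_pow :: "'k::complete_ultrametric_field \<Rightarrow> 'k \<Rightarrow> 'k"
  where "padic_pow u s = suminf (\<lambda>n. (s gchoose n) * (u - 1) ^ n)"

definition padic_log :: "'k::complete_ultrametric_field \<Rightarrow> 'k"
  where "padic_log u = suminf (\<lambda>n. (- 1) ^ n * (u - 1) ^ Suc n / of_nat (Suc n))"

definition ell :: "nat \<Rightarrow> nat \<Rightarrow> 'k::complete_ultrametric_field"
  where "ell p m = padic_log (principal p (of_nat m)) / padic_log (1 + of_nat p)"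


section \<open>Components of pseudomeasures\<close>

definition mellin ::
    "nat \<Rightarrow> ('k::complete_ultrametric_field set \<Rightarrow> 'k) \<Rightarrow> int \<Rightarrow> 'k \<Rightarrow> 'k"
  where "mellin p \<rho> j s =
    padic_integral p Zp_units (\<lambda>x. (teich p x powi j) * padic_pow (principal p x) s) \<rho>"

definition admissible :: "nat \<Rightarrow> nat \<Rightarrow> bool"
  where "admissible p c \<longleftrightarrow> odd c \<and> c > 1 \<and> coprime c p"

definition r_elem :: "nat \<Rightarrow> 'k::complete_ultrametric_field set \<Rightarrow> 'k"
  where "r_elem c = (\<lambda>U. dirac 1 U - of_nat c * dirac (of_nat c) U)"

inductive_set Sigma_set :: "nat \<Rightarrow> ('k::complete_ultrametric_field set \<Rightarrow> 'k) set"
  for p :: nat where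
  one: "dirac 1 \<in> Sigma_set p"
| mult: "admissible p c \<Longrightarrow> t \<in> Sigma_set p \<Longrightarrow> measure_conv p (r_elem c) t \<in> Sigma_set p"

text \<open>
  Elements of the localization of \<open>bounded_measures Zp_units\<close> at \<open>Sigma_set p\<close> are
  equivalence classes of pairs (numerator, denominator); \<open>pm_frac p A r\<close> is the class of
  \<open>A / r\<close>.
\<close>

definition pm_frac ::
    "nat \<Rightarrow> ('k::complete_ultrametric_field set \<Rightarrow> 'k) \<Rightarrow> ('k set \<Rightarrow> 'k) \<Rightarrow>
     (('k set \<Rightarrow> 'k) \<times> ('k set \<Rightarrow> 'k)) set"
  where "pm_frac p A r = {(B, t). B \<in> bounded_measures Zp_units \<and> t \<in> Sigma_set p \<and>
    (\<exists>w\<in>Sigma_set p.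
      measure_conv p w (measure_conv p t A) = measure_conv p w (measure_conv p r B))}"

definition pm_mellin ::
    "nat \<Rightarrow> (('k::complete_ultrametric_field set \<Rightarrow> 'k) \<times> ('k set \<Rightarrow> 'k)) set \<Rightarrow> int \<Rightarrow> 'k \<Rightarrow> 'k"
  where "pm_mellin p X j s =
    (THE v. \<exists>(A, r)\<in>X. mellin p r j s \<noteq> 0 \<and> v = mellin p A j s / mellin p r j s)"


section \<open>The pseudomeasure of a cyclotomic presentation\<close>

text \<open>
  A presentation, i.e. a finite formal sum of \<open>a z\<close> times the symbol of \<open>z\<close>, is the finitely
  supported function \<open>a\<close>.
\<close>

definition cyc_presentation ::
    "nat \<Rightarrow> 'k::complete_ultrametric_field set \<Rightarrow> ('k \<Rightarrow>\<^sub>0 'k) \<Rightarrow> bool"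
  where "cyc_presentation p K \<xi> \<longleftrightarrow>
    (\<forall>z. Poly_Mapping.lookup \<xi> z \<in> valuation_ring K) \<and>
    (\<forall>z\<in>Poly_Mapping.keys \<xi>. z \<in> K \<and> z \<noteq> 1 \<and>
      (\<exists>n>0. z ^ n = 1 \<and> (\<forall>k. 0 < k \<and> k < n \<longrightarrow> z ^ k \<noteq> 1) \<and> coprime n p))"

text \<open>
  The finitely additive extension of the values \<open>z ^ a / (1 - z ^ (p ^ n))\<close> on the cosets of
  \<open>a < p ^ n\<close>: a clopen set is the disjoint union of the cosets modulo \<open>p ^ n\<close> of its elements
  \<open>a < p ^ n\<close> for all large \<open>n\<close>, so the sequence is eventually constant.
\<close>

definition mu_measure :: "nat \<Rightarrow> 'k::complete_ultrametric_field \<Rightarrow> 'k set \<Rightarrow> 'k"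
  where "mu_measure p z U =
    (if clopen_in Zp U
     then lim (\<lambda>n. \<Sum>a | a < p ^ n \<and> of_nat a \<in> U. z ^ a / (1 - z ^ (p ^ n))) else 0)"

definition nu_measure ::
    "nat \<Rightarrow> ('k::complete_ultrametric_field \<Rightarrow>\<^sub>0 'k) \<Rightarrow> 'k set \<Rightarrow> 'k"
  where "nu_measure p \<xi> U =
    (if clopen_in Zp_units U
     then \<Sum>z\<in>Poly_Mapping.keys \<xi>. Poly_Mapping.lookup \<xi> z *
            padic_integral p Zp (\<lambda>x. if x \<in> U then inverse x else 0) (mu_measure p z)
     else 0)"

text \<open>
  The integral of \<open>(1 + T) ^ x\<close> is the power series whose n-th coefficient is the integral of
  \<open>x gchoose n\<close>. The right-hand side is formed in Laurent series, where the poles cancel.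
\<close>

definition is_half_measure ::
    "nat \<Rightarrow> nat \<Rightarrow> ('k::complete_ultrametric_field set \<Rightarrow> 'k) \<Rightarrow> bool"
  where "is_half_measure p c \<Lambda> \<longleftrightarrow> \<Lambda> \<in> bounded_measures Zp \<and>
    fps_to_fls (Abs_fps (\<lambda>n. padic_integral p Zp (\<lambda>x. x gchoose n) \<Lambda>)) =
      fps_to_fls (fps_binomial (1 / 2)) / fls_X -
      of_nat c * (fps_to_fls (fps_binomial (of_nat c / 2)) /
                  (fps_to_fls (fps_binomial (of_nat c)) - 1))"

definition pseudomeasure ::
    "nat \<Rightarrow> nat \<Rightarrow> ('k::complete_ultrametric_field set \<Rightarrow> 'k) \<Rightarrow> ('k \<Rightarrow>\<^sub>0 'k) \<Rightarrow>
     (('k set \<Rightarrow> 'k) \<times> ('k set \<Rightarrow> 'k)) set"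
  where "pseudomeasure p c \<Lambda> \<xi> =
    pm_frac p (measure_conv p (restrict_units \<Lambda>) (nu_measure p \<xi>)) (r_elem c)"

text \<open>
  The exceptional component is the sum of the Laurent series \<open>F\<close>, with at most a
  simple pole, in the coordinate \<open>(1 + p) ^ (s + 1) - 1\<close>.
\<close>

definition exceptional_expansion ::
    "nat \<Rightarrow> nat \<Rightarrow> ('k::complete_ultrametric_field set \<Rightarrow> 'k) \<Rightarrow> ('k \<Rightarrow>\<^sub>0 'k) \<Rightarrow> 'k fls \<Rightarrow> bool"
  where "exceptional_expansion p c \<Lambda> \<xi> F \<longleftrightarrow>
    (\<forall>n < - 1. fls_nth F n = 0) \<and>
    (\<forall>s\<in>Zp - {- 1}. (\<lambda>n. fls_nth F (int n - 1) *
        (padic_pow (1 + of_nat p) (s + 1) - 1) powi (int n - 1))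
      sums pm_mellin p (pseudomeasure p c \<Lambda> \<xi>) (- 1) s)"


section \<open>Refinement operators\<close>

text \<open>
  The m-th roots \<open>u\<close> are taken in the ambient field, so they may lie outside \<open>K\<close>. An operator
  is the finitely supported function \<open>C\<close> of its coefficients.
\<close>

definition refine ::
    "nat \<Rightarrow> ('k::complete_ultrametric_field \<Rightarrow>\<^sub>0 'k) \<Rightarrow> ('k \<Rightarrow>\<^sub>0 'k)"
  where "refine m \<xi> =
    (\<Sum>z\<in>Poly_Mapping.keys \<xi>. \<Sum>u | u ^ m = z.
      Poly_Mapping.single u (Poly_Mapping.lookup \<xi> z * of_nat m))"

definition apply_op ::
    "(nat \<Rightarrow>\<^sub>0 'k::complete_ultrametric_field) \<Rightarrow> ('k \<Rightarrow>\<^sub>0 'k) \<Rightarrow> ('k \<Rightarrow>\<^sub>0 'k)"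
  where "apply_op C \<xi> =
    (\<Sum>m\<in>Poly_Mapping.keys C.
      Poly_Mapping.map (\<lambda>a. Poly_Mapping.lookup C m * a) (refine m \<xi>))"

definition normalized_ops ::
    "nat \<Rightarrow> 'k::complete_ultrametric_field set \<Rightarrow> (nat \<Rightarrow>\<^sub>0 'k) set"
  where "normalized_ops p K = {C.
    (\<forall>m\<in>Poly_Mapping.keys C. m \<ge> 1 \<and> coprime m p \<and> Poly_Mapping.lookup C m \<in> K) \<and>
    (\<Sum>m\<in>Poly_Mapping.keys C. Poly_Mapping.lookup C m) = 1}"

definition multiplier ::
    "nat \<Rightarrow> (nat \<Rightarrow>\<^sub>0 'k::complete_ultrametric_field) \<Rightarrow> nat \<Rightarrow> 'k fps"
  where "multiplier p C e =
    (\<Sum>m\<in>Poly_Mapping.keys C.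
      fps_const (Poly_Mapping.lookup C m * of_nat m ^ e) * fps_binomial (ell p m))"

definition rigid_coeff ::
    "nat \<Rightarrow> 'k::complete_ultrametric_field set \<Rightarrow> nat \<Rightarrow> ('k set \<Rightarrow> 'k) \<Rightarrow> ('k \<Rightarrow>\<^sub>0 'k) \<Rightarrow> int \<Rightarrow> bool"
  where "rigid_coeff p K c \<Lambda> \<xi> n \<longleftrightarrow>
    (\<forall>C\<in>normalized_ops p K. \<forall>F F'.
      exceptional_expansion p c \<Lambda> \<xi> F \<longrightarrow>
      exceptional_expansion p c \<Lambda> (apply_op C \<xi>) F' \<longrightarrow>
      fls_nth F' n = fls_nth F n)"

end

theory Submission
  imports Defs "HOL-Number_Theory.Cong" "HOL-Computational_Algebra.Polynomial_FPS"
begin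

text \<open>
  Two facts about the multiplier \<open>H = \<Sum>c\<^sub>m \<langle>m\<rangle> ^ (s + 1)\<close> of the exceptional component carry the proof: at
  \<open>s = - 1\<close> it equals \<open>\<Sum>c\<^sub>m = 1\<close>, which fixes the residue, and everything else about it, together with the
  multipliers of the other components, can be prescribed by polynomial interpolation.

  The refinement \<open>R\<^sub>m\<close> replaces \<open>\<nu>\<^sub>\<xi>\<close> by \<open>m\<close> times its push-forward under multiplication by \<open>m\<close>. This is the
  distribution relation for \<open>z ^ a / (1 - z ^ (p ^ n))\<close>, summed over the \<open>m\<close>-th roots of \<open>z\<close>
  (\<open>sum_roots_distribution\<close>, \<open>nu_root_distribution\<close>). Push-forward is convolution with a Dirac measure, and
  integration against a character of \<open>G\<close> turns convolution into multiplication (\<open>integral_conv\<close>). Hence the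
  exceptional component of \<open>C \<xi>\<close> is \<open>\<Sum>c\<^sub>m m \<chi>(m) = \<Sum>c\<^sub>m \<langle>m\<rangle> ^ (s + 1)\<close> times the one of \<open>\<xi>\<close>, where
  \<open>\<chi> = \<omega>\<inverse>\<langle>x\<rangle>\<^sup>s\<close> (\<open>pm_mellin_apply_op\<close>). Dividing by the denominator \<open>r\<^sub>c\<close> is harmless because its
  integral \<open>1 - \<langle>c\<rangle> ^ (s + 1)\<close> vanishes only at \<open>s = - 1\<close>.

  To prescribe jets it suffices to use \<open>m = (1 + p) ^ i\<close>. Then \<open>\<ell>\<^sub>m = i\<close>, and with \<open>P = \<Sum>c\<^sub>i X ^ i\<close> the
  multiplier on the component \<open>e\<close> is \<open>P((1 + p) ^ e (1 + Y))\<close>, a Taylor expansion of one polynomial at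
  the point \<open>(1 + p) ^ e\<close>. These points are distinct, so Hermite interpolation prescribes all jets independently
  (\<open>hermite_interpolation\<close>). On the exceptional component the required jet is the quotient of the target by
  the expansion of \<open>\<xi>\<close>; equal residues give it the constant term 1, and this is \<open>P(1) = \<Sum>c\<^sub>i = 1\<close>.

  For the coefficients of \<open>P\<close> to lie in \<open>K\<close>, the expansion of \<open>\<xi>\<close> must have its coefficients there. They are
  limits built from the values at \<open>s = p ^ k - 1\<close> (\<open>fps_nth_limit\<close>), and \<open>K\<close> is closed because it is
  finite-dimensional over a complete field (\<open>closed_field_span\<close>). The values lie in \<open>K\<close> because \<open>\<nu>\<^sub>\<xi>\<close>
  is explicit, while a measure with rational moments has values in the p-adic numbers by Mahler's expansion of
  locally constant functions (\<open>mahler_approximation\<close>).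

  Integrals are limits of Riemann sums over cosets, whose errors the ultrametric inequality bounds by the
  oscillation of the integrand. Identities for p-adic powers and logarithms are obtained from natural exponents
  by continuity.
\<close>

section \<open>Ultrametric analysis\<close>

lemma absv_mult: "absv (x * y) = absv x * absv y"
  for x :: "'k::complete_ultrametric_field"
  by (rule dist_mult_zero)

lemma absv_zero_iff [simp]: "absv x = 0 \<longleftrightarrow> x = 0"
  for x :: "'k::complete_ultrametric_field"
  by simp

lemma absv_one [simp]: "absv (1::'k::complete_ultrametric_field) = 1"
  using dist_mult_zero[of 1 "1::'k"] by simp

lemma absv_minus [simp]: "absv (- x) = absv x"
  for x :: "'k::complete_ultrametric_field"
  using dist_eq_dist_diff[of 0 x] by (simp add: dist_commute)

lemma absv_diff_commute: "absv (x - y) = absv (y - x)"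
  for x :: "'k::complete_ultrametric_field"
  by (metis absv_minus minus_diff_eq)

lemma absv_diff_le_max: "absv (x - y) \<le> max (absv x) (absv y)"
  for x :: "'k::complete_ultrametric_field"
  using dist_add_zero_le_max[of x "- y"] by simp

lemma absv_add_le: "absv x \<le> r \<Longrightarrow> absv y \<le> r \<Longrightarrow> absv (x + y) \<le> r"
  for x :: "'k::complete_ultrametric_field"
  using dist_add_zero_le_max[of x y] by linarith

lemma absv_diff_le: "absv x \<le> r \<Longrightarrow> absv y \<le> r \<Longrightarrow> absv (x - y) \<le> r"
  for x :: "'k::complete_ultrametric_field"
  using absv_diff_le_max[of x y] by linarith

lemma absv_add_less: "absv x < r \<Longrightarrow> absv y < r \<Longrightarrow> absv (x + y) < r"
  for x :: "'k::complete_ultrametric_field"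
  using dist_add_zero_le_max[of x y] by linarith

lemma absv_diff_trans: "absv (x - y) \<le> r \<Longrightarrow> absv (y - z) \<le> r \<Longrightarrow> absv (x - z) \<le> r"
  for x :: "'k::complete_ultrametric_field"
  using absv_add_le[of "x - y" r "y - z"] by simp

lemma absv_power: "absv (x ^ n) = absv x ^ n"
  for x :: "'k::complete_ultrametric_field"
  by (induction n) (auto simp: absv_mult)

lemma absv_inverse: "absv (inverse x) = inverse (absv x)"
  for x :: "'k::complete_ultrametric_field"
proof (cases "x = 0")
  case False
  then have "absv x * absv (inverse x) = 1"
    by (simp flip: absv_mult)
  then show ?thesis
    by (metis inverse_unique)
qed simp

lemma absv_divide: "absv (x / y) = absv x / absv y"
  for x :: "'k::complete_ultrametric_field"
  by (simp add: divide_inverse absv_mult absv_inverse)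

lemma absv_of_nat_le: "absv (of_nat n :: 'k::complete_ultrametric_field) \<le> 1"
  by (induction n) (auto intro!: absv_add_le)

lemma absv_of_int_le: "absv (of_int n :: 'k::complete_ultrametric_field) \<le> 1"
  by (cases n rule: int_cases2) (auto simp: absv_of_nat_le)

lemma absv_eq_of_diff_less: "absv (x - y) < absv y \<Longrightarrow> absv x = absv y"
  for x :: "'k::complete_ultrametric_field"
  using dist_add_zero_le_max[of "x - y" y] absv_diff_le_max[of x "x - y"] by (auto simp: max_def split: if_splits)

lemma absv_sum_le:
  fixes f :: "'i \<Rightarrow> 'k::complete_ultrametric_field"
  assumes "\<And>i. i \<in> A \<Longrightarrow> absv (f i) \<le> B" "0 \<le> B"
  shows "absv (sum f A) \<le> B"
proof (cases "finite A")
  case True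
  then show ?thesis
    using assms by (induction A rule: finite_induct) (auto intro!: absv_add_le)
qed (use assms in simp)

lemma absv_power_diff_le:
  fixes x y :: "'k::complete_ultrametric_field"
  assumes "absv x \<le> 1" "absv y \<le> 1"
  shows "absv (x ^ n - y ^ n) \<le> absv (x - y)"
proof (induction n)
  case (Suc n)
  have "x ^ Suc n - y ^ Suc n = x * (x ^ n - y ^ n) + (x - y) * y ^ n"
    by (simp add: algebra_simps)
  moreover have "absv (x * (x ^ n - y ^ n)) \<le> absv (x - y)"
    using mult_mono[OF assms(1) Suc] by (simp add: absv_mult)
  moreover have "absv ((x - y) * y ^ n) \<le> absv (x - y)"
    using assms(2) by (simp add: absv_mult absv_power mult_right_le_one_le power_le_one)
  ultimately show ?case
    by (simp add: absv_add_le)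
qed simp

lemma tendsto_iff_absv:
  "(f \<longlongrightarrow> l) G \<longleftrightarrow> ((\<lambda>x. absv (f x - l)) \<longlongrightarrow> 0) G"
  for l :: "'k::complete_ultrametric_field"
  by (subst tendsto_dist_iff, subst dist_eq_dist_diff) simp

lemma tendsto_absv_bound:
  fixes l :: "'k::complete_ultrametric_field"
  assumes "(g \<longlongrightarrow> 0) G" "eventually (\<lambda>x. absv (f x - l) \<le> g x) G"
  shows "(f \<longlongrightarrow> l) G"
  unfolding tendsto_iff_absv
  by (rule tendsto_sandwich[OF _ assms(2) tendsto_const assms(1)]) auto

text \<open>These instances make the general limit theorems for topological groups and semigroups
  applicable.\<close>

instance complete_ultrametric_field \<subseteq> topological_ab_group_add
proof
  fix a b :: 'a
  show "((\<lambda>x. fst x + snd x) \<longlongrightarrow> a + b) (nhds a \<times>\<^sub>F nhds b)"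
  proof (rule tendsto_absv_bound)
    have 1: "((\<lambda>x. fst x) \<longlongrightarrow> a) (nhds a \<times>\<^sub>F nhds b)" "((\<lambda>x. snd x) \<longlongrightarrow> b) (nhds a \<times>\<^sub>F nhds b)"
      by (auto intro: filterlim_fst filterlim_snd)
    show "((\<lambda>x. absv (fst x - a) + absv (snd x - b)) \<longlongrightarrow> 0) (nhds a \<times>\<^sub>F nhds b)"
      using tendsto_add[OF 1(1)[unfolded tendsto_iff_absv] 1(2)[unfolded tendsto_iff_absv]] by simp
    show "\<forall>\<^sub>F x in nhds a \<times>\<^sub>F nhds b. absv (fst x + snd x - (a + b)) \<le> absv (fst x - a) + absv (snd x - b)"
    proof (rule always_eventually, rule allI)
      fix x :: "'a \<times> 'a"
      have "fst x + snd x - (a + b) = (fst x - a) + (snd x - b)" by simp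
      then show "absv (fst x + snd x - (a + b)) \<le> absv (fst x - a) + absv (snd x - b)"
        using dist_add_zero_le_max[of "fst x - a" "snd x - b"] zero_le_dist[of "fst x - a" 0]
          zero_le_dist[of "snd x - b" 0] by (simp only: max_def split: if_splits)
    qed
  qed
  show "(uminus \<longlongrightarrow> - a) (nhds a)"
    unfolding tendsto_iff_absv
    using filterlim_ident[of "nhds a", unfolded tendsto_iff_absv] absv_diff_commute[of _ a]
    by (simp add: algebra_simps)
qed

instance complete_ultrametric_field \<subseteq> topological_semigroup_mult
proof
  fix a b :: 'a
  show "((\<lambda>x. fst x * snd x) \<longlongrightarrow> a * b) (nhds a \<times>\<^sub>F nhds b)"
  proof (rule tendsto_absv_bound)
    have 1: "((\<lambda>x. fst x) \<longlongrightarrow> a) (nhds a \<times>\<^sub>F nhds b)" "((\<lambda>x. snd x) \<longlongrightarrow> b) (nhds a \<times>\<^sub>F nhds b)"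
      by (auto intro: filterlim_fst filterlim_snd)
    note 2 = 1[unfolded tendsto_iff_absv]
    have "((\<lambda>x. absv (fst x - a) * absv (snd x - b) + absv a * absv (snd x - b) + absv (fst x - a) * absv b) \<longlongrightarrow>
       0 * 0 + absv a * 0 + 0 * absv b) (nhds a \<times>\<^sub>F nhds b)"
      by (intro tendsto_intros 2)
    then show "((\<lambda>x. absv (fst x - a) * absv (snd x - b) + absv a * absv (snd x - b) + absv (fst x - a) * absv b) \<longlongrightarrow> 0)
       (nhds a \<times>\<^sub>F nhds b)" by simp
    show "\<forall>\<^sub>F x in nhds a \<times>\<^sub>F nhds b. absv (fst x * snd x - a * b)
       \<le> absv (fst x - a) * absv (snd x - b) + absv a * absv (snd x - b) + absv (fst x - a) * absv b"
    proof (rule always_eventually, rule allI)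
      fix x :: "'a \<times> 'a"
      let ?u = "(fst x - a) * (snd x - b)" and ?v = "a * (snd x - b)" and ?w = "(fst x - a) * b"
      have *: "fst x * snd x - a * b = ?u + ?v + ?w"
        by (simp add: algebra_simps)
      have "absv (?u + ?v + ?w) \<le> absv ?u + absv ?v + absv ?w"
        using dist_add_zero_le_max[of "?u + ?v" ?w] dist_add_zero_le_max[of ?u ?v]
          zero_le_dist[of ?u 0] zero_le_dist[of ?v 0] zero_le_dist[of ?w 0] by linarith
      then show "absv (fst x * snd x - a * b)
       \<le> absv (fst x - a) * absv (snd x - b) + absv a * absv (snd x - b) + absv (fst x - a) * absv b"
        unfolding * by (simp add: absv_mult)
    qed
  qed
qed

lemma tendsto_absv: "(f \<longlongrightarrow> l) G \<Longrightarrow> ((\<lambda>x. absv (f x)) \<longlongrightarrow> absv l) G"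
  for l :: "'k::complete_ultrametric_field"
  by (intro tendsto_intros)

lemma absv_lim_le:
  fixes l :: "'k::complete_ultrametric_field"
  assumes "f \<longlonglongrightarrow> l" "eventually (\<lambda>n. absv (f n) \<le> B) sequentially"
  shows "absv l \<le> B"
  by (rule tendsto_upperbound[OF tendsto_absv[OF assms(1)] assms(2)]) simp

text \<open>The distance between two late terms is at most the largest of the steps between them, so the
  steps need not be summable for the sequence to be Cauchy.\<close>

lemma convergent_ultrametric:
  fixes f :: "nat \<Rightarrow> 'k::complete_ultrametric_field"
  assumes "(\<lambda>n. f (Suc n) - f n) \<longlonglongrightarrow> 0"
  shows "\<exists>l. f \<longlonglongrightarrow> l"
proof -
  have "Cauchy f"
  proof (rule metric_CauchyI)
    fix e :: real assume "e > 0"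
    then have "eventually (\<lambda>n. absv (f (Suc n) - f n) < e) sequentially"
      using assms by (auto simp: tendsto_iff)
    then obtain N where N: "\<And>n. n \<ge> N \<Longrightarrow> absv (f (Suc n) - f n) < e"
      by (auto simp: eventually_sequentially)
    have *: "absv (f (N + k) - f N) < e" for k
    proof (induction k)
      case (Suc k)
      then show ?case
        using absv_add_less[OF N[of "N + k"], of "f (N + k) - f N"] by simp
    qed (use \<open>e > 0\<close> in simp)
    have "dist (f m) (f n) < e" if "m \<ge> N" "n \<ge> N" for m n
    proof -
      have "absv (f m - f N) < e" "absv (f N - f n) < e"
        using *[of "m - N"] *[of "n - N"] that absv_diff_commute[of "f N" "f n"] by auto
      then show ?thesis
        using absv_add_less[of "f m - f N" e "f N - f n"] dist_eq_dist_diff[of "f m" "f n"] by simp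
    qed
    then show "\<exists>M. \<forall>m\<ge>M. \<forall>n\<ge>M. dist (f m) (f n) < e" by blast
  qed
  then show ?thesis
    using Cauchy_convergent convergent_def by blast
qed

lemma summable_ultrametric:
  fixes f :: "nat \<Rightarrow> 'k::complete_ultrametric_field"
  assumes "f \<longlonglongrightarrow> 0"
  shows "summable f"
  unfolding summable_def sums_def
  by (rule convergent_ultrametric) (use assms in simp)

lemma sums_tendsto_zero:
  fixes f :: "nat \<Rightarrow> 'k::complete_ultrametric_field"
  assumes "f sums l"
  shows "f \<longlonglongrightarrow> 0"
proof -
  have "(\<lambda>n. (\<Sum>i<Suc n. f i) - (\<Sum>i<n. f i)) \<longlonglongrightarrow> l - l"
    using assms unfolding sums_def by (intro tendsto_diff LIMSEQ_Suc)
  then show ?thesis by simp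
qed

lemma absv_sums_le:
  fixes f :: "nat \<Rightarrow> 'k::complete_ultrametric_field"
  assumes "f sums l" "\<And>n. absv (f n) \<le> B"
  shows "absv l \<le> B"
proof (rule absv_lim_le[OF assms(1)[unfolded sums_def]])
  have "0 \<le> B" using assms(2)[of 0] zero_le_dist[of "f 0" 0] by linarith
  then show "\<forall>\<^sub>F n in sequentially. absv (sum f {..<n}) \<le> B"
    by (auto intro!: always_eventually absv_sum_le assms)
qed

lemma sums_cmult:
  fixes f :: "nat \<Rightarrow> 'k::complete_ultrametric_field"
  assumes "f sums l" shows "(\<lambda>n. c * f n) sums (c * l)"
  using tendsto_mult[OF tendsto_const assms[unfolded sums_def], of c]
  by (simp add: sums_def sum_distrib_left)

text \<open>The tail of a series is bounded by the largest of its terms. Dominated convergence therefore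
  holds for a dominating sequence that merely tends to zero. It is what makes p-adic powers continuous in
  the exponent and evaluates the limit that defines the logarithm.\<close>

lemma suminf_dominated_convergence:
  fixes f :: "nat \<Rightarrow> nat \<Rightarrow> 'k::complete_ultrametric_field"
  assumes lim: "\<And>n. (\<lambda>j. f j n) \<longlonglongrightarrow> g n"
    and dom: "\<And>j n. absv (f j n) \<le> t n" and t: "t \<longlonglongrightarrow> 0"
  shows "(\<lambda>j. suminf (f j)) \<longlonglongrightarrow> suminf g"
proof -
  have g: "absv (g n) \<le> t n" for n
    by (rule absv_lim_le[OF lim]) (use dom in simp)
  have sf: "f j sums suminf (f j)" for j
    by (intro summable_sums summable_ultrametric tendsto_absv_bound[OF t]) (use dom in simp)
  have sg: "g sums suminf g"
    by (intro summable_sums summable_ultrametric tendsto_absv_bound[OF t]) (use g in simp)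
  have d: "(\<lambda>n. f j n - g n) sums (suminf (f j) - suminf g)" for j
    using sums_add[OF sf[of j] sums_cmult[OF sg, of "-1"]] by simp
  show ?thesis
  proof (rule metric_LIMSEQ_I)
    fix e :: real assume "e > 0"
    then have "eventually (\<lambda>n. dist (t n) 0 < e / 2) sequentially"
      using t half_gt_zero unfolding tendsto_iff by blast
    then obtain N where N: "\<And>n. n \<ge> N \<Longrightarrow> t n < e / 2"
      by (force simp: eventually_sequentially dist_real_def)
    have "eventually (\<lambda>j. absv (f j n - g n) < e / 2) sequentially" for n
      using lim[of n, unfolded tendsto_iff_absv] \<open>e > 0\<close> unfolding tendsto_iff by (auto dest: spec[of _ "e/2"])
    then have "eventually (\<lambda>j. \<forall>n\<in>{..<N}. absv (f j n - g n) < e / 2) sequentially"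
      by (intro eventually_ball_finite) auto
    then obtain J where J: "\<And>j n. j \<ge> J \<Longrightarrow> n < N \<Longrightarrow> absv (f j n - g n) < e / 2"
      by (auto simp: eventually_sequentially)
    have "dist (suminf (f j)) (suminf g) < e" if "j \<ge> J" for j
    proof -
      have "absv (f j n - g n) \<le> e / 2" for n
      proof (cases "n < N")
        case False
        then have "t n < e / 2" using N by simp
        then show ?thesis
          using dom[of j n] g[of n] by (intro absv_diff_le) auto
      qed (use J[OF that] less_imp_le in blast)
      then have "absv (suminf (f j) - suminf g) \<le> e / 2"
        by (rule absv_sums_le[OF d])
      then show ?thesis
        using \<open>e > 0\<close> dist_eq_dist_diff[of "suminf (f j)" "suminf g"] by simp
    qed
    then show "\<exists>no. \<forall>n\<ge>no. dist (suminf (f n)) (suminf g) < e" by blast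
  qed
qed

lemma tendsto_gbinomial:
  fixes f :: "nat \<Rightarrow> 'k::complete_ultrametric_field"
  assumes "f \<longlonglongrightarrow> l"
  shows "(\<lambda>j. f j gchoose n) \<longlonglongrightarrow> (l gchoose n)"
proof -
  have "(\<lambda>j. inverse (fact n) * (\<Prod>i<n. f j - of_nat i)) \<longlonglongrightarrow> inverse (fact n) * (\<Prod>i<n. l - of_nat i)"
  proof (intro tendsto_mult tendsto_const)
    show "(\<lambda>j. \<Prod>i<n. f j - of_nat i) \<longlonglongrightarrow> (\<Prod>i<n. l - of_nat i)"
      by (induction n) (auto intro!: tendsto_mult tendsto_diff assms simp: algebra_simps)
  qed
  then show ?thesis
    by (simp add: gbinomial_prod_rev divide_inverse mult.commute atLeast0LessThan)
qed

section \<open>The p-adic integers inside the ambient field\<close>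

text \<open>The parameter \<open>ty\<close> only names the type of the ambient field.\<close>

locale padic_ambient =
  fixes p :: nat and ty :: "'k::complete_ultrametric_field itself"
  assumes prime_p: "prime p" and odd_p: "odd p"
    and absv_p: "absv (of_nat p :: 'k) = 1 / real p"
begin

abbreviation eps :: "nat \<Rightarrow> real" where "eps n \<equiv> (1 / real p) ^ n"

lemma p_ge_3: "p \<ge> 3"
  using prime_p odd_p prime_ge_2_nat[of p] by (cases "p = 2") auto

lemma eps_pos [simp]: "0 < eps n"
  using p_ge_3 by simp

lemma eps_nonneg [simp]: "0 \<le> eps n"
  by simp

lemma eps_le_one: "eps n \<le> 1"
  using p_ge_3 by (intro power_le_one) auto

lemma eps_antimono: "m \<le> n \<Longrightarrow> eps n \<le> eps m"
  using p_ge_3 by (intro power_decreasing) auto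

lemma eps_strict: "m < n \<Longrightarrow> eps n < eps m"
  using p_ge_3 by (intro power_strict_decreasing) auto

lemma eps_tendsto: "eps \<longlonglongrightarrow> 0"
  using p_ge_3 by (intro LIMSEQ_power_zero) auto

lemma eps_less_obtain: assumes "e > 0" obtains n where "eps n < e"
  using p_ge_3 real_arch_pow_inv[OF assms, of "1 / real p"] by auto

lemma absv_p_power: "absv (of_nat p ^ n :: 'k) = eps n"
  by (simp add: absv_power absv_p)

text \<open>In a Bezout relation \<open>u p + v k = 1\<close> the first summand is small, so the second is not.\<close>

lemma absv_of_int_coprime:
  assumes "\<not> int p dvd k" shows "absv (of_int k :: 'k) = 1"
proof -
  have "coprime (int p) k"
    using assms prime_p by (simp add: prime_imp_coprime)
  then obtain u v where "u * int p + v * k = 1"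
    using bezout_int[of "int p" k] by auto
  then have e: "of_int u * of_nat p + of_int v * of_int k = (1::'k)"
    by (metis of_int_1 of_int_add of_int_mult of_int_of_nat_eq)
  have 1: "absv (of_int u * of_nat p :: 'k) < 1"
  proof -
    have "absv (of_int u * of_nat p :: 'k) \<le> 1 * (1 / real p)"
      unfolding absv_mult absv_p by (intro mult_right_mono absv_of_int_le) simp
    then show ?thesis
      using eps_strict[of 0 1] by simp
  qed
  have "\<not> absv (of_int v * of_int k :: 'k) < 1"
    using absv_add_less[OF 1, of "of_int v * of_int k"] e by auto
  moreover have "absv (of_int v * of_int k :: 'k) \<le> absv (of_int k :: 'k)"
    by (simp add: absv_mult mult_left_le_one_le absv_of_int_le)
  ultimately show ?thesis
    using absv_of_int_le[of k, where 'k='k] by linarith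
qed

lemma absv_of_int_le_iff: "absv (of_int k :: 'k) \<le> eps n \<longleftrightarrow> int p ^ n dvd k"
proof (cases "k = 0")
  case False
  have nu: "\<not> is_unit (int p)" using prime_p by auto
  obtain j where j: "k = int p ^ multiplicity (int p) k * j" "\<not> int p dvd j"
    using multiplicity_decompose'[OF False nu] by blast
  define v where "v = multiplicity (int p) k"
  have "absv (of_int k :: 'k) = eps v"
    using absv_of_int_coprime[OF j(2)] by (subst j(1)) (simp add: absv_mult absv_p_power v_def)
  moreover have "eps v \<le> eps n \<longleftrightarrow> n \<le> v"
    using eps_antimono eps_strict by (metis linorder_not_le)
  moreover have "n \<le> v \<longleftrightarrow> int p ^ n dvd k"
    unfolding v_def using False nu by (simp add: power_dvd_iff_le_multiplicity)
  ultimately show ?thesis by simp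
qed simp

lemma absv_of_nat_diff_le_iff:
  "absv (of_nat a - of_nat b :: 'k) \<le> eps n \<longleftrightarrow> [a = b] (mod p ^ n)"
proof -
  have "(of_nat a - of_nat b :: 'k) = of_int (int a - int b)" by simp
  then show ?thesis
    by (metis absv_of_int_le_iff cong_iff_dvd_diff cong_int_iff of_nat_power)
qed

lemma absv_of_nat_coprime: "\<not> p dvd a \<Longrightarrow> absv (of_nat a :: 'k) = 1"
  using absv_of_int_coprime[of "int a"] by simp

lemma absv_of_nat_dvd: "p dvd a \<Longrightarrow> absv (of_nat a :: 'k) \<le> 1 / real p"
  using absv_of_nat_diff_le_iff[of a 0 1] by (simp add: cong_0_iff)

lemma absv_of_nat_ge:
  assumes "n > 0" shows "1 / real n \<le> absv (of_nat n :: 'k)"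
proof -
  have nu: "\<not> is_unit p" using prime_p by auto
  obtain j where j: "n = p ^ multiplicity p n * j" "\<not> p dvd j"
    using multiplicity_decompose'[OF _ nu, of n] assms by blast
  define v where "v = multiplicity p n"
  have "absv (of_nat n :: 'k) = eps v"
    using absv_of_nat_coprime[OF j(2)] by (subst j(1)) (simp add: absv_mult absv_p_power v_def)
  moreover have "p ^ v \<le> n"
    using assms by (intro dvd_imp_le) (auto simp: v_def multiplicity_dvd)
  then have "real p ^ v \<le> real n"
    by (metis of_nat_le_iff of_nat_power)
  then have "1 / real n \<le> 1 / real p ^ v"
    using p_ge_3 by (intro divide_left_mono) (use assms in auto)
  ultimately show ?thesis
    by (simp add: power_one_over)
qed

subsection \<open>The ring of p-adic integers\<close>

abbreviation ZZ :: "'k set" where "ZZ \<equiv> Zp"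
abbreviation G :: "'k set" where "G \<equiv> Zp_units"

lemma of_int_Zp [simp]: "of_int k \<in> ZZ"
  unfolding Zp_def by (meson Ints_of_int closure_subset subset_iff)

lemma of_nat_Zp [simp]: "of_nat k \<in> ZZ"
  using of_int_Zp[of "int k"] by simp

lemma zero_Zp [simp]: "0 \<in> ZZ" and one_Zp [simp]: "1 \<in> ZZ"
  using of_nat_Zp[of 0] of_nat_Zp[of 1] by auto

lemma closed_Zp: "closed ZZ"
  by (simp add: Zp_def)

lemma Zp_lim: "(\<And>n. f n \<in> ZZ) \<Longrightarrow> f \<longlonglongrightarrow> l \<Longrightarrow> l \<in> ZZ"
  using closed_Zp closed_sequentially by blast

lemma Zp_int_approx:
  assumes "x \<in> ZZ" shows "\<exists>k. absv (x - of_int k) \<le> eps n"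
proof -
  have "\<exists>y\<in>\<int>. dist y x < eps n"
    using assms unfolding Zp_def closure_approachable by auto
  then show ?thesis
    by (metis Ints_cases dist_commute dist_eq_dist_diff less_imp_le)
qed

lemma Zp_nat_approx:
  assumes "x \<in> ZZ" shows "\<exists>a<p ^ n. absv (x - of_nat a) \<le> eps n"
proof -
  obtain k where k: "absv (x - of_int k) \<le> eps n"
    using Zp_int_approx[OF assms] by blast
  define a where "a = nat (k mod int p ^ n)"
  have P: "int p ^ n > 0" using p_ge_3 by simp
  have a: "int a = k mod int p ^ n"
    using P by (simp add: a_def)
  have "int p ^ n dvd k - int a"
    unfolding a by (rule dvd_minus_mod)
  then have "absv (of_int (k - int a) :: 'k) \<le> eps n"
    by (simp only: absv_of_int_le_iff)
  then have "absv (of_int k - of_nat a :: 'k) \<le> eps n"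
    by (simp only: of_int_diff of_int_of_nat_eq)
  moreover have "a < p ^ n"
    using a P by (metis of_nat_less_iff of_nat_power pos_mod_bound)
  ultimately show ?thesis
    using absv_diff_trans[OF k] by blast
qed

lemma Zp_nat_approx_unique:
  assumes "absv (x - of_nat a :: 'k) \<le> eps n" "absv (x - of_nat b) \<le> eps n" "a < p ^ n" "b < p ^ n"
  shows "a = b"
proof -
  have "absv (of_nat a - of_nat b :: 'k) \<le> eps n"
    using absv_diff_trans[of "of_nat a" x "eps n" "of_nat b"] assms absv_diff_commute[of "of_nat a" x] by simp
  then show ?thesis
    using assms(3,4) by (simp add: absv_of_nat_diff_le_iff cong_less_modulus_unique_nat)
qed

lemma in_Zp_if_int_approx:
  assumes "\<And>n. \<exists>k. absv (x - of_int k) \<le> eps n" shows "x \<in> ZZ"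
  unfolding Zp_def closure_approachable
proof (intro allI impI)
  fix e :: real assume "e > 0"
  then obtain n where "eps n < e" using eps_less_obtain by blast
  moreover obtain k where "absv (x - of_int k) \<le> eps n" using assms by blast
  ultimately show "\<exists>y\<in>\<int>. dist y x < e"
    by (intro bexI[of _ "of_int k"]) (auto simp: dist_commute dist_eq_dist_diff[of x])
qed

lemma absv_Zp: "x \<in> ZZ \<Longrightarrow> absv x \<le> 1"
  using Zp_int_approx[of x 0] absv_add_le[of "x - of_int k" 1 "of_int k" for k] absv_of_int_le by force

lemma Zp_add: assumes "x \<in> ZZ" "y \<in> ZZ" shows "x + y \<in> ZZ"
proof (rule in_Zp_if_int_approx)
  fix n
  obtain k l where "absv (x - of_int k) \<le> eps n" "absv (y - of_int l) \<le> eps n"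
    using Zp_int_approx assms by metis
  then have "absv (x + y - of_int (k + l)) \<le> eps n"
    using absv_add_le[of "x - of_int k" "eps n" "y - of_int l"] by (simp add: algebra_simps)
  then show "\<exists>k. absv (x + y - of_int k) \<le> eps n" by blast
qed

lemma Zp_mult: assumes "x \<in> ZZ" "y \<in> ZZ" shows "x * y \<in> ZZ"
proof (rule in_Zp_if_int_approx)
  fix n
  obtain k l where k: "absv (x - of_int k) \<le> eps n" and l: "absv (y - of_int l) \<le> eps n"
    using Zp_int_approx assms by metis
  have "absv ((x - of_int k) * y) \<le> eps n * 1"
    unfolding absv_mult by (intro mult_mono k absv_Zp assms) auto
  moreover have "absv (of_int k * (y - of_int l)) \<le> 1 * eps n"
    unfolding absv_mult by (intro mult_mono l absv_of_int_le) auto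
  moreover have "x * y - of_int (k * l) = (x - of_int k) * y + of_int k * (y - of_int l)"
    by (simp add: algebra_simps)
  ultimately have "absv (x * y - of_int (k * l)) \<le> eps n"
    by (simp add: absv_add_le)
  then show "\<exists>k. absv (x * y - of_int k) \<le> eps n" by blast
qed

lemma Zp_minus: "x \<in> ZZ \<Longrightarrow> - x \<in> ZZ"
  using Zp_mult[OF of_int_Zp[of "- 1"], of x] by simp

lemma Zp_diff: "x \<in> ZZ \<Longrightarrow> y \<in> ZZ \<Longrightarrow> x - y \<in> ZZ"
  using Zp_add[of x "- y"] Zp_minus by simp

lemma Zp_power: "x \<in> ZZ \<Longrightarrow> x ^ n \<in> ZZ"
  by (induction n) (auto intro: Zp_mult)

lemma Zp_div_p_power:
  assumes "x \<in> ZZ" "absv x \<le> eps n" shows "x / of_nat p ^ n \<in> ZZ"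
proof (rule in_Zp_if_int_approx)
  fix m
  obtain k where k: "absv (x - of_int k) \<le> eps (n + m)"
    using Zp_int_approx assms by metis
  then have "absv (of_int k :: 'k) \<le> eps n"
    using absv_diff_le[OF assms(2), of "x - of_int k"] eps_antimono[of n "n + m"] by simp
  then obtain j where j: "k = int p ^ n * j"
    using absv_of_int_le_iff by auto
  have p0: "(of_nat p ^ n :: 'k) \<noteq> 0" using p_ge_3 by simp
  have "x / of_nat p ^ n - of_int j = (x - of_int k) / of_nat p ^ n"
    using p0 by (simp add: j field_simps)
  then have "absv (x / of_nat p ^ n - of_int j) \<le> eps (n + m) / eps n"
    using k by (simp add: absv_divide absv_p_power divide_right_mono del: power_one_over)
  then show "\<exists>k. absv (x / of_nat p ^ n - of_int k) \<le> eps m"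
    using p_ge_3 by (auto simp: power_add)
qed

lemma Zp_coset_iff: "x \<in> Zp_coset p a n \<longleftrightarrow> x \<in> ZZ \<and> absv (x - of_nat a) \<le> eps n"
proof
  assume "x \<in> Zp_coset p a n"
  then obtain y where y: "y \<in> ZZ" "x = of_nat a + of_nat p ^ n * y"
    unfolding Zp_coset_def by blast
  have "of_nat p ^ n \<in> ZZ" by (simp add: Zp_power)
  then have "x \<in> ZZ" unfolding y(2) by (intro Zp_add Zp_mult y) auto
  moreover have "absv (x - of_nat a) \<le> eps n * 1"
    unfolding y(2) using absv_Zp[OF y(1)] by (simp add: absv_mult absv_p_power mult_left_le)
  ultimately show "x \<in> ZZ \<and> absv (x - of_nat a) \<le> eps n" by simp
next
  assume x: "x \<in> ZZ \<and> absv (x - of_nat a) \<le> eps n"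
  then have "(x - of_nat a) / of_nat p ^ n \<in> ZZ"
    by (intro Zp_div_p_power Zp_diff) auto
  moreover have "x = of_nat a + of_nat p ^ n * ((x - of_nat a) / of_nat p ^ n)"
    using p_ge_3 by simp
  ultimately show "x \<in> Zp_coset p a n"
    unfolding Zp_coset_def by blast
qed

text \<open>If \<open>x\<close> has absolute value 1, then the integers that approximate it are prime to \<open>p\<close>, and
  their inverses modulo \<open>p ^ n\<close> approximate \<open>inverse x\<close>.\<close>

lemma Zp_units_iff: "x \<in> G \<longleftrightarrow> x \<in> ZZ \<and> absv x = 1"
proof
  assume "x \<in> G"
  then have x: "x \<in> ZZ" "x \<noteq> 0" "inverse x \<in> ZZ" by (auto simp: Zp_units_def)
  have "absv x \<le> 1" "absv (inverse x) \<le> 1"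
    using absv_Zp x by blast+
  moreover have "absv x * absv (inverse x) = 1"
    using x(2) by (simp flip: absv_mult)
  ultimately have "absv x = 1"
    by (smt (verit) mult_left_le zero_le_dist)
  then show "x \<in> ZZ \<and> absv x = 1" using x by simp
next
  assume x: "x \<in> ZZ \<and> absv x = 1"
  have "inverse x \<in> ZZ"
  proof (rule in_Zp_if_int_approx)
    fix n
    obtain k where k: "absv (x - of_int k) \<le> eps (Suc n)"
      using Zp_int_approx x by metis
    have "\<not> int p dvd k"
    proof
      assume "int p dvd k"
      then have "absv (of_int k :: 'k) \<le> eps 1" using absv_of_int_le_iff[of k 1] by simp
      then have "absv x \<le> eps 1"
        using absv_add_le[of "x - of_int k" "eps 1" "of_int k"] k eps_antimono[of 1 "Suc n"] by simp
      then show False using x eps_strict[of 0 1] by simp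
    qed
    then have "coprime (int p) k"
      using prime_p by (simp add: prime_imp_coprime)
    then have "coprime k (int p ^ n)"
      by (simp add: ac_simps)
    then obtain b where "[k * b = 1] (mod int p ^ n)"
      using cong_solve_coprime_int by blast
    then have b: "absv (of_int (k * b - 1) :: 'k) \<le> eps n"
      by (simp only: absv_of_int_le_iff cong_iff_dvd_diff)
    have "absv ((x - of_int k) * of_int b) \<le> eps n * 1"
      unfolding absv_mult using k eps_antimono[of n "Suc n"]
      by (intro mult_mono absv_of_int_le) auto
    moreover have "x * of_int b - 1 = (x - of_int k) * of_int b + of_int (k * b - 1)"
      by (simp add: algebra_simps)
    ultimately have "absv (x * of_int b - 1) \<le> eps n"
      using absv_add_le[of "(x - of_int k) * of_int b" "eps n"] b by (metis mult.right_neutral)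
    moreover have "x * of_int b - 1 = - (x * (inverse x - of_int b))"
    proof -
      have "x \<noteq> 0" using x by auto
      then show ?thesis by (simp add: algebra_simps)
    qed
    ultimately have "absv (inverse x - of_int b) \<le> eps n"
      using x by (simp only: absv_minus absv_mult mult_1)
    then show "\<exists>k. absv (inverse x - of_int k) \<le> eps n" by blast
  qed
  then show "x \<in> G" using x by (auto simp: Zp_units_def)
qed

lemma Zp_units_Zp: "x \<in> G \<Longrightarrow> x \<in> ZZ"
  by (simp add: Zp_units_iff)

lemma Zp_units_mult: "x \<in> G \<Longrightarrow> y \<in> G \<Longrightarrow> x * y \<in> G"
  by (simp add: Zp_units_iff Zp_mult absv_mult)

lemma Zp_units_inverse: "x \<in> G \<Longrightarrow> inverse x \<in> G"
  by (auto simp: Zp_units_def)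

lemma Zp_units_divide: "x \<in> G \<Longrightarrow> y \<in> G \<Longrightarrow> x / y \<in> G"
  by (simp add: divide_inverse Zp_units_mult Zp_units_inverse)

lemma Zp_units_nonzero: "x \<in> G \<Longrightarrow> x \<noteq> 0"
  by (simp add: Zp_units_def)

lemma one_Zp_units [simp]: "1 \<in> G"
  by (simp add: Zp_units_iff)

lemma of_nat_Zp_units_iff: "of_nat a \<in> G \<longleftrightarrow> \<not> p dvd a"
  using absv_of_nat_coprime absv_of_nat_dvd[of a] eps_strict[of 0 1] by (auto simp: Zp_units_iff)

lemma Zp_units_cong:
  assumes "x \<in> G" "y \<in> ZZ" "absv (x - y) \<le> eps 1" shows "y \<in> G"
proof -
  have "absv (y - x) < absv x"
    using assms eps_strict[of 0 1] absv_diff_commute[of x y] by (simp add: Zp_units_iff)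
  then show ?thesis
    using absv_eq_of_diff_less[of y x] assms by (simp add: Zp_units_iff)
qed

lemma closed_Zp_units: "closed G"
  unfolding closed_sequential_limits
proof (intro allI impI, elim conjE)
  fix f l assume f: "\<forall>n. f n \<in> G" "f \<longlonglongrightarrow> l"
  have "l \<in> ZZ" by (rule Zp_lim[OF _ f(2)]) (use f(1) Zp_units_Zp in blast)
  moreover have "absv l = 1"
    using tendsto_absv[OF f(2)] f(1) by (simp add: Zp_units_iff LIMSEQ_const_iff)
  ultimately show "l \<in> G" by (simp add: Zp_units_iff)
qed

lemma compact_Zp: "compact ZZ"
  unfolding compact_eq_totally_bounded
proof (intro conjI allI impI)
  show "complete ZZ"
    using closed_Zp by (simp add: complete_eq_closed)
  fix e :: real assume "e > 0"
  then obtain n where n: "eps n < e" using eps_less_obtain by blast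
  show "\<exists>k. finite k \<and> ZZ \<subseteq> (\<Union>x\<in>k. ball x e)"
  proof (intro exI conjI subsetI)
    show "finite (of_nat ` {..<p ^ n} :: 'k set)" by simp
    fix x assume "x \<in> ZZ"
    then obtain a where "a < p ^ n" "absv (x - of_nat a) \<le> eps n" using Zp_nat_approx by blast
    then show "x \<in> (\<Union>x\<in>of_nat ` {..<p ^ n}. ball x e)"
      using n by (auto simp: dist_commute dist_eq_dist_diff[of x] intro!: bexI[of _ a])
  qed
qed

lemma Zp_nat_seq:
  assumes "x \<in> ZZ"
  shows "\<exists>a. (\<lambda>n. of_nat (a n)) \<longlonglongrightarrow> x"
proof -
  obtain a where a: "\<And>n. absv (x - of_nat (a n)) \<le> eps n"
    using Zp_nat_approx[OF assms] by metis
  have "absv (of_nat (a n) - x) \<le> eps n" for n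
    using a by (subst absv_diff_commute)
  then have "(\<lambda>n. of_nat (a n)) \<longlonglongrightarrow> x"
    by (intro tendsto_absv_bound[OF eps_tendsto] always_eventually allI)
  then show ?thesis by blast
qed

subsection \<open>Powers of principal units\<close>

lemma power_one_plus_approx:
  fixes y :: 'k
  assumes "absv y \<le> 1" shows "absv ((1 + y) ^ n - 1 - of_nat n * y) \<le> absv y ^ 2"
proof (induction n)
  case (Suc n)
  have "(1 + y) ^ Suc n - 1 - of_nat (Suc n) * y =
      (1 + y) * ((1 + y) ^ n - 1 - of_nat n * y) + of_nat n * y ^ 2"
    by (simp add: algebra_simps power2_eq_square)
  moreover have "absv ((1 + y) * ((1 + y) ^ n - 1 - of_nat n * y)) \<le> 1 * absv y ^ 2"
    unfolding absv_mult by (intro mult_mono Suc absv_add_le) (use assms in auto)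
  moreover have "absv (of_nat n * y ^ 2) \<le> 1 * absv y ^ 2"
    unfolding absv_mult absv_power by (intro mult_mono absv_of_nat_le) auto
  ultimately show ?case
    using absv_add_le by simp
qed simp

text \<open>For \<open>z = 1 + y\<close> the equation \<open>z ^ n = 1\<close> says that \<open>n y\<close>, which is as large as \<open>y\<close>, is
  at most of the size of \<open>y\<^sup>2\<close>.\<close>

lemma root_of_unity_near_one:
  fixes z :: 'k
  assumes "z ^ n = 1" "coprime n p" "absv (z - 1) < 1" shows "z = 1"
proof -
  define y where "y = z - 1"
  have n: "absv (of_nat n :: 'k) = 1"
    using assms(2) prime_p by (intro absv_of_nat_coprime) (metis coprime_absorb_right not_prime_unit)
  have y: "absv y < 1" using assms(3) by (simp add: y_def)
  have "absv ((1 + y) ^ n - 1 - of_nat n * y) \<le> absv y ^ 2"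
    by (intro power_one_plus_approx) (use y in simp)
  then have "absv y \<le> absv y ^ 2"
    using assms(1) n by (simp add: y_def absv_mult)
  moreover have "absv y * absv y < absv y * 1" if "absv y > 0"
    by (rule mult_strict_left_mono[OF y that])
  ultimately have "\<not> absv y > 0"
    unfolding power2_eq_square by linarith
  then have "y = 0" by simp
  then show ?thesis by (simp add: y_def)
qed

text \<open>In the binomial expansion of \<open>(1 + y) ^ p\<close> the linear term \<open>p y\<close> dominates: the other
  coefficients of degree less than \<open>p\<close> are divisible by \<open>p\<close>, and \<open>y ^ p\<close> is smaller than \<open>p y\<close>
  because \<open>p \<ge> 3\<close> and \<open>y\<close> is at most as large as \<open>p\<close>.\<close>

lemma absv_power_p_minus_one:
  fixes u :: 'k
  assumes "absv (u - 1) \<le> eps 1" shows "absv (u ^ p - 1) = absv (u - 1) / real p"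
proof (cases "u = 1")
  case False
  define y where "y = u - 1"
  have y: "absv y \<le> eps 1" "absv y > 0" "absv y \<le> 1"
    using assms False eps_le_one[of 1] by (auto simp: y_def)
  have y2: "absv y ^ i \<le> absv y * eps 2" if "i \<ge> 3" for i
  proof -
    define j where "j = i - 3"
    have "i = Suc (Suc (Suc j))"
      using that by (simp add: j_def)
    then have "absv y ^ i = absv y * absv y ^ 2 * absv y ^ j" by (simp add: power2_eq_square)
    also have "\<dots> \<le> absv y * eps 1 ^ 2 * 1"
      using y by (intro mult_mono power_mono power_le_one) auto
    finally show ?thesis by simp
  qed
  have "u ^ p = (\<Sum>i\<le>p. of_nat (p choose i) * y ^ i)"
    using binomial_ring[of y 1 p] by (simp add: y_def)
  also have "{..p} = insert 0 (insert 1 {2..p})" using p_ge_3 by auto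
  also have "(\<Sum>i\<in>insert 0 (insert 1 {2..p}). of_nat (p choose i) * y ^ i) =
      1 + (of_nat p * y + (\<Sum>i\<in>{2..p}. of_nat (p choose i) * y ^ i))"
    using p_ge_3 by simp
  finally have e: "u ^ p - 1 - of_nat p * y = (\<Sum>i\<in>{2..p}. of_nat (p choose i) * y ^ i)"
    by (simp add: algebra_simps)
  have "absv (of_nat (p choose i) * y ^ i) \<le> absv y * eps 2" if "i \<in> {2..p}" for i
  proof (cases "i = p")
    case True
    then show ?thesis using y2[of p] p_ge_3 by (simp add: absv_power)
  next
    case False
    then have "p dvd (p choose i)"
      using that prime_p by (intro dvd_choose_prime) auto
    then have 1: "absv (of_nat (p choose i) * y ^ i) \<le> eps 1 * absv y ^ i"
      unfolding absv_mult absv_power by (intro mult_right_mono) (use absv_of_nat_dvd in auto)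
    have "absv y ^ i \<le> absv y ^ 2"
      using that y by (intro power_decreasing) auto
    also have "absv y ^ 2 \<le> absv y * eps 1"
      unfolding power2_eq_square using y by (intro mult_left_mono) auto
    finally have "absv y ^ i \<le> absv y * eps 1" .
    then have "eps 1 * absv y ^ i \<le> eps 1 * (absv y * eps 1)"
      by (intro mult_left_mono) auto
    with 1 show ?thesis by (simp add: power2_eq_square)
  qed
  then have "absv (u ^ p - 1 - of_nat p * y) \<le> absv y * eps 2"
    unfolding e by (intro absv_sum_le) auto
  also have "absv y * eps 2 < absv (of_nat p * y)"
    using mult_strict_left_mono[OF eps_strict[of 1 2] y(2)] by (simp add: absv_mult absv_p)
  finally have "absv (u ^ p - 1) = absv (of_nat p * y)"
    by (rule absv_eq_of_diff_less)
  then show ?thesis by (simp add: absv_mult absv_p y_def)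
qed simp

lemma absv_principal: "absv (u - 1 :: 'k) \<le> eps 1 \<Longrightarrow> absv u = 1"
  using absv_eq_of_diff_less[of u 1] eps_strict[of 0 1] by simp

lemma principal_power: "absv (u - 1 :: 'k) \<le> eps 1 \<Longrightarrow> absv (u ^ n - 1) \<le> absv (u - 1)"
  using absv_power_diff_le[of u 1 n] by (simp add: absv_principal)

text \<open>The prime-to-p part of the exponent is handled by the linear term of the binomial expansion,
  the p-part by the contraction above.\<close>

lemma absv_power_minus_one:
  fixes u :: 'k
  assumes u: "absv (u - 1) \<le> eps 1"
  shows "absv (u ^ n - 1) = absv (of_nat n :: 'k) * absv (u - 1)"
proof (induction n rule: less_induct)
  case (less n)
  show ?case
  proof (cases "p dvd n")
    case True
    then obtain m where m: "n = m * p" by (metis dvdE mult.commute)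
    show ?thesis
    proof (cases "m = 0")
      case False
      have "absv ((u ^ m) ^ p - 1) = absv (u ^ m - 1) / real p"
        by (intro absv_power_p_minus_one) (use u principal_power[OF u, of m] in linarith)
      also have "absv (u ^ m - 1) = absv (of_nat m :: 'k) * absv (u - 1)"
        using False p_ge_3 by (intro less) (simp add: m)
      finally show ?thesis
        by (simp add: m power_mult absv_mult absv_p)
    qed (simp add: m)
  next
    case False
    define y where "y = u - 1"
    have n: "absv (of_nat n :: 'k) = 1" using absv_of_nat_coprime False .
    show ?thesis
    proof (cases "u = 1")
      case u1: False
      have y: "absv y < 1" "absv y > 0"
        using u eps_strict[of 0 1] u1 by (auto simp: y_def)
      have "absv ((1 + y) ^ n - 1 - of_nat n * y) \<le> absv y ^ 2"
        using y by (intro power_one_plus_approx) auto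
      also have "\<dots> < absv (of_nat n * y)"
        using y n by (simp add: absv_mult power2_eq_square)
      finally have "absv ((1 + y) ^ n - 1) = absv (of_nat n * y)"
        by (rule absv_eq_of_diff_less)
      then show ?thesis by (simp add: absv_mult y_def)
    qed simp
  qed
qed

lemma absv_gbinomial_le:
  assumes "s \<in> ZZ" shows "absv (s gchoose n) \<le> 1"
proof -
  obtain a where "(\<lambda>n. of_nat (a n)) \<longlonglongrightarrow> s" using Zp_nat_seq[OF assms] by blast
  from tendsto_gbinomial[OF this, of n]
  show ?thesis
    by (rule absv_lim_le) (simp add: absv_of_nat_le binomial_gbinomial[symmetric])
qed

lemma padic_pow_of_nat: "padic_pow u (of_nat n) = (u :: 'k) ^ n"
proof -
  have "padic_pow u (of_nat n) = (\<Sum>i\<le>n. (of_nat n gchoose i) * (u - 1) ^ i)"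
    unfolding padic_pow_def by (rule suminf_finite) (auto simp: binomial_gbinomial[symmetric] binomial_eq_0)
  then show ?thesis
    using binomial_ring[of "u - 1" 1 n] by (simp add: binomial_gbinomial)
qed

lemma padic_pow_tendsto:
  fixes u :: 'k
  assumes u: "absv (u - 1) \<le> eps 1" and f: "\<And>j. f j \<in> ZZ" "f \<longlonglongrightarrow> s"
  shows "(\<lambda>j. padic_pow u (f j)) \<longlonglongrightarrow> padic_pow u s"
  unfolding padic_pow_def
proof (rule suminf_dominated_convergence)
  show "(\<lambda>j. (f j gchoose n) * (u - 1) ^ n) \<longlonglongrightarrow> (s gchoose n) * (u - 1) ^ n" for n
    by (intro tendsto_mult tendsto_gbinomial f tendsto_const)
  show "eps \<longlonglongrightarrow> 0" by (rule eps_tendsto)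
  show "absv ((f j gchoose n) * (u - 1) ^ n) \<le> eps n" for j n
  proof -
    have "absv (u - 1) ^ n \<le> eps 1 ^ n" using u by (intro power_mono) auto
    then have "absv (f j gchoose n) * absv (u - 1) ^ n \<le> 1 * eps 1 ^ n"
      by (intro mult_mono absv_gbinomial_le f) auto
    then show ?thesis by (simp add: absv_mult absv_power)
  qed
qed

text \<open>All properties of p-adic powers follow from those of natural powers by approximating
  the exponent by natural numbers.\<close>

lemma padic_pow_nat_seq:
  assumes "s \<in> ZZ"
  obtains a where "(\<lambda>n. of_nat (a n)) \<longlonglongrightarrow> s" "\<And>u. absv (u - 1 :: 'k) \<le> eps 1 \<Longrightarrow> (\<lambda>n. u ^ a n) \<longlonglongrightarrow> padic_pow u s"
proof -
  obtain a where a: "(\<lambda>n. of_nat (a n)) \<longlonglongrightarrow> s" using Zp_nat_seq[OF assms] by blast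
  have "(\<lambda>n. u ^ a n) \<longlonglongrightarrow> padic_pow u s" if "absv (u - 1 :: 'k) \<le> eps 1" for u
    using padic_pow_tendsto[OF that _ a] by (simp add: padic_pow_of_nat)
  then show ?thesis using that a by blast
qed

lemma principal_mult:
  fixes u v :: 'k
  assumes "absv (u - 1) \<le> eps 1" "absv (v - 1) \<le> eps 1" shows "absv (u * v - 1) \<le> eps 1"
proof -
  have "absv (u * (v - 1)) \<le> eps 1"
    unfolding absv_mult using assms absv_principal by simp
  then show ?thesis
    using absv_add_le[of "u * (v - 1)" "eps 1" "u - 1"] assms(1) by (simp add: algebra_simps)
qed

lemma padic_pow_mult:
  fixes u v :: 'k
  assumes "absv (u - 1) \<le> eps 1" "absv (v - 1) \<le> eps 1" "s \<in> ZZ"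
  shows "padic_pow (u * v) s = padic_pow u s * padic_pow v s"
proof -
  obtain a where a: "\<And>u. absv (u - 1 :: 'k) \<le> eps 1 \<Longrightarrow> (\<lambda>n. u ^ a n) \<longlonglongrightarrow> padic_pow u s"
    using padic_pow_nat_seq[OF assms(3)] by blast
  have "(\<lambda>n. (u * v) ^ a n) \<longlonglongrightarrow> padic_pow u s * padic_pow v s"
    unfolding power_mult_distrib by (intro tendsto_mult a assms)
  then show ?thesis
    using a[OF principal_mult[OF assms(1,2)]] LIMSEQ_unique by blast
qed

lemma padic_pow_power:
  fixes u :: 'k
  assumes "absv (u - 1) \<le> eps 1" "s \<in> ZZ"
  shows "padic_pow (u ^ i) s = padic_pow u s ^ i"
proof -
  obtain a where a: "\<And>u. absv (u - 1 :: 'k) \<le> eps 1 \<Longrightarrow> (\<lambda>n. u ^ a n) \<longlonglongrightarrow> padic_pow u s"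
    using padic_pow_nat_seq[OF assms(2)] by blast
  show ?thesis
  proof (induction i)
    case 0
    have "(\<lambda>n. 1 ^ a n) \<longlonglongrightarrow> padic_pow (1::'k) s" by (rule a) simp
    then show ?case by (simp add: LIMSEQ_const_iff)
  next
    case (Suc i)
    have "absv (u ^ i - 1) \<le> eps 1" using principal_power[OF assms(1)] assms(1) by (meson order_trans)
    then show ?case
      using padic_pow_mult[OF assms(1) _ assms(2)] Suc by simp
  qed
qed

lemma padic_pow_plus_one:
  fixes u :: 'k
  assumes "absv (u - 1) \<le> eps 1" "s \<in> ZZ"
  shows "padic_pow u (s + 1) = u * padic_pow u s"
proof -
  obtain a where a: "(\<lambda>n. of_nat (a n)) \<longlonglongrightarrow> s" "\<And>u. absv (u - 1 :: 'k) \<le> eps 1 \<Longrightarrow> (\<lambda>n. u ^ a n) \<longlonglongrightarrow> padic_pow u s"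
    using padic_pow_nat_seq[OF assms(2)] by blast
  have "(\<lambda>n. of_nat (a n + 1)) \<longlonglongrightarrow> s + 1"
    unfolding of_nat_add by (intro tendsto_add a) auto
  then have "(\<lambda>n. u ^ (a n + 1)) \<longlonglongrightarrow> padic_pow u (s + 1)"
    using padic_pow_tendsto[OF assms(1), of "\<lambda>n. of_nat (a n + 1)" "s + 1"]
    by (simp only: padic_pow_of_nat of_nat_Zp simp_thms)
  moreover have "(\<lambda>n. u ^ (a n + 1)) \<longlonglongrightarrow> u * padic_pow u s"
    using tendsto_mult[OF tendsto_const a(2)[OF assms(1)], of u] by simp
  ultimately show ?thesis using LIMSEQ_unique by blast
qed

lemma absv_padic_pow_minus_one:
  fixes u :: 'k
  assumes "absv (u - 1) \<le> eps 1" "s \<in> ZZ"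
  shows "absv (padic_pow u s - 1) = absv s * absv (u - 1)"
proof -
  obtain a where a: "(\<lambda>n. of_nat (a n)) \<longlonglongrightarrow> s" "\<And>u. absv (u - 1 :: 'k) \<le> eps 1 \<Longrightarrow> (\<lambda>n. u ^ a n) \<longlonglongrightarrow> padic_pow u s"
    using padic_pow_nat_seq[OF assms(2)] by blast
  have "(\<lambda>n. absv (u ^ a n - 1)) \<longlonglongrightarrow> absv (padic_pow u s - 1)"
    by (intro tendsto_absv tendsto_diff a assms tendsto_const)
  moreover have "(\<lambda>n. absv (of_nat (a n) :: 'k) * absv (u - 1)) \<longlonglongrightarrow> absv s * absv (u - 1)"
    by (intro tendsto_mult tendsto_const tendsto_absv a)
  ultimately show ?thesis
    unfolding absv_power_minus_one[OF assms(1)] by (rule LIMSEQ_unique)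
qed

lemma padic_pow_eq_one_iff:
  fixes u :: 'k
  assumes "absv (u - 1) \<le> eps 1" "s \<in> ZZ"
  shows "padic_pow u s = 1 \<longleftrightarrow> s = 0 \<or> u = 1"
proof -
  have "padic_pow u s = 1 \<longleftrightarrow> absv (padic_pow u s - 1) = 0"
    by simp
  also have "\<dots> \<longleftrightarrow> s = 0 \<or> u = 1"
    unfolding absv_padic_pow_minus_one[OF assms] by simp
  finally show ?thesis .
qed

lemma padic_pow_diff_le:
  fixes u v :: 'k
  assumes "absv (u - 1) \<le> eps 1" "absv (v - 1) \<le> eps 1" "s \<in> ZZ"
  shows "absv (padic_pow u s - padic_pow v s) \<le> absv (u - v)"
proof -
  obtain a where a: "\<And>u. absv (u - 1 :: 'k) \<le> eps 1 \<Longrightarrow> (\<lambda>n. u ^ a n) \<longlonglongrightarrow> padic_pow u s"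
    using padic_pow_nat_seq[OF assms(3)] by blast
  have "(\<lambda>n. u ^ a n - v ^ a n) \<longlonglongrightarrow> padic_pow u s - padic_pow v s"
    by (intro tendsto_diff a assms)
  then show ?thesis
    by (rule absv_lim_le)
      (use absv_principal[OF assms(1)] absv_principal[OF assms(2)] in \<open>simp add: absv_power_diff_le\<close>)
qed

lemma padic_pow_Zp:
  assumes "absv (u - 1 :: 'k) \<le> eps 1" "u \<in> ZZ" "s \<in> ZZ"
  shows "padic_pow u s \<in> G"
proof -
  obtain a where a: "\<And>u. absv (u - 1 :: 'k) \<le> eps 1 \<Longrightarrow> (\<lambda>n. u ^ a n) \<longlonglongrightarrow> padic_pow u s"
    using padic_pow_nat_seq[OF assms(3)] by blast
  have "padic_pow u s \<in> ZZ"
    by (rule Zp_lim[OF _ a[OF assms(1)]]) (use assms Zp_power in blast)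
  moreover have "absv (padic_pow u s - 1) \<le> 1 * eps 1"
    unfolding absv_padic_pow_minus_one[OF assms(1,3)]
    by (intro mult_mono absv_Zp assms) auto
  ultimately show ?thesis
    using absv_principal[of "padic_pow u s"] by (simp add: Zp_units_iff)
qed

subsection \<open>The logarithm\<close>

text \<open>The difference quotient at exponent zero with step \<open>p ^ k\<close> is a binomial series with
  coefficients \<open>(p ^ k - 1 choose n) / (n + 1)\<close>, and \<open>(p ^ k - 1 choose n)\<close> tends to
  \<open>(- 1 choose n) = (- 1) ^ n\<close>. This description turns identities between powers into identities for
  the logarithm.\<close>

lemma padic_log_limit:
  fixes u :: 'k
  assumes u: "absv (u - 1) \<le> eps 1"
  shows "(\<lambda>k. (u ^ (p ^ k) - 1) / of_nat p ^ k) \<longlonglongrightarrow> padic_log u"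
proof -
  define y where "y = u - 1"
  define f where "f k n = (of_nat (p ^ k - 1) gchoose n) * y ^ Suc n / of_nat (Suc n)" for k n
  have fin: "suminf (f k) = (u ^ (p ^ k) - 1) / of_nat p ^ k" for k
  proof -
    define N where "N = p ^ k"
    have N: "N > 0" "(of_nat N :: 'k) = of_nat p ^ k" using p_ge_3 by (auto simp: N_def)
    have "suminf (f k) = (\<Sum>n<N. f k n)"
      unfolding f_def using N
      by (intro suminf_finite) (auto simp: binomial_gbinomial[symmetric] N_def[symmetric] binomial_eq_0 simp del: of_nat_diff of_nat_diff_if)
    also have "\<dots> = (\<Sum>n<N. of_nat (N choose Suc n) * y ^ Suc n / of_nat N)"
    proof (rule sum.cong[OF refl])
      fix n
      obtain M where M: "N = Suc M" using N(1) gr0_implies_Suc by blast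
      have "of_nat (Suc n) * of_nat (N choose Suc n) = (of_nat N :: 'k) * of_nat ((N - 1) choose n)"
        unfolding M by (metis Suc_times_binomial_eq diff_Suc_1 mult.commute of_nat_mult)
      moreover have "(of_nat (Suc n) :: 'k) \<noteq> 0" "(of_nat N :: 'k) \<noteq> 0"
        using N(1) by (auto simp del: of_nat_Suc)
      ultimately show "f k n = of_nat (N choose Suc n) * y ^ Suc n / of_nat N"
        unfolding f_def N_def[symmetric] binomial_gbinomial[symmetric]
        by (simp add: divide_simps del: of_nat_Suc power_Suc) (simp add: mult_ac)
    qed
    also have "\<dots> = (\<Sum>n<N. of_nat (N choose Suc n) * y ^ Suc n) / of_nat N"
      by (simp add: sum_divide_distrib)
    also have "(\<Sum>n<N. of_nat (N choose Suc n) * y ^ Suc n) = (\<Sum>i\<le>N. of_nat (N choose i) * y ^ i) - 1"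
      by (subst sum.atMost_shift) simp
    also have "(\<Sum>i\<le>N. of_nat (N choose i) * y ^ i) = u ^ N"
      using binomial_ring[of y 1 N] by (simp add: y_def)
    finally show ?thesis by (simp add: N N_def)
  qed
  have "(\<lambda>k. suminf (f k)) \<longlonglongrightarrow> suminf (\<lambda>n. (- 1) ^ n * y ^ Suc n / of_nat (Suc n))"
  proof (rule suminf_dominated_convergence)
    fix n
    have "(\<lambda>k. (of_nat (p ^ k - 1) :: 'k)) \<longlonglongrightarrow> - 1"
    proof (rule tendsto_absv_bound[OF eps_tendsto])
      have "absv (of_nat (p ^ k - 1) - - 1 :: 'k) \<le> eps k" for k
        using p_ge_3 by (simp add: of_nat_diff absv_p_power)
      then show "\<forall>\<^sub>F k in sequentially. absv (of_nat (p ^ k - 1) - - 1 :: 'k) \<le> eps k" by simp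
    qed
    from tendsto_gbinomial[OF this, of n]
    have "(\<lambda>k. (of_nat (p ^ k - 1) gchoose n :: 'k)) \<longlonglongrightarrow> (- 1) ^ n"
      using gbinomial_minus[of "1::'k" n] by (simp add: binomial_gbinomial[symmetric])
    from tendsto_mult[OF this tendsto_const[of "y ^ Suc n / of_nat (Suc n)"]]
    show "(\<lambda>k. f k n) \<longlonglongrightarrow> (- 1) ^ n * y ^ Suc n / of_nat (Suc n)"
      by (simp add: f_def del: of_nat_Suc power_Suc)
  next
    fix k n
    have "absv (y ^ Suc n) \<le> eps 1 ^ Suc n"
      unfolding absv_power using u by (intro power_mono) (auto simp: y_def)
    moreover have "1 / absv (of_nat (Suc n) :: 'k) \<le> real (Suc n)"
    proof -
      have "absv (of_nat (Suc n) :: 'k) > 0" by (simp del: of_nat_Suc)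
      then show ?thesis
        using absv_of_nat_ge[of "Suc n"] by (simp add: field_simps del: of_nat_Suc zero_less_dist_iff)
    qed
    \<comment> \<open>The denominator \<open>n + 1\<close> costs at most a factor \<open>n + 1\<close>, which the powers of \<open>1 / p\<close> absorb.\<close>
    ultimately have "absv (of_nat (p ^ k - 1) gchoose n :: 'k) * absv (y ^ Suc n) * (1 / absv (of_nat (Suc n) :: 'k))
       \<le> 1 * eps 1 ^ Suc n * real (Suc n)"
      by (intro mult_mono absv_gbinomial_le of_nat_Zp mult_nonneg_nonneg) auto
    then show "absv (f k n) \<le> real (Suc n) * (1 / real p) ^ Suc n"
      unfolding f_def by (simp add: absv_mult absv_divide mult_ac del: of_nat_Suc power_Suc)
  next
    have "(\<lambda>n. real n * (1 / real p) ^ n) \<longlonglongrightarrow> 0"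
      using p_ge_3 by (intro powser_times_n_limit_0) auto
    then show "(\<lambda>n. real (Suc n) * (1 / real p) ^ Suc n) \<longlonglongrightarrow> 0"
      by (rule LIMSEQ_Suc)
  qed
  then show ?thesis
    by (simp add: fin padic_log_def y_def)
qed

lemma padic_log_power:
  fixes u :: 'k
  assumes u: "absv (u - 1) \<le> eps 1"
  shows "padic_log (u ^ i) = of_nat i * padic_log u"
proof -
  have ui: "absv (u ^ i - 1) \<le> eps 1"
    using principal_power[OF u] u by (meson order_trans)
  have L1: "(\<lambda>k. ((u ^ i) ^ (p ^ k) - 1) / of_nat p ^ k - of_nat i * ((u ^ (p ^ k) - 1) / of_nat p ^ k)) \<longlonglongrightarrow> 0"
  proof (rule tendsto_absv_bound[OF eps_tendsto], rule always_eventually, rule allI)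
    fix k
    define v where "v = u ^ (p ^ k) - 1"
    have v: "absv v = eps k * absv (u - 1)"
      using absv_power_minus_one[OF u, of "p ^ k"] absv_p_power[of k] by (simp add: v_def)
    have "eps k * absv (u - 1) \<le> eps k * 1" using u eps_le_one[of 1] by (intro mult_left_mono) auto
    then have v1: "absv v \<le> eps k" using v by simp
    have "absv ((1 + v) ^ i - 1 - of_nat i * v) \<le> absv v ^ 2"
      by (intro power_one_plus_approx) (use v1 eps_le_one[of k] in linarith)
    also have "\<dots> \<le> eps k ^ 2" using v1 by (intro power_mono) auto
    finally have *: "absv ((1 + v) ^ i - 1 - of_nat i * v) / eps k \<le> eps k"
      using eps_pos[of k] by (simp add: divide_le_eq power2_eq_square del: eps_pos power_one_over)
    have "((u ^ i) ^ (p ^ k) - 1) / of_nat p ^ k - of_nat i * ((u ^ (p ^ k) - 1) / of_nat p ^ k)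
      = ((1 + v) ^ i - 1 - of_nat i * v) / of_nat p ^ k"
      by (simp add: v_def diff_divide_distrib right_diff_distrib mult.commute flip: power_mult)
    then show "absv (((u ^ i) ^ (p ^ k) - 1) / of_nat p ^ k - of_nat i * ((u ^ (p ^ k) - 1) / of_nat p ^ k) - 0) \<le> eps k"
      using * by (simp only: absv_divide absv_p_power diff_zero)
  qed
  have L2: "(\<lambda>k. ((u ^ i) ^ (p ^ k) - 1) / of_nat p ^ k - of_nat i * ((u ^ (p ^ k) - 1) / of_nat p ^ k))
     \<longlonglongrightarrow> padic_log (u ^ i) - of_nat i * padic_log u"
    by (intro tendsto_diff tendsto_mult tendsto_const padic_log_limit u ui)
  have "padic_log (u ^ i) - of_nat i * padic_log u = 0"
    using LIMSEQ_unique[OF L2 L1] .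
  then show ?thesis by simp
qed

lemma padic_log_nonzero:
  fixes u :: 'k
  assumes u: "absv (u - 1) \<le> eps 1" "u \<noteq> 1"
  shows "padic_log u \<noteq> 0"
proof -
  have "absv ((u ^ (p ^ k) - 1) / of_nat p ^ k) = absv (u - 1)" for k
    using absv_power_minus_one[OF u(1), of "p ^ k"] absv_p_power[of k] p_ge_3
    by (simp add: absv_divide)
  then have "absv (padic_log u) = absv (u - 1)"
    using tendsto_absv[OF padic_log_limit[OF u(1)]] by (simp add: LIMSEQ_const_iff)
  then show ?thesis using u(2) by auto
qed

subsection \<open>The Teichmueller character\<close>

lemma absv_fermat: "absv (of_nat a ^ p - of_nat a :: 'k) \<le> eps 1"
proof (induction a)
  case (Suc a)
  let ?x = "of_nat a :: 'k"
  have "(?x + 1) ^ p = (\<Sum>i\<le>p. of_nat (p choose i) * ?x ^ i)"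
    using binomial_ring[of ?x 1 p] by simp
  also have "{..p} = insert 0 (insert p {1..<p})" using p_ge_3 by auto
  also have "(\<Sum>i\<in>insert 0 (insert p {1..<p}). of_nat (p choose i) * ?x ^ i) =
      1 + (?x ^ p + (\<Sum>i\<in>{1..<p}. of_nat (p choose i) * ?x ^ i))"
    using p_ge_3 by simp
  finally have e: "of_nat (Suc a) ^ p - of_nat (Suc a) =
      (?x ^ p - ?x) + (\<Sum>i\<in>{1..<p}. of_nat (p choose i) * ?x ^ i)"
    by (simp add: add.commute)
  have "absv (of_nat (p choose i) * ?x ^ i) \<le> eps 1 * 1" if "i \<in> {1..<p}" for i
  proof -
    have "p dvd (p choose i)"
      using that prime_p by (intro dvd_choose_prime) auto
    then show ?thesis
      unfolding absv_mult absv_power using absv_of_nat_dvd absv_of_nat_le[of a, where 'k='k]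
      by (intro mult_mono power_le_one) auto
  qed
  then have "absv (\<Sum>i\<in>{1..<p}. of_nat (p choose i) * ?x ^ i) \<le> eps 1"
    by (intro absv_sum_le) auto
  then show ?case unfolding e using Suc by (rule absv_add_le[rotated])
qed (use p_ge_3 in \<open>simp add: power_0_left\<close>)

lemma principal_coset_iff: "x \<in> Zp_coset p (Suc 0) (Suc 0) \<longleftrightarrow> x \<in> ZZ \<and> absv (x - 1) \<le> 1 / real p"
  by (simp add: Zp_coset_iff)

lemma coprime_p_minus_1: "coprime (p - 1) p"
  using p_ge_3 coprime_diff_one_left_nat[of p] by simp

lemma teich_unique:
  fixes x w w' :: 'k
  assumes "x \<in> G" "w ^ (p - 1) = 1" "x / w \<in> Zp_coset p 1 1" "w' ^ (p - 1) = 1" "x / w' \<in> Zp_coset p 1 1"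
  shows "w = w'"
proof -
  have x0: "x \<noteq> 0" using assms(1) Zp_units_nonzero by blast
  have w0: "w \<noteq> 0" "w' \<noteq> 0"
    using assms(2,4) p_ge_3 by (auto simp: power_0_left)
  have a: "absv (x / w - 1) \<le> eps 1" "absv (x / w' - 1) \<le> eps 1"
    using assms(3,5) by (auto simp: principal_coset_iff)
  have "absv (x / w' - x / w) \<le> eps 1"
    using absv_diff_le[OF a(2,1)] by simp
  moreover have "x / w' - x / w = x / w * (w / w' - 1)"
    using w0 by (simp add: field_simps)
  ultimately have "absv (w / w' - 1) \<le> eps 1"
    using absv_principal[OF a(1)] by (simp only: absv_mult mult_1)
  then have "absv (w / w' - 1) < 1" using eps_strict[of 0 1] by simp
  moreover have "(w / w') ^ (p - 1) = 1"
    using assms(2,4) by (simp add: power_divide)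
  ultimately have "w / w' = 1"
    using root_of_unity_near_one coprime_p_minus_1 by blast
  then show ?thesis using w0 by simp
qed

lemma teichI:
  fixes x w :: 'k
  assumes "x \<in> G" "w ^ (p - 1) = 1" "x / w \<in> Zp_coset p 1 1"
  shows "teich p x = w"
  unfolding teich_def using assms teich_unique by (intro the_equality) blast+

text \<open>The representative is the limit of \<open>x ^ (p ^ n)\<close>. Successive terms differ by the factor
  \<open>u ^ (p ^ n)\<close> with \<open>u = x ^ (p - 1)\<close>, which tends to 1 since \<open>u\<close> is a principal unit by Fermat's
  little theorem.\<close>

lemma teich_exists:
  fixes x :: 'k
  assumes x: "x \<in> G" shows "\<exists>w. w \<in> G \<and> w ^ (p - 1) = 1 \<and> x / w \<in> Zp_coset p 1 1"
proof -
  have x0: "x \<noteq> 0" and x1: "absv x = 1" using x Zp_units_nonzero by (auto simp: Zp_units_iff)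
  define u where "u = x ^ (p - 1)"
  have uG: "x ^ n \<in> G" for n
    by (induction n) (auto intro: Zp_units_mult x)
  obtain a where a: "absv (x - of_nat a) \<le> eps 1"
    using Zp_nat_approx[OF Zp_units_Zp[OF x], of 1] by blast
  have u1: "absv (u - 1) \<le> eps 1"
  proof -
    have "absv (x ^ p - of_nat a ^ p) \<le> eps 1"
      using absv_power_diff_le[of x "of_nat a" p] a x1 absv_of_nat_le[of a, where 'k='k] by linarith
    from absv_diff_trans[OF absv_diff_trans[OF this absv_fermat], of x]
    have "absv (x ^ p - x) \<le> eps 1" using a absv_diff_commute[of x] by simp
    moreover have "x ^ p - x = x * (x ^ (p - 1) - 1)"
      using p_ge_3 by (cases p) (auto simp: algebra_simps)
    ultimately show ?thesis
      unfolding u_def by (simp add: absv_mult x1)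
  qed
  have step: "x ^ (p ^ Suc n) - x ^ (p ^ n) = x ^ (p ^ n) * (u ^ (p ^ n) - 1)" for n
  proof -
    have "p ^ Suc n = p ^ n + (p - 1) * p ^ n"
      using p_ge_3 by (cases p) auto
    then have "x ^ (p ^ Suc n) = x ^ (p ^ n) * u ^ (p ^ n)"
      unfolding u_def by (simp only: power_add power_mult)
    then show ?thesis
      by (simp only: right_diff_distrib mult_1_right)
  qed
  have sb: "absv (x ^ (p ^ Suc n) - x ^ (p ^ n)) \<le> eps (Suc n)" for n
  proof -
    have "absv (x ^ (p ^ Suc n) - x ^ (p ^ n)) = eps n * absv (u - 1)"
      unfolding step using absv_power_minus_one[OF u1, of "p ^ n"] absv_p_power[of n]
      by (simp add: absv_mult absv_power x1)
    also have "\<dots> \<le> eps n * eps 1" using u1 by (intro mult_left_mono) auto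
    finally show ?thesis by (simp add: mult.commute)
  qed
  have "(\<lambda>n. x ^ (p ^ Suc n) - x ^ (p ^ n)) \<longlonglongrightarrow> 0"
    by (rule tendsto_absv_bound[OF LIMSEQ_Suc[OF eps_tendsto]]) (use sb in simp)
  from convergent_ultrametric[OF this] obtain w where w: "(\<lambda>n. x ^ (p ^ n)) \<longlonglongrightarrow> w" by blast
  have wG: "w \<in> G"
    by (rule closed_sequentially[OF closed_Zp_units _ w]) (use uG in simp)
  then have w0: "w \<noteq> 0" and w1: "absv w = 1" using Zp_units_nonzero by (auto simp: Zp_units_iff)
  have d: "absv (x ^ (p ^ n) - x) \<le> eps 1" for n
  proof (induction n)
    case (Suc n)
    have "absv (x ^ (p ^ Suc n) - x ^ (p ^ n)) \<le> eps 1"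
      by (rule order_trans[OF sb eps_antimono]) simp
    then show ?case using Suc by (rule absv_diff_trans)
  qed simp
  have "absv (w - x) \<le> eps 1"
    by (rule absv_lim_le[OF tendsto_diff[OF w tendsto_const]]) (use d in simp)
  then have "absv (x / w - 1) \<le> eps 1"
    using w0 w1 absv_diff_commute[of w x] absv_divide[of "x - w" w] by (simp add: diff_divide_distrib)
  then have 1: "x / w \<in> Zp_coset p 1 1"
    using Zp_units_Zp[OF Zp_units_divide[OF x wG]] by (simp add: principal_coset_iff)
  have L1: "(\<lambda>n. x ^ (p ^ Suc n)) \<longlonglongrightarrow> w" using w by (rule LIMSEQ_Suc)
  moreover have "(\<lambda>n. (x ^ (p ^ n)) ^ k) \<longlonglongrightarrow> w ^ k" for k
    by (induction k) (auto intro!: tendsto_mult w)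
  then have "(\<lambda>n. (x ^ (p ^ n)) ^ p) \<longlonglongrightarrow> w ^ p" .
  moreover have "(x ^ (p ^ n)) ^ p = x ^ (p ^ Suc n)" for n
    by (simp add: power_mult[symmetric] mult.commute)
  ultimately have "(\<lambda>n. x ^ (p ^ Suc n)) \<longlonglongrightarrow> w ^ p" by (simp only:)
  from LIMSEQ_unique[OF this L1] have "w ^ p = w" .
  moreover have "w ^ p = w * w ^ (p - 1)"
    using p_ge_3 by (cases p) auto
  ultimately have "w ^ (p - 1) = 1" using w0 by simp
  then show ?thesis using wG 1 by blast
qed

lemma teich:
  assumes "x \<in> G"
  shows "teich p x \<in> G" "teich p x ^ (p - 1) = 1" "x / teich p x \<in> Zp_coset p 1 1"
  using teich_exists[OF assms] teichI[OF assms] by auto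

lemma principal:
  assumes "x \<in> G"
  shows "absv (principal p x - 1) \<le> eps 1" "principal p x \<in> G" "x = teich p x * principal p x"
  using teich[OF assms] assms Zp_units_divide[OF assms teich(1)[OF assms]] Zp_units_nonzero[OF teich(1)[OF assms]]
  by (auto simp: principal_coset_iff principal_def)

lemma teich_mult:
  assumes "x \<in> G" "y \<in> G" shows "teich p (x * y) = teich p x * teich p y"
proof (rule teichI)
  show "x * y \<in> G" using assms by (rule Zp_units_mult)
  show "(teich p x * teich p y) ^ (p - 1) = 1"
    using teich assms by (simp add: power_mult_distrib)
  have "x * y / (teich p x * teich p y) = principal p x * principal p y"
    by (simp add: principal_def)
  then show "x * y / (teich p x * teich p y) \<in> Zp_coset p 1 1"
    using principal(1,2)[OF assms(1)] principal(1,2)[OF assms(2)] principal_mult Zp_mult Zp_units_Zp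
    by (auto simp: principal_coset_iff)
qed

lemma principal_mult_eq:
  assumes "x \<in> G" "y \<in> G" shows "principal p (x * y) = principal p x * principal p y"
  by (simp add: principal_def teich_mult[OF assms])

lemma teich_cong:
  assumes "x \<in> G" "y \<in> G" "absv (x - y) \<le> eps 1" shows "teich p x = teich p y"
proof (rule teichI[OF assms(1) teich(2)[OF assms(2)]])
  have t: "teich p y \<in> G" using teich(1) assms(2) .
  have "absv (x / teich p y - y / teich p y) \<le> eps 1"
    using assms(3) t by (simp add: Zp_units_iff absv_divide flip: diff_divide_distrib)
  then have "absv (x / teich p y - 1) \<le> eps 1"
    using absv_diff_trans[of "x / teich p y" "y / teich p y" "eps 1" 1] teich(3)[OF assms(2)]
    by (simp add: principal_coset_iff)
  then show "x / teich p y \<in> Zp_coset p 1 1"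
    using Zp_units_Zp[OF Zp_units_divide[OF assms(1) t]] by (simp add: principal_coset_iff)
qed

lemma principal_of_principal:
  assumes "absv (u - 1) \<le> eps 1" "u \<in> ZZ" shows "principal p u = u"
proof -
  have "teich p u = 1"
    by (rule teichI) (use assms absv_principal in \<open>auto simp: principal_coset_iff Zp_units_iff\<close>)
  then show ?thesis by (simp add: principal_def)
qed

lemma one_plus_p: "absv (1 + of_nat p - 1 :: 'k) = eps 1" "1 + of_nat p \<in> ZZ" "1 + of_nat p \<noteq> (1::'k)"
  using Zp_add[OF one_Zp of_nat_Zp[of p]] p_ge_3 by (auto simp: absv_p)

lemma principal_one_plus_p_power: "principal p (of_nat ((1 + p) ^ i)) = ((1 + of_nat p) ^ i :: 'k)"
proof -
  have u: "absv (1 + of_nat p - 1 :: 'k) \<le> eps 1" using one_plus_p(1) by simp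
  have "absv ((1 + of_nat p) ^ i - 1 :: 'k) \<le> eps 1"
    using principal_power[OF u, of i] u by (meson order_trans)
  then have "principal p ((1 + of_nat p) ^ i :: 'k) = (1 + of_nat p) ^ i"
    by (intro principal_of_principal Zp_power one_plus_p)
  then show ?thesis by simp
qed

lemma ell_power_one_plus_p: "ell p ((1 + p) ^ i) = (of_nat i :: 'k)"
proof -
  have u: "absv (1 + of_nat p - 1 :: 'k) \<le> eps 1" using one_plus_p(1) by simp
  show ?thesis
    unfolding ell_def principal_one_plus_p_power padic_log_power[OF u]
    using padic_log_nonzero[OF u one_plus_p(3)] by simp
qed

end

context padic_ambient
begin

section \<open>Bounded measures and their integrals\<close>

subsection \<open>Clopen sets of finite level\<close>

text \<open>The two domains of integration. Both are unions of cosets modulo \<open>p\<close>, which is why levels and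
  Riemann sums are considered for \<open>n \<ge> 1\<close> only.\<close>

definition is_dom :: "'k set \<Rightarrow> bool"
  where "is_dom X \<longleftrightarrow> X = ZZ \<or> X = G"

definition has_level :: "'k set \<Rightarrow> nat \<Rightarrow> 'k set \<Rightarrow> bool"
  where "has_level X n U \<longleftrightarrow> U \<subseteq> X \<and> (\<forall>x\<in>X. \<forall>y\<in>X. absv (x - y) \<le> eps n \<longrightarrow> x \<in> U \<longrightarrow> y \<in> U)"

lemma is_dom_ZZ [simp]: "is_dom ZZ" and is_dom_G [simp]: "is_dom G"
  by (auto simp: is_dom_def)

lemma is_dom_subset: "is_dom X \<Longrightarrow> x \<in> X \<Longrightarrow> x \<in> ZZ"
  by (auto simp: is_dom_def Zp_units_Zp)

lemma is_dom_cong: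
  assumes "is_dom X" "x \<in> X" "y \<in> ZZ" "absv (x - y) \<le> eps n" "n \<ge> 1" shows "y \<in> X"
proof -
  have "absv (x - y) \<le> eps 1" using assms(4) eps_antimono[OF assms(5)] by (rule order_trans)
  then show ?thesis
    using assms Zp_units_cong by (auto simp: is_dom_def)
qed

lemma is_dom_compact: "is_dom X \<Longrightarrow> compact X"
  unfolding is_dom_def using compact_Zp closed_Zp_units Zp_units_Zp
  by (metis compact_Int_closed inf.absorb_iff2 subsetI)

lemma has_level_subset: "has_level X n U \<Longrightarrow> U \<subseteq> X"
  by (simp add: has_level_def)

lemma has_levelD:
  "has_level X n U \<Longrightarrow> x \<in> X \<Longrightarrow> y \<in> X \<Longrightarrow> absv (x - y) \<le> eps n \<Longrightarrow> x \<in> U \<longleftrightarrow> y \<in> U"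
  unfolding has_level_def by (metis absv_diff_commute)

lemma has_level_mono: "has_level X n U \<Longrightarrow> n \<le> m \<Longrightarrow> has_level X m U"
  unfolding has_level_def using eps_antimono order_trans by meson

lemma has_level_diff: "has_level X n U \<Longrightarrow> has_level X n (X - U)"
  unfolding has_level_def by (metis DiffD1 DiffD2 DiffI Diff_subset absv_diff_commute)

lemma has_level_Un: "has_level X n U \<Longrightarrow> has_level X n V \<Longrightarrow> has_level X n (U \<union> V)"
  unfolding has_level_def by blast

lemma has_level_openin:
  assumes "has_level X n U" shows "openin (top_of_set X) U"
  unfolding openin_euclidean_subtopology_iff
proof (intro conjI ballI)
  show "U \<subseteq> X" using assms by (rule has_level_subset)
  fix x assume x: "x \<in> U"
  have "y \<in> U" if "y \<in> X" "dist y x < eps n" for y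
  proof -
    have "absv (x - y) \<le> eps n"
      using that(2) dist_eq_dist_diff[of y x] absv_diff_commute[of x y] by simp
    then show ?thesis using assms x that(1) by (auto simp: has_level_def)
  qed
  then show "\<exists>e>0. \<forall>x'\<in>X. dist x' x < e \<longrightarrow> x' \<in> U"
    by (intro exI[of _ "eps n"]) auto
qed

lemma has_level_clopen: assumes "has_level X n U" shows "clopen_in X U"
  unfolding clopen_in_def closedin_def
  using has_level_openin[OF assms] has_level_openin[OF has_level_diff[OF assms]] has_level_subset[OF assms] by simp

text \<open>By compactness a clopen set and its complement have positive distance. All properties of
  measures can therefore be checked on the cosets modulo a power of \<open>p\<close>.\<close>

lemma clopen_has_level:
  assumes "is_dom X" "clopen_in X U" obtains n where "n \<ge> 1" "has_level X n U"
proof -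
  have c: "compact X" using assms(1) by (rule is_dom_compact)
  have "openin (top_of_set X) U" "openin (top_of_set X) (X - U)"
    using assms(2) by (auto simp: clopen_in_def closedin_def)
  then obtain S T where S: "open S" "U = X \<inter> S" and T: "open T" "X - U = X \<inter> T"
    unfolding openin_open by blast
  have cov: "X \<subseteq> \<Union>{S, T}" using S(2) T(2) by blast
  obtain d where d: "d > 0" "\<forall>x\<in>X. \<exists>W\<in>{S, T}. ball x d \<subseteq> W"
    by (rule Heine_Borel_lemma[OF c cov]) (use S(1) T(1) in auto)
  obtain n where n: "eps n < d" using eps_less_obtain[OF d(1)] by blast
  have "y \<in> U" if "x \<in> X" "y \<in> X" "absv (x - y) \<le> eps n" "x \<in> U" for x y
  proof -
    have "y \<in> ball x d" "x \<in> ball x d"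
      using that(3) n d(1) dist_eq_dist_diff[of x y] by auto
    then have "x \<in> S \<and> y \<in> S \<or> x \<in> T \<and> y \<in> T"
      using bspec[OF d(2) that(1)] by blast
    then show ?thesis using that(1,2,4) S(2) T(2) by blast
  qed
  then have "has_level X n U" unfolding has_level_def using S(2) by blast
  then have "has_level X (max 1 n) U" by (rule has_level_mono) simp
  then show ?thesis using that[of "max 1 n"] by simp
qed

lemma coset_has_level: assumes "is_dom X" shows "has_level X n (Zp_coset p a n \<inter> X)"
  unfolding has_level_def
proof (intro conjI ballI impI)
  fix x y assume a: "x \<in> X" "y \<in> X" "absv (x - y) \<le> eps n" "x \<in> Zp_coset p a n \<inter> X"
  then have "absv (y - of_nat a) \<le> eps n"
    using absv_diff_trans[of y x "eps n" "of_nat a"] absv_diff_commute[of x y] by (auto simp: Zp_coset_iff)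
  then show "y \<in> Zp_coset p a n \<inter> X"
    using a is_dom_subset[OF assms] by (auto simp: Zp_coset_iff)
qed auto

lemma coset_empty:
  assumes "is_dom X" "n \<ge> 1" "of_nat a \<notin> X" shows "Zp_coset p a n \<inter> X = {}"
proof -
  have False if "x \<in> Zp_coset p a n" "x \<in> X" for x
    using is_dom_cong[OF assms(1) that(2) of_nat_Zp[of a] _ assms(2)] that(1) assms(3)
    by (simp add: Zp_coset_iff)
  then show ?thesis by blast
qed

lemma of_nat_in_coset_iff:
  assumes "b < p ^ n" shows "(of_nat a :: 'k) \<in> Zp_coset p b n \<longleftrightarrow> a mod p ^ n = b"
  using assms unfolding Zp_coset_iff absv_of_nat_diff_le_iff by (auto simp: cong_def)

lemma absv_mod_diff: "absv (of_nat (a mod p ^ n) - of_nat a :: 'k) \<le> eps n"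
  unfolding absv_of_nat_diff_le_iff by (simp add: cong_def)

lemma of_nat_mod_dom:
  assumes "is_dom X" "n \<ge> 1" shows "of_nat (a mod p ^ n) \<in> X \<longleftrightarrow> of_nat a \<in> X"
  using is_dom_cong[OF assms(1) _ of_nat_Zp _ assms(2)] absv_mod_diff absv_diff_commute by metis

lemma clopen_Un:
  assumes "is_dom X" "clopen_in X U" "clopen_in X V" shows "clopen_in X (U \<union> V)"
  using assms(2,3) by (auto simp: clopen_in_def)

lemma clopen_empty [simp]: "clopen_in X {}"
  by (auto simp: clopen_in_def)

lemma clopen_coset: "is_dom X \<Longrightarrow> clopen_in X (Zp_coset p a n \<inter> X)"
  using coset_has_level has_level_clopen by blast

subsection \<open>Additivity\<close>

lemma bm_add:
  "\<mu> \<in> bounded_measures X \<Longrightarrow> clopen_in X U \<Longrightarrow> clopen_in X V \<Longrightarrow> U \<inter> V = {} \<Longrightarrow> \<mu> (U \<union> V) = \<mu> U + \<mu> V"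
  by (auto simp: bounded_measures_def)

lemma bm_empty [simp]: "\<mu> \<in> bounded_measures X \<Longrightarrow> \<mu> {} = 0"
  using bm_add[of \<mu> X "{}" "{}"] by simp

lemma bm_outside: "\<mu> \<in> bounded_measures X \<Longrightarrow> \<not> clopen_in X U \<Longrightarrow> \<mu> U = 0"
  by (auto simp: bounded_measures_def)

lemma bm_bound:
  fixes \<mu> :: "'k set \<Rightarrow> 'k"
  assumes "\<mu> \<in> bounded_measures X"
  obtains B where "B > 0" "\<And>U. absv (\<mu> U) \<le> B"
proof -
  obtain e where e: "\<forall>y\<in>range \<mu>. dist 0 y \<le> e"
    using assms bounded_any_center[of "range \<mu>" 0] by (auto simp: bounded_measures_def)
  show ?thesis
    by (rule that[of "max 1 e"]) (use e in \<open>auto simp: dist_commute le_max_iff_disj\<close>)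
qed

lemma bounded_measuresI:
  fixes \<mu> :: "'k set \<Rightarrow> 'k"
  assumes "\<And>U V. clopen_in X U \<Longrightarrow> clopen_in X V \<Longrightarrow> U \<inter> V = {} \<Longrightarrow> \<mu> (U \<union> V) = \<mu> U + \<mu> V"
    "\<And>U. \<not> clopen_in X U \<Longrightarrow> \<mu> U = 0" "\<And>U. clopen_in X U \<Longrightarrow> absv (\<mu> U) \<le> B"
  shows "\<mu> \<in> bounded_measures X"
proof -
  have "dist 0 (\<mu> U) \<le> max 0 B" for U
    using assms(2,3)[of U] by (cases "clopen_in X U") (auto simp: dist_commute le_max_iff_disj)
  then have "bounded (range \<mu>)"
    unfolding bounded_any_center[of _ 0] by blast
  then show ?thesis using assms(1,2) by (auto simp: bounded_measures_def)
qed

lemma bm_UN: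
  assumes "\<mu> \<in> bounded_measures X" "is_dom X" "finite I" "\<And>i. i \<in> I \<Longrightarrow> clopen_in X (A i)"
    "\<And>i j. i \<in> I \<Longrightarrow> j \<in> I \<Longrightarrow> i \<noteq> j \<Longrightarrow> A i \<inter> A j = {}"
  shows "clopen_in X (\<Union>i\<in>I. A i) \<and> \<mu> (\<Union>i\<in>I. A i) = (\<Sum>i\<in>I. \<mu> (A i))"
  using assms(3,4,5)
proof (induction I rule: finite_induct)
  case (insert i I)
  have IH: "clopen_in X (\<Union>i\<in>I. A i)" "\<mu> (\<Union>i\<in>I. A i) = (\<Sum>i\<in>I. \<mu> (A i))"
    using insert by auto
  have "A i \<inter> (\<Union>i\<in>I. A i) = {}"
    using insert.prems(2)[of i] insert.hyps(2) by fastforce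
  then show ?case
    using IH insert.hyps insert.prems(1)[of i] bm_add[OF assms(1), of "A i" "\<Union>i\<in>I. A i"] clopen_Un[OF assms(2), of "A i" "\<Union>i\<in>I. A i"]
    by simp
qed (use assms(1) in simp)

lemma level_decomposition:
  assumes "is_dom X" "has_level X n U" "n \<ge> 1"
  shows "U = (\<Union>b\<in>{b. b < p ^ n \<and> of_nat b \<in> U}. Zp_coset p b n \<inter> X)"
proof (intro subset_antisym subsetI)
  fix x assume x: "x \<in> U"
  then have xX: "x \<in> X" using has_level_subset assms(2) by blast
  obtain b where b: "b < p ^ n" "absv (x - of_nat b) \<le> eps n"
    using Zp_nat_approx[OF is_dom_subset[OF assms(1) xX]] by blast
  have bX: "of_nat b \<in> X" using is_dom_cong[OF assms(1) xX of_nat_Zp b(2) assms(3)] .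
  then have "of_nat b \<in> U" using has_levelD[OF assms(2) xX bX b(2)] x by simp
  moreover have "x \<in> Zp_coset p b n" using b is_dom_subset[OF assms(1) xX] by (simp add: Zp_coset_iff)
  ultimately show "x \<in> (\<Union>b\<in>{b. b < p ^ n \<and> of_nat b \<in> U}. Zp_coset p b n \<inter> X)"
    using b xX by blast
next
  fix x assume "x \<in> (\<Union>b\<in>{b. b < p ^ n \<and> of_nat b \<in> U}. Zp_coset p b n \<inter> X)"
  then obtain b where b: "of_nat b \<in> U" "x \<in> Zp_coset p b n" "x \<in> X" by blast
  then have "of_nat b \<in> X" using has_level_subset[OF assms(2)] by blast
  then show "x \<in> U" using has_levelD[OF assms(2) b(3)] b by (auto simp: Zp_coset_iff)
qed

lemma coset_disjoint:
  assumes "a < p ^ n" "b < p ^ n" "a \<noteq> b" shows "Zp_coset p a n \<inter> Zp_coset p b n = ({} :: 'k set)"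
  using Zp_nat_approx_unique[of _ a n b] assms by (auto simp: Zp_coset_iff)

lemma bm_level_sum:
  assumes "\<mu> \<in> bounded_measures X" "is_dom X" "has_level X n U" "n \<ge> 1"
  shows "\<mu> U = (\<Sum>b | b < p ^ n \<and> of_nat b \<in> U. \<mu> (Zp_coset p b n \<inter> X))"
proof -
  have "\<mu> (\<Union>b\<in>{b. b < p ^ n \<and> of_nat b \<in> U}. Zp_coset p b n \<inter> X) = (\<Sum>b | b < p ^ n \<and> of_nat b \<in> U. \<mu> (Zp_coset p b n \<inter> X))"
    by (rule bm_UN[OF assms(1,2), THEN conjunct2])
      (use clopen_coset[OF assms(2)] coset_disjoint in \<open>simp, blast, blast\<close>)
  then show ?thesis
    using level_decomposition[OF assms(2-4)] by simp
qed

subsection \<open>Riemann sums\<close>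

text \<open>A function enters the integral only through its values at natural numbers, so its oscillation is
  measured there as well.\<close>

definition riemann_sum :: "'k set \<Rightarrow> ('k \<Rightarrow> 'k) \<Rightarrow> ('k set \<Rightarrow> 'k) \<Rightarrow> nat \<Rightarrow> 'k"
  where "riemann_sum X f \<mu> n = (\<Sum>a<p ^ n. f (of_nat a) * \<mu> (Zp_coset p a n \<inter> X))"

definition osc_le :: "'k set \<Rightarrow> ('k \<Rightarrow> 'k) \<Rightarrow> nat \<Rightarrow> real \<Rightarrow> bool"
  where "osc_le X f n e \<longleftrightarrow> (\<forall>a b. of_nat a \<in> X \<longrightarrow> of_nat b \<in> X \<longrightarrow>
    absv (of_nat a - of_nat b :: 'k) \<le> eps n \<longrightarrow> absv (f (of_nat a) - f (of_nat b)) \<le> e)"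

definition unif_cont :: "'k set \<Rightarrow> ('k \<Rightarrow> 'k) \<Rightarrow> bool"
  where "unif_cont X f \<longleftrightarrow> (\<forall>e>0. \<exists>n. osc_le X f n e)"

lemma osc_le_mono: "osc_le X f n e \<Longrightarrow> n \<le> m \<Longrightarrow> osc_le X f m e"
  unfolding osc_le_def using eps_antimono order_trans by meson

text \<open>By additivity the sum of level \<open>n\<close> is a sum over the cosets of level \<open>n + 1\<close>, in which the
  representative \<open>b\<close> is replaced by \<open>b mod p ^ n\<close>.\<close>

lemma riemann_sum_step:
  assumes \<mu>: "\<mu> \<in> bounded_measures X" "is_dom X" and n: "n \<ge> 1"
    and osc: "osc_le X f n e" and B: "\<And>U. absv (\<mu> U) \<le> B" and e: "0 \<le> e"
  shows "absv (riemann_sum X f \<mu> (Suc n) - riemann_sum X f \<mu> n) \<le> e * B"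
proof -
  let ?P = "p ^ n" and ?Q = "p ^ Suc n"
  let ?m = "\<lambda>b. \<mu> (Zp_coset p b (Suc n) \<inter> X)"
  have P: "?P > 0" using p_ge_3 by simp
  have "riemann_sum X f \<mu> n = (\<Sum>a<?P. \<Sum>b | b \<in> {b. b < ?Q \<and> of_nat b \<in> X} \<and> b mod ?P = a. f (of_nat (b mod ?P)) * ?m b)"
    unfolding riemann_sum_def
  proof (rule sum.cong[OF refl])
    fix a assume a: "a \<in> {..<?P}"
    have "has_level X (Suc n) (Zp_coset p a n \<inter> X)"
      by (rule has_level_mono[OF coset_has_level[OF \<mu>(2)]]) simp
    then have "\<mu> (Zp_coset p a n \<inter> X) = (\<Sum>b | b < ?Q \<and> of_nat b \<in> Zp_coset p a n \<inter> X. ?m b)"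
      by (intro bm_level_sum \<mu>) auto
    also have "{b. b < ?Q \<and> of_nat b \<in> Zp_coset p a n \<inter> X} = {b. b \<in> {b. b < ?Q \<and> of_nat b \<in> X} \<and> b mod ?P = a}"
      using a of_nat_in_coset_iff by auto
    finally show "f (of_nat a) * \<mu> (Zp_coset p a n \<inter> X) =
        (\<Sum>b | b \<in> {b. b < ?Q \<and> of_nat b \<in> X} \<and> b mod ?P = a. f (of_nat (b mod ?P)) * ?m b)"
      by (simp add: sum_distrib_left)
  qed
  also have "\<dots> = (\<Sum>b | b < ?Q \<and> of_nat b \<in> X. f (of_nat (b mod ?P)) * ?m b)"
    using P by (intro sum.group) auto
  finally have 1: "riemann_sum X f \<mu> n = (\<Sum>b | b < ?Q \<and> of_nat b \<in> X. f (of_nat (b mod ?P)) * ?m b)" .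
  have 2: "riemann_sum X f \<mu> (Suc n) = (\<Sum>b | b < ?Q \<and> of_nat b \<in> X. f (of_nat b) * ?m b)"
    unfolding riemann_sum_def
    by (rule sum.mono_neutral_right) (use coset_empty[OF \<mu>(2)] \<mu>(1) in auto)
  have "absv (f (of_nat b) * ?m b - f (of_nat (b mod ?P)) * ?m b) \<le> e * B" if "of_nat b \<in> X" for b
  proof -
    have "of_nat (b mod ?P) \<in> X" using that of_nat_mod_dom[OF \<mu>(2) n] by simp
    then have "absv (f (of_nat b) - f (of_nat (b mod ?P))) \<le> e"
      using osc that absv_mod_diff[of b n] absv_diff_commute unfolding osc_le_def by metis
    then show ?thesis
      unfolding left_diff_distrib[symmetric] absv_mult using B e by (intro mult_mono) auto
  qed
  moreover have "0 \<le> e * B" using e B[of "{}"] zero_le_dist order_trans by (metis mult_nonneg_nonneg)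
  ultimately show ?thesis
    unfolding 1 2 sum_subtractf[symmetric] by (intro absv_sum_le) auto
qed

lemma riemann_sum_dist:
  assumes \<mu>: "\<mu> \<in> bounded_measures X" "is_dom X" and n: "n \<ge> 1" "n \<le> m"
    and osc: "osc_le X f n e" and B: "\<And>U. absv (\<mu> U) \<le> B" and e: "0 \<le> e"
  shows "absv (riemann_sum X f \<mu> m - riemann_sum X f \<mu> n) \<le> e * B"
  using n(2)
proof (induction m rule: dec_induct)
  case base
  have "0 \<le> e * B" using e B[of "{}"] zero_le_dist order_trans by (metis mult_nonneg_nonneg)
  then show ?case by simp
next
  case (step m)
  have "absv (riemann_sum X f \<mu> (Suc m) - riemann_sum X f \<mu> m) \<le> e * B"
    using n(1) step by (intro riemann_sum_step \<mu> osc_le_mono[OF osc] B e) auto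
  then show ?case using step.IH by (rule absv_diff_trans)
qed

lemma integral_tendsto:
  assumes \<mu>: "\<mu> \<in> bounded_measures X" "is_dom X" and f: "unif_cont X f"
  shows "riemann_sum X f \<mu> \<longlonglongrightarrow> padic_integral p X f \<mu>"
proof -
  obtain B where B: "B > 0" "\<And>U. absv (\<mu> U) \<le> B" using bm_bound[OF \<mu>(1)] by blast
  have "(\<lambda>n. riemann_sum X f \<mu> (Suc n) - riemann_sum X f \<mu> n) \<longlonglongrightarrow> 0"
  proof (rule metric_LIMSEQ_I)
    fix r :: real assume r: "r > 0"
    define e where "e = r / (2 * B)"
    have e: "e > 0" "e * B < r" using r B(1) by (auto simp: e_def)
    obtain n where n: "osc_le X f n e" using f e(1) unfolding unif_cont_def by blast
    have "dist (riemann_sum X f \<mu> (Suc m) - riemann_sum X f \<mu> m) 0 < r" if "m \<ge> max 1 n" for m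
      using riemann_sum_step[OF \<mu> _ osc_le_mono[OF n, of m] B(2)] e that by force
    then show "\<exists>N. \<forall>m\<ge>N. dist (riemann_sum X f \<mu> (Suc m) - riemann_sum X f \<mu> m) 0 < r" by blast
  qed
  from convergent_ultrametric[OF this] obtain l where "riemann_sum X f \<mu> \<longlonglongrightarrow> l" by blast
  then show ?thesis
    unfolding padic_integral_def riemann_sum_def using limI by blast
qed

lemma integral_eqI: "riemann_sum X f \<mu> \<longlonglongrightarrow> l \<Longrightarrow> padic_integral p X f \<mu> = l"
  unfolding padic_integral_def riemann_sum_def by (rule limI)

lemma integral_level:
  assumes \<mu>: "\<mu> \<in> bounded_measures X" "is_dom X" and f: "osc_le X f n 0" and n: "n \<ge> 1"
  shows "padic_integral p X f \<mu> = riemann_sum X f \<mu> n"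
proof (rule integral_eqI)
  obtain B where B: "B > 0" "\<And>U. absv (\<mu> U) \<le> B" using bm_bound[OF \<mu>(1)] by blast
  have "riemann_sum X f \<mu> m = riemann_sum X f \<mu> n" if "m \<ge> n" for m
    using riemann_sum_dist[OF \<mu> n that f B(2)] by simp
  then show "riemann_sum X f \<mu> \<longlonglongrightarrow> riemann_sum X f \<mu> n"
    by (intro tendsto_eventually eventually_sequentiallyI)
qed

lemma riemann_sum_bound:
  assumes "\<And>a. of_nat a \<in> X \<Longrightarrow> absv (f (of_nat a)) \<le> C" "\<And>U. absv (\<mu> U) \<le> B" "0 \<le> C"
    "\<mu> \<in> bounded_measures X" "is_dom X" "n \<ge> 1"
  shows "absv (riemann_sum X f \<mu> n) \<le> C * B"
proof -
  have B: "0 \<le> B" using assms(2)[of "{}"] zero_le_dist order_trans by blast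
  have "absv (f (of_nat a) * \<mu> (Zp_coset p a n \<inter> X)) \<le> C * B" for a
  proof (cases "of_nat a \<in> X")
    case True
    then show ?thesis unfolding absv_mult using assms B by (intro mult_mono) auto
  next
    case False
    then show ?thesis using coset_empty[OF assms(5,6) False] assms(3,4) B by simp
  qed
  then show ?thesis
    unfolding riemann_sum_def using assms(3) B by (intro absv_sum_le) auto
qed

lemma integral_bound:
  assumes "\<And>a. of_nat a \<in> X \<Longrightarrow> absv (f (of_nat a)) \<le> C" "\<And>U. absv (\<mu> U) \<le> B" "0 \<le> C"
    "\<mu> \<in> bounded_measures X" "is_dom X" "unif_cont X f"
  shows "absv (padic_integral p X f \<mu>) \<le> C * B"
  by (rule absv_lim_le[OF integral_tendsto[OF assms(4-6)]], rule eventually_sequentiallyI[of 1],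
      rule riemann_sum_bound) (use assms in auto)

subsection \<open>Linear combinations of measures\<close>

lemma bm_scaled_add:
  fixes \<mu> \<nu> :: "'k set \<Rightarrow> 'k"
  assumes "\<mu> \<in> bounded_measures X" "\<nu> \<in> bounded_measures X"
  shows "(\<lambda>U. \<mu> U + c * \<nu> U) \<in> bounded_measures X"
proof -
  obtain B where B: "B > 0" "\<And>U. absv (\<mu> U) \<le> B" using bm_bound[OF assms(1)] by blast
  obtain D where D: "D > 0" "\<And>U. absv (\<nu> U) \<le> D" using bm_bound[OF assms(2)] by blast
  show ?thesis
  proof (rule bounded_measuresI)
    fix U show "absv (\<mu> U + c * \<nu> U) \<le> max B (absv c * D)"
      using B(2)[of U] D(2)[of U] by (intro absv_add_le) (auto simp: absv_mult le_max_iff_disj mult_left_mono)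
  qed (simp_all add: bm_add[OF assms(1)] bm_add[OF assms(2)] bm_outside[OF assms(1)] bm_outside[OF assms(2)] algebra_simps)
qed

lemma bm_zero: "(\<lambda>U. 0 :: 'k) \<in> bounded_measures X"
  by (rule bounded_measuresI[of _ _ 0]) auto

lemma integral_scaled_add:
  assumes "\<mu> \<in> bounded_measures X" "\<nu> \<in> bounded_measures X" "is_dom X" "unif_cont X f"
  shows "padic_integral p X f (\<lambda>U. \<mu> U + c * \<nu> U) = padic_integral p X f \<mu> + c * padic_integral p X f \<nu>"
proof (rule integral_eqI)
  have "riemann_sum X f (\<lambda>U. \<mu> U + c * \<nu> U) = (\<lambda>n. riemann_sum X f \<mu> n + c * riemann_sum X f \<nu> n)"
    by (simp add: riemann_sum_def fun_eq_iff sum.distrib sum_distrib_left algebra_simps)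
  then show "riemann_sum X f (\<lambda>U. \<mu> U + c * \<nu> U) \<longlonglongrightarrow> padic_integral p X f \<mu> + c * padic_integral p X f \<nu>"
    by (simp add: tendsto_add tendsto_mult integral_tendsto assms)
qed

lemma integral_zero: "padic_integral p X f (\<lambda>U. 0) = (0 :: 'k)"
  by (rule integral_eqI) (simp add: riemann_sum_def[abs_def])

lemma bm_linear_combination:
  fixes \<mu> :: "'i \<Rightarrow> 'k set \<Rightarrow> 'k"
  assumes "finite I" "\<And>i. i \<in> I \<Longrightarrow> \<mu> i \<in> bounded_measures X"
  shows "(\<lambda>U. \<Sum>i\<in>I. c i * \<mu> i U) \<in> bounded_measures X"
  using assms
proof (induction I rule: finite_induct)
  case (insert i I)
  then show ?case using bm_scaled_add[of "\<lambda>U. \<Sum>i\<in>I. c i * \<mu> i U" X "\<mu> i" "c i"] by (simp add: add.commute)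
qed (simp add: bm_zero)

lemma integral_linear_combination:
  assumes "finite I" "\<And>i. i \<in> I \<Longrightarrow> \<mu> i \<in> bounded_measures X" "is_dom X" "unif_cont X f"
  shows "padic_integral p X f (\<lambda>U. \<Sum>i\<in>I. c i * \<mu> i U) = (\<Sum>i\<in>I. c i * padic_integral p X f (\<mu> i))"
  using assms(1,2)
proof (induction I rule: finite_induct)
  case (insert i I)
  have "(\<lambda>U. \<Sum>i\<in>I. c i * \<mu> i U) \<in> bounded_measures X"
    using insert by (intro bm_linear_combination) auto
  then show ?case
    using insert integral_scaled_add[of "\<lambda>U. \<Sum>i\<in>I. c i * \<mu> i U" X "\<mu> i" f "c i"] assms(3,4)
    by (simp add: add.commute)
qed (simp add: integral_zero)

subsection \<open>Convolution\<close>

definition slice :: "'k set \<Rightarrow> 'k \<Rightarrow> 'k set"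
  where "slice U y = {x \<in> G. x * y \<in> U}"

lemma slice_has_level:
  assumes "has_level G n U" "y \<in> G" shows "has_level G n (slice U y)"
  unfolding has_level_def
proof (intro conjI ballI impI)
  fix x x' assume a: "x \<in> G" "x' \<in> G" "absv (x - x') \<le> eps n" "x \<in> slice U y"
  have "absv (x * y - x' * y) \<le> eps n"
    unfolding left_diff_distrib[symmetric] absv_mult using a assms(2) by (simp add: Zp_units_iff)
  then show "x' \<in> slice U y"
    using has_levelD[OF assms(1) Zp_units_mult[OF a(1) assms(2)] Zp_units_mult[OF a(2) assms(2)]] a
    by (auto simp: slice_def)
qed (auto simp: slice_def)

lemma slice_cong:
  assumes "has_level G n U" "y \<in> G" "y' \<in> G" "absv (y - y') \<le> eps n" shows "slice U y = slice U y'"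
proof -
  have "x * y \<in> U \<longleftrightarrow> x * y' \<in> U" if x: "x \<in> G" for x
  proof (rule has_levelD[OF assms(1) Zp_units_mult[OF x assms(2)] Zp_units_mult[OF x assms(3)]])
    show "absv (x * y - x * y') \<le> eps n"
      unfolding right_diff_distrib[symmetric] absv_mult using assms(4) x by (simp add: Zp_units_iff)
  qed
  then show ?thesis by (auto simp: slice_def)
qed

text \<open>The slices of a set of level \<open>n\<close> depend on \<open>y\<close> only modulo \<open>p ^ n\<close>, so the integral that
  defines the convolution is a finite sum.\<close>

lemma conv_level_sum:
  assumes "\<nu> \<in> bounded_measures G" "has_level G n U" "n \<ge> 1"
  shows "measure_conv p \<mu> \<nu> U = (\<Sum>b<p ^ n. \<mu> (slice U (of_nat b)) * \<nu> (Zp_coset p b n \<inter> G))"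
proof -
  have "osc_le G (\<lambda>y. \<mu> (slice U y)) n 0"
    unfolding osc_le_def
  proof (intro allI impI)
    fix a b assume "of_nat a \<in> G" "of_nat b \<in> G" "absv (of_nat a - of_nat b :: 'k) \<le> eps n"
    from slice_cong[OF assms(2) this]
    show "absv (\<mu> (slice U (of_nat a)) - \<mu> (slice U (of_nat b))) \<le> 0" by simp
  qed
  from integral_level[OF assms(1) _ this assms(3)]
  show ?thesis
    using has_level_clopen[OF assms(2)] by (simp add: measure_conv_def riemann_sum_def slice_def[abs_def])
qed

lemma bm_conv:
  assumes \<mu>: "\<mu> \<in> bounded_measures G" and \<nu>: "\<nu> \<in> bounded_measures G"
  shows "measure_conv p \<mu> \<nu> \<in> bounded_measures G"
proof -
  obtain B where B: "B > 0" "\<And>U. absv (\<mu> U) \<le> B" using bm_bound[OF \<mu>] by blast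
  obtain D where D: "D > 0" "\<And>U. absv (\<nu> U) \<le> D" using bm_bound[OF \<nu>] by blast
  show ?thesis
  proof (rule bounded_measuresI[of _ _ "B * D"])
    fix U V :: "'k set" assume a: "clopen_in G U" "clopen_in G V" "U \<inter> V = {}"
    obtain n where n: "n \<ge> 1" "has_level G n U" using clopen_has_level[OF is_dom_G a(1)] by blast
    obtain m where m: "m \<ge> 1" "has_level G m V" using clopen_has_level[OF is_dom_G a(2)] by blast
    define N where "N = max n m"
    have N: "N \<ge> 1" "has_level G N U" "has_level G N V"
      using has_level_mono[OF n(2), of N] has_level_mono[OF m(2), of N] n(1) by (auto simp: N_def)
    have "\<mu> (slice (U \<union> V) (of_nat b)) * \<nu> (Zp_coset p b N \<inter> G) =
        \<mu> (slice U (of_nat b)) * \<nu> (Zp_coset p b N \<inter> G) + \<mu> (slice V (of_nat b)) * \<nu> (Zp_coset p b N \<inter> G)" for b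
    proof (cases "of_nat b \<in> G")
      case True
      have "slice (U \<union> V) (of_nat b) = slice U (of_nat b) \<union> slice V (of_nat b)" by (auto simp: slice_def)
      moreover have "slice U (of_nat b) \<inter> slice V (of_nat b) = {}" using a(3) by (auto simp: slice_def)
      moreover have "clopen_in G (slice U (of_nat b))" "clopen_in G (slice V (of_nat b))"
        using has_level_clopen[OF slice_has_level[OF N(2) True]] has_level_clopen[OF slice_has_level[OF N(3) True]]
        by blast+
      ultimately have "\<mu> (slice (U \<union> V) (of_nat b)) = \<mu> (slice U (of_nat b)) + \<mu> (slice V (of_nat b))"
        using bm_add[OF \<mu>] by simp
      then show ?thesis by (simp add: algebra_simps)
    next
      case False
      then show ?thesis using coset_empty[OF is_dom_G N(1) False] \<nu> by simp
    qed
    then show "measure_conv p \<mu> \<nu> (U \<union> V) = measure_conv p \<mu> \<nu> U + measure_conv p \<mu> \<nu> V"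
      using N has_level_Un[OF N(2,3)] by (simp add: conv_level_sum[OF \<nu>, of N] sum.distrib)
  next
    fix U :: "'k set" assume a: "clopen_in G U"
    obtain n where n: "n \<ge> 1" "has_level G n U" using clopen_has_level[OF is_dom_G a] by blast
    show "absv (measure_conv p \<mu> \<nu> U) \<le> B * D"
      unfolding conv_level_sum[OF \<nu> n(2,1)] using B D by (intro absv_sum_le) (auto simp: absv_mult intro!: mult_mono)
  qed (simp add: measure_conv_def)
qed

subsection \<open>Characters\<close>

text \<open>A Lipschitz condition instead of mere continuity makes the errors of Riemann sums explicit.\<close>

definition unit_character :: "('k \<Rightarrow> 'k) \<Rightarrow> bool"
  where "unit_character \<chi> \<longleftrightarrow> (\<forall>x\<in>G. \<forall>y\<in>G. \<chi> (x * y) = \<chi> x * \<chi> y) \<and> (\<forall>x\<in>G. absv (\<chi> x) \<le> 1) \<and>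
     (\<forall>x\<in>G. \<forall>y\<in>G. absv (x - y) \<le> eps 1 \<longrightarrow> absv (\<chi> x - \<chi> y) \<le> absv (x - y))"

lemma unit_characterD:
  assumes "unit_character \<chi>"
  shows "x \<in> G \<Longrightarrow> y \<in> G \<Longrightarrow> \<chi> (x * y) = \<chi> x * \<chi> y" "x \<in> G \<Longrightarrow> absv (\<chi> x) \<le> 1"
    "x \<in> G \<Longrightarrow> y \<in> G \<Longrightarrow> absv (x - y) \<le> eps n \<Longrightarrow> n \<ge> 1 \<Longrightarrow> absv (\<chi> x - \<chi> y) \<le> eps n"
  using assms eps_antimono[of 1 n] unfolding unit_character_def by (blast, blast, meson order_trans)

lemma unit_character_osc: "unit_character \<chi> \<Longrightarrow> n \<ge> 1 \<Longrightarrow> osc_le G \<chi> n (eps n)"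
  unfolding osc_le_def using unit_characterD(3) by blast

lemma unif_contI:
  assumes "\<And>n. n \<ge> n0 \<Longrightarrow> osc_le X f n (C * eps n)" shows "unif_cont X f"
  unfolding unif_cont_def
proof (intro allI impI)
  fix e :: real assume e: "e > 0"
  have "(\<lambda>n. C * eps n) \<longlonglongrightarrow> C * 0" by (intro tendsto_mult tendsto_const eps_tendsto)
  then have "\<forall>\<^sub>F n in sequentially. C * eps n < e"
    using e order_tendstoD(2) by (metis mult_zero_right)
  then obtain N where N: "\<And>n. n \<ge> N \<Longrightarrow> C * eps n < e" by (auto simp: eventually_sequentially)
  have "osc_le X f (max n0 N) e"
    using assms[of "max n0 N"] N[of "max n0 N"] unfolding osc_le_def by (meson less_imp_le max.cobounded1 max.cobounded2 order_trans)
  then show "\<exists>n. osc_le X f n e" by blast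
qed

lemma unit_character_unif_cont: "unit_character \<chi> \<Longrightarrow> unif_cont G \<chi>"
  by (rule unif_contI[of 1 _ _ 1]) (simp add: unit_character_osc del: power_one_over)

lemma mult_mod_bij:
  assumes "coprime b P" "P > (0::nat)" shows "bij_betw (\<lambda>d. d * b mod P) {..<P} {..<P}"
proof -
  have "inj_on (\<lambda>d. d * b mod P) {..<P}"
  proof (rule inj_onI)
    fix x y assume "x \<in> {..<P}" "y \<in> {..<P}" "x * b mod P = y * b mod P"
    then have "[x * b = y * b] (mod P)" by (simp add: cong_def)
    then have "[x = y] (mod P)" using assms(1) by (simp add: cong_mult_rcancel_nat coprime_commute)
    then show "x = y" using \<open>x \<in> {..<P}\<close> \<open>y \<in> {..<P}\<close> by (simp add: cong_less_modulus_unique_nat)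
  qed
  moreover have "(\<lambda>d. d * b mod P) ` {..<P} \<subseteq> {..<P}" using assms(2) by auto
  ultimately show ?thesis
    by (simp add: bij_betw_def endo_inj_surj)
qed

lemma coprime_p_power: "\<not> p dvd b \<Longrightarrow> coprime b (p ^ n)"
  using prime_imp_coprime[OF prime_p, of b] by (simp add: ac_simps)

text \<open>The Riemann sum of level \<open>n\<close> of a convolution is the product of those of the factors up to an error
  proportional to \<open>1 / p ^ n\<close>, which arises because the product of two representatives has to be reduced modulo
  \<open>p ^ n\<close>.\<close>

lemma integral_conv:
  assumes \<chi>: "unit_character \<chi>" and \<mu>: "\<mu> \<in> bounded_measures G" and \<nu>: "\<nu> \<in> bounded_measures G"
  shows "padic_integral p G \<chi> (measure_conv p \<mu> \<nu>) = padic_integral p G \<chi> \<mu> * padic_integral p G \<chi> \<nu>"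
proof -
  obtain B where B: "B > 0" "\<And>U. absv (\<mu> U) \<le> B" using bm_bound[OF \<mu>] by blast
  obtain D where D: "D > 0" "\<And>U. absv (\<nu> U) \<le> D" using bm_bound[OF \<nu>] by blast
  let ?R = "riemann_sum G \<chi>"
  have main: "absv (?R (measure_conv p \<mu> \<nu>) n - ?R \<mu> n * ?R \<nu> n) \<le> B * D * eps n" if n: "n \<ge> 1" for n
  proof -
    let ?P = "p ^ n"
    have P: "?P > 0" using p_ge_3 by simp
    let ?c = "\<lambda>a. Zp_coset p a n \<inter> G"
    define S where "S b = (\<Sum>a<?P. \<chi> (of_nat a) * \<mu> (slice (?c a) (of_nat b)))" for b
    have "?R (measure_conv p \<mu> \<nu>) n = (\<Sum>a<?P. \<Sum>b<?P. \<chi> (of_nat a) * \<mu> (slice (?c a) (of_nat b)) * \<nu> (?c b))"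
      unfolding riemann_sum_def conv_level_sum[OF \<nu> coset_has_level[OF is_dom_G] n] by (simp add: sum_distrib_left mult.assoc)
    also have "\<dots> = (\<Sum>b<?P. S b * \<nu> (?c b))"
      by (subst sum.swap) (simp add: S_def sum_distrib_right)
    finally have 1: "?R (measure_conv p \<mu> \<nu>) n = (\<Sum>b<?P. S b * \<nu> (?c b))" .
    have 2: "?R \<mu> n * ?R \<nu> n = (\<Sum>b<?P. \<chi> (of_nat b) * ?R \<mu> n * \<nu> (?c b))"
      unfolding riemann_sum_def[of G \<chi> \<nu>] by (simp add: sum_distrib_left mult_ac)
    \<comment> \<open>For a unit \<open>b\<close>, multiplication by \<open>b\<close> permutes the classes modulo \<open>p ^ n\<close>, and the slice at \<open>b\<close> of
      the class of \<open>d b\<close> is the class of \<open>d\<close>.\<close>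
    have S: "absv (S b - \<chi> (of_nat b) * ?R \<mu> n) \<le> eps n * B" if b: "of_nat b \<in> G" for b
    proof -
      have cop: "coprime b ?P" using b coprime_p_power by (simp add: of_nat_Zp_units_iff)
      have sl: "slice (?c (d * b mod ?P)) (of_nat b) = ?c d" for d
      proof -
        have "x * of_nat b \<in> ?c (d * b mod ?P) \<longleftrightarrow> x \<in> ?c d" if x: "x \<in> G" for x
        proof -
          have xb: "x * of_nat b \<in> G" using x b by (rule Zp_units_mult)
          have e: "absv (of_nat (d * b mod ?P) - of_nat (d * b) :: 'k) \<le> eps n" by (rule absv_mod_diff)
          have "absv (x * of_nat b - of_nat (d * b mod ?P)) \<le> eps n \<longleftrightarrow> absv (x * of_nat b - of_nat (d * b)) \<le> eps n"
            using absv_diff_trans[OF _ e, of "x * of_nat b"]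
              absv_diff_trans[OF _ e[unfolded absv_diff_commute[of "of_nat (d * b mod ?P)"]], of "x * of_nat b"] by blast
          also have "x * of_nat b - of_nat (d * b) = (x - of_nat d) * of_nat b" by (simp add: algebra_simps)
          finally show ?thesis
            using x xb b by (simp add: Zp_coset_iff Zp_units_Zp absv_mult) (simp add: Zp_units_iff)
        qed
        then show ?thesis by (auto simp: slice_def)
      qed
      have "S b = (\<Sum>d<?P. \<chi> (of_nat (d * b mod ?P)) * \<mu> (slice (?c (d * b mod ?P)) (of_nat b)))"
        unfolding S_def by (rule sum.reindex_bij_betw[OF mult_mod_bij[OF cop P], symmetric])
      then have "S b - \<chi> (of_nat b) * ?R \<mu> n = (\<Sum>d<?P. (\<chi> (of_nat (d * b mod ?P)) - \<chi> (of_nat b) * \<chi> (of_nat d)) * \<mu> (?c d))"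
        unfolding sl riemann_sum_def by (simp add: sum_distrib_left sum_subtractf left_diff_distrib mult.assoc)
      moreover have "absv ((\<chi> (of_nat (d * b mod ?P)) - \<chi> (of_nat b) * \<chi> (of_nat d)) * \<mu> (?c d)) \<le> eps n * B" for d
      proof (cases "of_nat d \<in> G")
        case True
        have db: "of_nat (d * b) \<in> G" using Zp_units_mult[OF True b] by simp
        then have "of_nat (d * b mod ?P) \<in> G" using of_nat_mod_dom[OF is_dom_G n] by blast
        from unit_characterD(3)[OF \<chi> this db absv_mod_diff n]
        have "absv (\<chi> (of_nat (d * b mod ?P)) - \<chi> (of_nat b) * \<chi> (of_nat d)) \<le> eps n"
          using unit_characterD(1)[OF \<chi> b True] by (simp add: mult.commute)
        then show ?thesis unfolding absv_mult using B by (intro mult_mono) auto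
      next
        case False
        then show ?thesis using coset_empty[OF is_dom_G n False] \<mu> B(1) by simp
      qed
      ultimately show ?thesis using B(1) by (simp only:) (intro absv_sum_le, auto)
    qed
    have "absv ((S b - \<chi> (of_nat b) * ?R \<mu> n) * \<nu> (?c b)) \<le> eps n * B * D" for b
    proof (cases "of_nat b \<in> G")
      case True
      then show ?thesis unfolding absv_mult using S[OF True] D B(1) by (intro mult_mono) auto
    next
      case False
      then show ?thesis using coset_empty[OF is_dom_G n False] \<nu> B(1) D(1) by simp
    qed
    then have "absv (?R (measure_conv p \<mu> \<nu>) n - ?R \<mu> n * ?R \<nu> n) \<le> eps n * B * D"
      unfolding 1 2 sum_subtractf[symmetric] left_diff_distrib[symmetric]
      using B(1) D(1) by (intro absv_sum_le) auto
    then show ?thesis by (simp add: mult_ac)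
  qed
  note uc = unit_character_unif_cont[OF \<chi>]
  have "(\<lambda>n. B * D * eps n) \<longlonglongrightarrow> B * D * 0" by (intro tendsto_mult tendsto_const eps_tendsto)
  then have z: "(\<lambda>n. B * D * eps n) \<longlonglongrightarrow> 0" by simp
  have "(\<lambda>n. ?R (measure_conv p \<mu> \<nu>) n - ?R \<mu> n * ?R \<nu> n) \<longlonglongrightarrow> 0"
    by (rule tendsto_absv_bound[OF z], rule eventually_sequentiallyI[of 1]) (simp add: main del: power_one_over)
  moreover have "(\<lambda>n. ?R (measure_conv p \<mu> \<nu>) n - ?R \<mu> n * ?R \<nu> n) \<longlonglongrightarrow>
     padic_integral p G \<chi> (measure_conv p \<mu> \<nu>) - padic_integral p G \<chi> \<mu> * padic_integral p G \<chi> \<nu>"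
    by (intro tendsto_diff tendsto_mult integral_tendsto \<mu> \<nu> bm_conv uc is_dom_G)
  ultimately have "padic_integral p G \<chi> (measure_conv p \<mu> \<nu>) - padic_integral p G \<chi> \<mu> * padic_integral p G \<chi> \<nu> = 0"
    by (metis LIMSEQ_unique)
  then show ?thesis by simp
qed

lemma bm_dirac: "dirac u \<in> bounded_measures G"
proof (rule bounded_measuresI[of _ _ 1])
  fix U V assume "clopen_in G U" "clopen_in G V" "U \<inter> V = {}"
  then show "dirac u (U \<union> V) = (dirac u U + dirac u V :: 'k)"
    using clopen_Un[OF is_dom_G, of U V] by (auto simp: dirac_def)
qed (auto simp: dirac_def)

lemma integral_dirac:
  assumes \<chi>: "unit_character \<chi>" and u: "u \<in> G"
  shows "padic_integral p G \<chi> (dirac u) = \<chi> u"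
proof (rule integral_eqI, rule tendsto_absv_bound[OF eps_tendsto], rule eventually_sequentiallyI[of 1])
  fix n :: nat assume n: "1 \<le> n"
  obtain a where a: "a < p ^ n" "absv (u - of_nat a) \<le> eps n"
    using Zp_nat_approx[OF Zp_units_Zp[OF u]] by blast
  have "dirac u (Zp_coset p b n \<inter> G) = (if b = a then 1 else 0 :: 'k)" if "b < p ^ n" for b
  proof -
    have "u \<in> Zp_coset p b n \<longleftrightarrow> b = a"
      using Zp_units_Zp[OF u] a Zp_nat_approx_unique[OF _ a(2) that a(1)] by (auto simp: Zp_coset_iff)
    then show ?thesis using clopen_coset[OF is_dom_G] u by (simp add: dirac_def)
  qed
  then have "riemann_sum G \<chi> (dirac u) n = (\<Sum>b<p ^ n. if b = a then \<chi> (of_nat a) else 0)"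
    unfolding riemann_sum_def by (intro sum.cong) auto
  then have "riemann_sum G \<chi> (dirac u) n = \<chi> (of_nat a)" using a(1) by simp
  moreover have "of_nat a \<in> G" using is_dom_cong[OF is_dom_G u of_nat_Zp a(2) n] .
  ultimately show "absv (riemann_sum G \<chi> (dirac u) n - \<chi> u) \<le> eps n"
    using unit_characterD(3)[OF \<chi> u _ a(2) n] absv_diff_commute[of "\<chi> u"] by simp
qed

lemma conv_dirac:
  assumes \<mu>: "\<mu> \<in> bounded_measures G" and u: "u \<in> G" and U: "clopen_in G U"
  shows "measure_conv p \<mu> (dirac u) U = \<mu> (slice U u)"
proof -
  obtain n where n: "n \<ge> 1" "has_level G n U" using clopen_has_level[OF is_dom_G U] by blast
  obtain a where a: "a < p ^ n" "absv (u - of_nat a) \<le> eps n"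
    using Zp_nat_approx[OF Zp_units_Zp[OF u]] by blast
  have aG: "of_nat a \<in> G" using is_dom_cong[OF is_dom_G u of_nat_Zp a(2) n(1)] .
  have "dirac u (Zp_coset p b n \<inter> G) = (if b = a then 1 else 0 :: 'k)" if "b < p ^ n" for b
  proof -
    have "u \<in> Zp_coset p b n \<longleftrightarrow> b = a"
      using Zp_units_Zp[OF u] a Zp_nat_approx_unique[OF _ a(2) that a(1)] by (auto simp: Zp_coset_iff)
    then show ?thesis using clopen_coset[OF is_dom_G] u by (simp add: dirac_def)
  qed
  then have "measure_conv p \<mu> (dirac u) U = (\<Sum>b<p ^ n. if b = a then \<mu> (slice U (of_nat a)) else 0)"
    unfolding conv_level_sum[OF bm_dirac n(2,1)] by (intro sum.cong) auto
  also have "\<dots> = \<mu> (slice U (of_nat a))" using a(1) by simp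
  also have "slice U (of_nat a) = slice U u"
    using slice_cong[OF n(2) u aG a(2)] by simp
  finally show ?thesis .
qed

lemma conv_dirac_one:
  assumes \<mu>: "\<mu> \<in> bounded_measures G" shows "measure_conv p \<mu> (dirac 1) = \<mu>"
proof
  fix U
  show "measure_conv p \<mu> (dirac 1) U = \<mu> U"
  proof (cases "clopen_in G U")
    case True
    then have "slice U 1 = U" by (auto simp: slice_def clopen_in_def dest: openin_imp_subset)
    then show ?thesis using conv_dirac[OF \<mu> one_Zp_units True] by simp
  qed (use bm_outside[OF \<mu>] in \<open>simp add: measure_conv_def\<close>)
qed

lemma bm_r_elem: "r_elem c \<in> bounded_measures G"
  using bm_scaled_add[OF bm_dirac[of 1] bm_dirac[of "of_nat c"], of "- of_nat c"] by (simp add: r_elem_def)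

lemma integral_r_elem:
  assumes "unit_character \<chi>" "coprime c p"
  shows "padic_integral p G \<chi> (r_elem c) = \<chi> 1 - of_nat c * \<chi> (of_nat c)"
proof -
  have "of_nat c \<in> G"
    using assms(2) prime_p by (metis coprime_common_divisor_nat dvd_refl not_prime_1 of_nat_Zp_units_iff)
  then show ?thesis
    using integral_scaled_add[OF bm_dirac[of 1] bm_dirac[of "of_nat c"] is_dom_G unit_character_unif_cont[OF assms(1)], of "- of_nat c"]
      integral_dirac[OF assms(1)] by (simp add: r_elem_def[abs_def])
qed

lemma Sigma_set_bm: "t \<in> Sigma_set p \<Longrightarrow> t \<in> bounded_measures G"
  by (induction rule: Sigma_set.induct) (auto intro: bm_dirac bm_conv bm_r_elem)

lemma Sigma_set_integral_nonzero:
  assumes "t \<in> Sigma_set p" and \<chi>: "unit_character \<chi>" "\<chi> 1 \<noteq> 0"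
    and "\<And>c. admissible p c \<Longrightarrow> padic_integral p G \<chi> (r_elem c) \<noteq> 0"
  shows "padic_integral p G \<chi> t \<noteq> 0"
  using assms(1)
proof (induction rule: Sigma_set.induct)
  case one
  show ?case using integral_dirac[OF \<chi>(1) one_Zp_units] \<chi>(2) by simp
next
  case (mult c t)
  then show ?case using integral_conv[OF \<chi>(1) bm_r_elem Sigma_set_bm[OF mult.hyps(2)]] assms(4) by simp
qed

lemma r_elem_Sigma_set: "admissible p c \<Longrightarrow> (r_elem c :: 'k set \<Rightarrow> 'k) \<in> Sigma_set p"
proof -
  assume "admissible p c"
  then have "measure_conv p (r_elem c) (dirac 1 :: 'k set \<Rightarrow> 'k) \<in> Sigma_set p"
    by (intro Sigma_set.intros)
  then show ?thesis by (simp add: conv_dirac_one bm_r_elem)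
qed

text \<open>The quotient is well defined: integrating the relation between two fractions against the
  character gives an equation of numbers, in which the integral of the auxiliary denominator \<open>w\<close> is not
  zero and cancels.\<close>

lemma pm_mellin_frac:
  fixes A :: "'k set \<Rightarrow> 'k" and j :: int and s :: 'k
  defines "\<chi> \<equiv> \<lambda>x. (teich p x powi j) * padic_pow (principal p x) s"
  assumes A: "A \<in> bounded_measures G" and c: "admissible p c"
    and \<chi>: "unit_character \<chi>" "\<chi> 1 \<noteq> 0"
    and nz: "\<And>c. admissible p c \<Longrightarrow> padic_integral p G \<chi> (r_elem c) \<noteq> 0"
  shows "pm_mellin p (pm_frac p A (r_elem c)) j s = padic_integral p G \<chi> A / padic_integral p G \<chi> (r_elem c)"
proof -
  let ?I = "padic_integral p G \<chi>"
  have m: "mellin p \<rho> j s = ?I \<rho>" for \<rho> by (simp add: mellin_def \<chi>_def)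
  note nz' = Sigma_set_integral_nonzero[OF _ \<chi> nz]
  show ?thesis
    unfolding pm_mellin_def m
  proof (rule the_equality)
    have "(A, r_elem c) \<in> pm_frac p A (r_elem c)"
      unfolding pm_frac_def using A r_elem_Sigma_set[OF c] Sigma_set.one[of p] by auto
    then show "\<exists>(B, r)\<in>pm_frac p A (r_elem c). ?I r \<noteq> 0 \<and> ?I A / ?I (r_elem c) = ?I B / ?I r"
      using nz[OF c] by blast
  next
    fix v assume "\<exists>(B, r)\<in>pm_frac p A (r_elem c). ?I r \<noteq> 0 \<and> v = ?I B / ?I r"
    then obtain B r w where B: "B \<in> bounded_measures G" "r \<in> Sigma_set p" "w \<in> Sigma_set p"
      "measure_conv p w (measure_conv p r A) = measure_conv p w (measure_conv p (r_elem c) B)" "?I r \<noteq> 0" "v = ?I B / ?I r"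
      unfolding pm_frac_def by auto
    have "?I w * (?I r * ?I A) = ?I w * (?I (r_elem c) * ?I B)"
      using arg_cong[OF B(4), of ?I] B(1-3) A bm_conv bm_r_elem Sigma_set_bm by (simp add: integral_conv[OF \<chi>(1)])
    then have "?I r * ?I A = ?I (r_elem c) * ?I B" using nz'[OF B(3)] by simp
    then show "v = ?I A / ?I (r_elem c)"
      unfolding B(6) using B(5) nz[OF c] by (simp add: frac_eq_eq mult.commute)
  qed
qed

end

section \<open>Roots in algebraically closed fields\<close>

lemma finite_nth_roots:
  fixes z :: "'k::field_char_0" assumes "m > 0" shows "finite {u. u ^ m = z}"
proof -
  have "monom 1 m - [:z:] \<noteq> 0"
  proof
    assume "monom 1 m - [:z:] = 0"
    then have "coeff (monom 1 m - [:z:]) m = 0" by simp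
    then show False using assms by (simp add: coeff_pCons split: nat.splits)
  qed
  from poly_roots_finite[OF this] show ?thesis by (simp add: poly_monom)
qed

lemma card_nth_roots_le:
  fixes z :: "'k::field_char_0" assumes "m > 0" shows "card {u. u ^ m = z} \<le> m"
proof -
  have c: "coeff (monom 1 m - [:z:]) m = 1"
    using assms by (simp add: coeff_pCons split: nat.splits)
  then have "monom 1 m - [:z:] \<noteq> 0" by force
  then have "card {x. poly (monom 1 m - [:z:]) x = 0} \<le> degree (monom 1 m - [:z:])"
    by (rule card_poly_roots_bound)
  also have "\<dots> \<le> m" by (intro degree_diff_le degree_monom_le) auto
  finally show ?thesis by (simp add: poly_monom)
qed

lemma card_nth_roots:
  fixes z :: "'k::{alg_closed_field, field_char_0}"
  assumes "m > 0" "z \<noteq> 0" shows "card {u. u ^ m = z} = m"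
proof -
  define q where "q = monom 1 m - [:z:]"
  have c: "coeff q m = 1"
    using assms by (simp add: q_def coeff_pCons split: nat.splits)
  have q0: "q \<noteq> 0" using c by force
  have "degree q \<le> m" unfolding q_def by (intro degree_diff_le degree_monom_le) auto
  then have deg: "degree q = m" using le_degree[of q m] c by simp
  have roots: "{x. poly q x = 0} = {u. u ^ m = z}" by (simp add: q_def poly_monom)
  have "poly (pderiv q) x \<noteq> 0" if "poly q x = 0" for x
  proof -
    have "x ^ m = z" using that roots by blast
    then have "x \<noteq> 0" using assms by (auto simp: power_0_left)
    moreover have "pderiv q = monom (of_nat m) (m - 1)" by (simp add: q_def pderiv_diff pderiv_monom pderiv_pCons)
    ultimately show ?thesis using assms(1) by (simp add: poly_monom)
  qed
  then have rs: "rsquarefree q" by (auto simp: rsquarefree_roots)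
  obtain A where A: "size A = degree q" "q = smult (lead_coeff q) (\<Prod>x\<in>#A. [:-x, 1:])"
    using alg_closed_imp_factorization[OF q0] by blast
  have "proots q = proots (\<Prod>x\<in>#A. [:-x, 1:])"
    using q0 by (subst A(2)) simp
  also have "\<dots> = A"
  proof (induction A)
    case (add x A)
    have "(\<Prod>x\<in>#A. [:-x, 1:]) \<noteq> 0" by (auto simp: prod_mset_zero_iff)
    then have "proots ([:-x, 1:] * (\<Prod>x\<in>#A. [:-x, 1:])) = add_mset x A"
      by (subst proots_mult) (use add in auto)
    then show ?case by (simp only: image_mset_add_mset prod_mset.add_mset)
  qed simp
  finally have pA: "proots q = A" .
  have "size A = (\<Sum>x\<in>set_mset A. count A x)" by (simp add: size_multiset_overloaded_eq)
  also have "\<dots> = (\<Sum>x\<in>set_mset A. 1)"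
  proof (rule sum.cong[OF refl])
    fix x assume "x \<in># A"
    then have "order x q \<noteq> 0" using q0 by (simp flip: pA add: order_root)
    moreover have "order x q = 0 \<or> order x q = 1" using rs unfolding rsquarefree_def by blast
    ultimately show "count A x = 1" using q0 by (simp flip: pA)
  qed
  also have "set_mset A = {u. u ^ m = z}" unfolding pA[symmetric] roots[symmetric] using q0 by simp
  finally show ?thesis using A(1) deg by simp
qed

text \<open>Multiplication by an \<open>m\<close>-th root of unity \<open>\<zeta>\<close> permutes the roots and multiplies the sum by
  \<open>\<zeta> ^ k\<close>. Some \<open>\<zeta>\<close> has \<open>\<zeta> ^ k \<noteq> 1\<close>, since otherwise there would be at most \<open>k mod m < m\<close>
  roots of unity.\<close>

lemma sum_power_nth_roots:
  fixes z :: "'k::{alg_closed_field, field_char_0}"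
  assumes m: "m > 0" and z: "z \<noteq> 0" and k: "\<not> m dvd k"
  shows "(\<Sum>u | u ^ m = z. u ^ k) = 0"
proof -
  define r where "r = k mod m"
  have r: "0 < r" "r < m" using k m by (auto simp: r_def dvd_eq_mod_eq_0)
  have "\<exists>\<zeta>::'k. \<zeta> ^ m = 1 \<and> \<zeta> ^ r \<noteq> 1"
  proof (rule ccontr)
    assume "\<not> ?thesis"
    then have "{\<zeta>::'k. \<zeta> ^ m = 1} \<subseteq> {\<zeta>. \<zeta> ^ r = 1}" by auto
    then have "card {\<zeta>::'k. \<zeta> ^ m = 1} \<le> card {\<zeta>::'k. \<zeta> ^ r = 1}"
      by (intro card_mono finite_nth_roots r)
    also have "\<dots> \<le> r" by (intro card_nth_roots_le r)
    finally show False using card_nth_roots[OF m, of "1::'k"] r by simp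
  qed
  then obtain \<zeta> :: 'k where \<zeta>: "\<zeta> ^ m = 1" "\<zeta> ^ r \<noteq> 1" by blast
  have "\<zeta> ^ k = \<zeta> ^ (m * (k div m) + k mod m)" by simp
  also have "\<dots> = \<zeta> ^ r" unfolding r_def power_add power_mult \<zeta>(1) by simp
  finally have \<zeta>k: "\<zeta> ^ k \<noteq> 1" using \<zeta>(2) by simp
  have \<zeta>0: "\<zeta> \<noteq> 0" using \<zeta>(1) m by (auto simp: power_0_left)
  have "(\<Sum>u | u ^ m = z. u ^ k) = (\<Sum>u | u ^ m = z. (\<zeta> * u) ^ k)"
    by (rule sum.reindex_bij_witness[of _ "\<lambda>u. \<zeta> * u" "\<lambda>u. u / \<zeta>"])
      (use \<zeta> \<zeta>0 in \<open>auto simp: power_mult_distrib power_divide\<close>)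
  also have "\<dots> = \<zeta> ^ k * (\<Sum>u | u ^ m = z. u ^ k)"
    by (simp add: power_mult_distrib sum_distrib_left)
  finally show ?thesis using \<zeta>k by simp
qed

section \<open>The distribution attached to a root of unity\<close>

context padic_ambient
begin

text \<open>These conditions give \<open>z ^ a / (1 - z ^ (p ^ n))\<close> the absolute value 1, so that these numbers define
  a bounded measure. Nontrivial roots of unity of order prime to \<open>p\<close> satisfy them, and every root of a number
  that does.\<close>

definition unit_root :: "'k \<Rightarrow> bool"
  where "unit_root z \<longleftrightarrow> absv z = 1 \<and> (\<forall>n. absv (1 - z ^ (p ^ n)) = 1)"

lemma unit_root_order_coprime:
  fixes z :: 'k
  assumes "z ^ n = 1" "n > 0" "coprime n p" "z \<noteq> 1" shows "unit_root z"
proof -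
  have "absv z ^ n = 1 ^ n" using assms(1) absv_power[of z n] by simp
  then have z1: "absv z = 1" by (rule power_eq_imp_eq_base) (use assms(2) in auto)
  have "absv (1 - z ^ (p ^ k)) = 1" for k
  proof (rule ccontr)
    assume ne: "absv (1 - z ^ (p ^ k)) \<noteq> 1"
    have "absv (1 - z ^ (p ^ k)) \<le> 1" by (intro absv_diff_le) (auto simp: absv_power z1)
    then have "absv (z ^ (p ^ k) - 1) < 1" using ne absv_diff_commute[of 1 "z ^ (p ^ k)"] by linarith
    moreover have "(z ^ (p ^ k)) ^ n = 1" using assms(1) by (metis mult.commute power_mult power_one)
    ultimately have e: "z ^ (p ^ k) = 1" using root_of_unity_near_one assms(3) by blast
    have "coprime n (p ^ k)" using assms(3) by simp
    then obtain x y where "n * x = p ^ k * y + 1"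
      using bezout_nat[of n "p ^ k"] assms(2) by (auto simp: coprime_iff_gcd_eq_1)
    then have "z ^ (n * x) = z ^ (p ^ k * y) * z" by simp
    then show False using assms(1,4) e by (simp add: power_mult)
  qed
  then show ?thesis using z1 by (simp add: unit_root_def)
qed

lemma unit_root_nth_root:
  assumes "unit_root (u ^ m)" "m > 0" shows "unit_root u"
proof -
  have "absv u ^ m = 1 ^ m" using assms(1) by (simp add: unit_root_def absv_power)
  then have u1: "absv u = 1" by (rule power_eq_imp_eq_base) (use assms(2) in auto)
  have "absv (1 - u ^ (p ^ k)) = 1" for k
  proof (rule antisym)
    show "absv (1 - u ^ (p ^ k)) \<le> 1" by (intro absv_diff_le) (auto simp: absv_power u1)
    have "(u ^ m) ^ (p ^ k) = (u ^ (p ^ k)) ^ m" by (metis mult.commute power_mult)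
    moreover have "absv (1 - (u ^ m) ^ (p ^ k)) = 1" using assms(1) by (simp add: unit_root_def)
    ultimately have "absv (1 ^ m - (u ^ (p ^ k)) ^ m) = 1" by simp
    moreover have "absv (1 ^ m - (u ^ (p ^ k)) ^ m) \<le> absv (1 - u ^ (p ^ k))"
      by (intro absv_power_diff_le) (auto simp: absv_power u1)
    ultimately show "1 \<le> absv (1 - u ^ (p ^ k))" by simp
  qed
  then show ?thesis using u1 by (simp add: unit_root_def)
qed

lemma unit_root_nonzero: "unit_root z \<Longrightarrow> z \<noteq> 0" "unit_root z \<Longrightarrow> 1 - z ^ (p ^ n) \<noteq> 0"
  unfolding unit_root_def by (metis absv_zero_iff zero_neq_one)+

lemma unit_root_absv: "unit_root z \<Longrightarrow> absv (z ^ a / (1 - z ^ (p ^ n))) = 1"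
  by (simp add: unit_root_def absv_divide absv_power)

lemma geometric_unit_root:
  fixes z :: 'k
  assumes "1 - z \<noteq> 0" shows "(\<Sum>i<q. z ^ i) = (1 - z ^ q) / (1 - z)"
  using assms by (simp add: sum_gp_strict)

text \<open>The values on the \<open>p\<close> cosets of level \<open>m + 1\<close> inside a coset of level \<open>m\<close> form a geometric
  progression.\<close>

lemma mu_partial_sums_constant:
  assumes z: "unit_root z" and U: "has_level ZZ n U" and m: "n \<le> m"
  shows "(\<Sum>a | a < p ^ m \<and> of_nat a \<in> U. z ^ a / (1 - z ^ (p ^ m))) =
    (\<Sum>a | a < p ^ n \<and> of_nat a \<in> U. z ^ a / (1 - z ^ (p ^ n)))"
  using m
proof (induction m rule: dec_induct)
  case (step m)
  let ?P = "p ^ m" and ?Q = "p ^ Suc m"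
  have P: "?P > 0" using p_ge_3 by simp
  have lev: "has_level ZZ m U" using has_level_mono[OF U step.hyps(1)] .
  have U_mod: "(of_nat (b mod ?P) :: 'k) \<in> U \<longleftrightarrow> of_nat b \<in> U" for b
    by (rule has_levelD[OF lev of_nat_Zp of_nat_Zp absv_mod_diff])
  have "(\<Sum>b | b < ?Q \<and> of_nat b \<in> U. z ^ b / (1 - z ^ ?Q)) =
     (\<Sum>a | a < ?P \<and> of_nat a \<in> U. \<Sum>b | b \<in> {b. b < ?Q \<and> of_nat b \<in> U} \<and> b mod ?P = a. z ^ b / (1 - z ^ ?Q))"
    using P U_mod by (intro sum.group[symmetric]) auto
  also have "\<dots> = (\<Sum>a | a < ?P \<and> of_nat a \<in> U. z ^ a / (1 - z ^ ?P))"
  proof (rule sum.cong[OF refl])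
    fix a assume a: "a \<in> {a. a < ?P \<and> (of_nat a :: 'k) \<in> U}"
    have "(\<Sum>b | b \<in> {b. b < ?Q \<and> of_nat b \<in> U} \<and> b mod ?P = a. z ^ b / (1 - z ^ ?Q)) =
      (\<Sum>i<p. z ^ (a + ?P * i) / (1 - z ^ ?Q))"
    proof (rule sum.reindex_bij_witness[of _ "\<lambda>i. a + ?P * i" "\<lambda>b. b div ?P"])
      fix i assume i: "i \<in> {..<p}"
      have "a + ?P * i < ?P + ?P * i" using a by simp
      also have "\<dots> = ?P * (i + 1)" by simp
      also have "\<dots> \<le> ?P * p" using i by (intro mult_left_mono) auto
      finally have lt: "a + ?P * i < ?Q" by (simp add: mult.commute)
      show "(a + ?P * i) div ?P = i" using a P by simp
      show "a + ?P * i \<in> {b. b \<in> {b. b < ?Q \<and> of_nat b \<in> U} \<and> b mod ?P = a}"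
        using lt a U_mod[of "a + ?P * i"] by simp
    next
      fix b assume b: "b \<in> {b. b \<in> {b. b < ?Q \<and> of_nat b \<in> U} \<and> b mod ?P = a}"
      show *: "a + ?P * (b div ?P) = b" using b mod_mult_div_eq[of b ?P] by simp
      show "b div ?P \<in> {..<p}" using b P by (auto simp: less_mult_imp_div_less)
      show "z ^ (a + ?P * (b div ?P)) / (1 - z ^ ?Q) = z ^ b / (1 - z ^ ?Q)" by (simp only: *)
    qed
    also have "\<dots> = z ^ a * (\<Sum>i<p. (z ^ ?P) ^ i) / (1 - z ^ ?Q)"
      by (simp add: power_add power_mult sum_distrib_left sum_divide_distrib)
    also have "(\<Sum>i<p. (z ^ ?P) ^ i) = (1 - z ^ ?Q) / (1 - z ^ ?P)"
      using geometric_unit_root[OF unit_root_nonzero(2)[OF z, of m]]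
      by (simp add: power_mult[symmetric] mult.commute)
    finally show "(\<Sum>b | b \<in> {b. b < ?Q \<and> of_nat b \<in> U} \<and> b mod ?P = a. z ^ b / (1 - z ^ ?Q)) = z ^ a / (1 - z ^ ?P)"
      using unit_root_nonzero(2)[OF z, of "Suc m"] by simp
  qed
  finally show ?case using step.IH by simp
qed simp

lemma mu_measure_level:
  assumes z: "unit_root z" and U: "has_level ZZ n U"
  shows "mu_measure p z U = (\<Sum>a | a < p ^ n \<and> of_nat a \<in> U. z ^ a / (1 - z ^ (p ^ n)))"
proof -
  have "(\<lambda>m. \<Sum>a | a < p ^ m \<and> of_nat a \<in> U. z ^ a / (1 - z ^ (p ^ m))) \<longlonglongrightarrow>
      (\<Sum>a | a < p ^ n \<and> of_nat a \<in> U. z ^ a / (1 - z ^ (p ^ n)))"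
    by (intro tendsto_eventually eventually_sequentiallyI[of n] mu_partial_sums_constant z U)
  then show ?thesis
    using has_level_clopen[OF U] by (simp add: mu_measure_def limI)
qed

lemma mu_measure_coset:
  assumes z: "unit_root z" and a: "a < p ^ n"
  shows "mu_measure p z (Zp_coset p a n \<inter> ZZ) = z ^ a / (1 - z ^ (p ^ n))"
proof -
  have "b < p ^ n \<and> of_nat b \<in> Zp_coset p a n \<inter> ZZ \<longleftrightarrow> b = a" for b
    using a of_nat_in_coset_iff[OF a, of b] by auto
  then have "{b. b < p ^ n \<and> of_nat b \<in> Zp_coset p a n \<inter> ZZ} = {a}"
    by blast
  then show ?thesis
    unfolding mu_measure_level[OF z coset_has_level[OF is_dom_ZZ]] by simp
qed

lemma bm_mu_measure:
  assumes z: "unit_root z" shows "mu_measure p z \<in> bounded_measures ZZ"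
proof (rule bounded_measuresI[of _ _ 1])
  fix U V :: "'k set" assume a: "clopen_in ZZ U" "clopen_in ZZ V" "U \<inter> V = {}"
  obtain n where n: "n \<ge> 1" "has_level ZZ n U" using clopen_has_level[OF is_dom_ZZ a(1)] by blast
  obtain m where m: "m \<ge> 1" "has_level ZZ m V" using clopen_has_level[OF is_dom_ZZ a(2)] by blast
  define N where "N = max n m"
  have N: "has_level ZZ N U" "has_level ZZ N V"
    using has_level_mono[OF n(2), of N] has_level_mono[OF m(2), of N] by (auto simp: N_def)
  have e: "{a. a < p ^ N \<and> of_nat a \<in> U \<union> V} = {a. a < p ^ N \<and> of_nat a \<in> U} \<union> {a. a < p ^ N \<and> of_nat a \<in> V}"
    by auto
  show "mu_measure p z (U \<union> V) = mu_measure p z U + mu_measure p z V"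
    unfolding mu_measure_level[OF z N(1)] mu_measure_level[OF z N(2)] mu_measure_level[OF z has_level_Un[OF N]] e
    using a(3) by (intro sum.union_disjoint) auto
next
  fix U :: "'k set" assume a: "clopen_in ZZ U"
  obtain n where n: "n \<ge> 1" "has_level ZZ n U" using clopen_has_level[OF is_dom_ZZ a] by blast
  show "absv (mu_measure p z U) \<le> 1"
    unfolding mu_measure_level[OF z n(2)] using unit_root_absv[OF z] by (intro absv_sum_le) auto
qed (simp add: mu_measure_def)

definition inv_on :: "'k set \<Rightarrow> 'k \<Rightarrow> 'k"
  where "inv_on U x = (if x \<in> U then inverse x else 0)"

text \<open>The measure \<open>x\<inverse> \<one>\<^sub>G \<mu>\<^sub>z\<close>.\<close>

definition nu_root :: "'k \<Rightarrow> 'k set \<Rightarrow> 'k"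
  where "nu_root z U = (if clopen_in G U then padic_integral p ZZ (inv_on U) (mu_measure p z) else 0)"

lemma nu_measure_eq:
  "nu_measure p \<xi> = (\<lambda>U. \<Sum>z\<in>Poly_Mapping.keys \<xi>. Poly_Mapping.lookup \<xi> z * nu_root z U)"
  by (auto simp: fun_eq_iff nu_measure_def nu_root_def inv_on_def[abs_def])

lemma level_G_ZZ:
  assumes "has_level G n U" "n \<ge> 1" shows "has_level ZZ n U"
  unfolding has_level_def
proof (intro conjI ballI impI)
  show "U \<subseteq> ZZ" using has_level_subset[OF assms(1)] Zp_units_Zp by blast
  fix x y assume a: "x \<in> ZZ" "y \<in> ZZ" "absv (x - y) \<le> eps n" "x \<in> U"
  have x: "x \<in> G" using a(4) has_level_subset[OF assms(1)] by blast
  have "y \<in> G" using is_dom_cong[OF is_dom_G x a(2,3) assms(2)] .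
  then show "y \<in> U" using has_levelD[OF assms(1) x _ a(3)] a(4) by blast
qed

lemma inverse_diff_le:
  assumes "x \<in> G" "y \<in> G" shows "absv (inverse x - inverse y) = absv (x - y)"
proof -
  have "inverse x - inverse y = (y - x) * (inverse x * inverse y)"
    using Zp_units_nonzero[OF assms(1)] Zp_units_nonzero[OF assms(2)] by (simp add: field_simps)
  then show ?thesis
    using assms absv_diff_commute[of x y] by (simp add: absv_mult absv_inverse Zp_units_iff)
qed

lemma inv_on_osc:
  assumes U: "has_level G n U" "n \<ge> 1" and m: "n \<le> m" shows "osc_le ZZ (inv_on U) m (1 * eps m)"
  unfolding osc_le_def
proof (intro allI impI)
  fix a b assume ab: "absv (of_nat a - of_nat b :: 'k) \<le> eps m"
  have "(of_nat a :: 'k) \<in> U \<longleftrightarrow> of_nat b \<in> U"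
    by (rule has_levelD[OF has_level_mono[OF level_G_ZZ[OF U] m] of_nat_Zp of_nat_Zp ab])
  moreover have "x \<in> U \<Longrightarrow> x \<in> G" for x using has_level_subset[OF U(1)] by blast
  ultimately show "absv (inv_on U (of_nat a) - inv_on U (of_nat b)) \<le> 1 * eps m"
    using ab by (auto simp: inv_on_def inverse_diff_le simp del: power_one_over)
qed

lemma inv_on_unif_cont: assumes "clopen_in G U" shows "unif_cont ZZ (inv_on U)"
proof -
  obtain n where n: "n \<ge> 1" "has_level G n U" using clopen_has_level[OF is_dom_G assms] by blast
  show ?thesis by (rule unif_contI[of n]) (rule inv_on_osc[OF n(2,1)])
qed

lemma inv_on_bound: assumes "clopen_in G U" shows "absv (inv_on U x) \<le> 1"
proof (cases "x \<in> U")
  case True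
  then have "x \<in> G" using assms by (auto simp: clopen_in_def dest: openin_imp_subset)
  then show ?thesis by (simp add: inv_on_def absv_inverse Zp_units_iff)
qed (simp add: inv_on_def)

lemma bm_nu_root:
  assumes z: "unit_root z" shows "nu_root z \<in> bounded_measures G"
proof -
  note mu = bm_mu_measure[OF z]
  obtain B where B: "B > 0" "\<And>U. absv (mu_measure p z U) \<le> B" using bm_bound[OF mu] by blast
  show ?thesis
  proof (rule bounded_measuresI[of _ _ "1 * B"])
    fix U V :: "'k set" assume a: "clopen_in G U" "clopen_in G V" "U \<inter> V = {}"
    have UV: "clopen_in G (U \<union> V)" using clopen_Un[OF is_dom_G a(1,2)] .
    have "inv_on (U \<union> V) x = inv_on U x + inv_on V x" for x using a(3) by (auto simp: inv_on_def)
    then have "riemann_sum ZZ (inv_on (U \<union> V)) (mu_measure p z) =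
       (\<lambda>n. riemann_sum ZZ (inv_on U) (mu_measure p z) n + riemann_sum ZZ (inv_on V) (mu_measure p z) n)"
      by (simp add: fun_eq_iff riemann_sum_def sum.distrib algebra_simps)
    moreover have "(\<lambda>n. riemann_sum ZZ (inv_on U) (mu_measure p z) n + riemann_sum ZZ (inv_on V) (mu_measure p z) n)
       \<longlonglongrightarrow> nu_root z U + nu_root z V"
      using a(1,2) by (auto simp: nu_root_def intro!: tendsto_add integral_tendsto mu inv_on_unif_cont)
    ultimately show "nu_root z (U \<union> V) = nu_root z U + nu_root z V"
      using UV integral_eqI[of ZZ "inv_on (U \<union> V)" "mu_measure p z"] by (simp add: nu_root_def[of z "U \<union> V"])
  next
    fix U :: "'k set" assume a: "clopen_in G U"
    then show "absv (nu_root z U) \<le> 1 * B"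
      unfolding nu_root_def using integral_bound[OF inv_on_bound[OF a] B(2) _ mu is_dom_ZZ inv_on_unif_cont[OF a]] by simp
  qed (simp add: nu_root_def)
qed

section \<open>The distribution relation\<close>

text \<open>Expanding each summand into a geometric series gives denominators \<open>1 - z ^ P\<close>
  and power sums of the roots; those vanish unless the exponent is divisible by \<open>m\<close>, which happens
  for exactly one term of the series.\<close>

lemma sum_roots_distribution:
  fixes z :: 'k
  assumes m: "m > 0" and z: "unit_root z" and d: "d < p ^ n" and cop: "coprime m p"
  shows "(\<Sum>u | u ^ m = z. u ^ (d * m mod p ^ n) / (1 - u ^ (p ^ n))) = of_nat m * z ^ d / (1 - z ^ (p ^ n))"
proof -
  let ?P = "p ^ n" and ?R = "{u. u ^ m = z}"
  define a where "a = d * m mod ?P"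
  define q where "q = d * m div ?P"
  have dm: "d * m = a + ?P * q" by (simp add: a_def q_def)
  have "d * m < ?P * m" using d m by simp
  then have q: "q < m" unfolding q_def using less_mult_imp_div_less[of "d * m" m ?P] by (simp add: mult.commute)
  have fin: "finite ?R" using finite_nth_roots[OF m] .
  have z0: "z \<noteq> 0" using unit_root_nonzero[OF z] by simp
  have step: "u ^ a / (1 - u ^ ?P) = (\<Sum>j<m. u ^ (a + ?P * j)) / (1 - z ^ ?P)" if u: "u \<in> ?R" for u
  proof -
    have ur: "unit_root u" using unit_root_nth_root[of u m] u z m by simp
    have "(u ^ ?P) ^ m = (u ^ m) ^ ?P" by (simp add: power_mult[symmetric] mult.commute)
    then have "(u ^ ?P) ^ m = z ^ ?P" using u by simp
    then have "(\<Sum>j<m. (u ^ ?P) ^ j) = (1 - z ^ ?P) / (1 - u ^ ?P)"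
      using geometric_unit_root[OF unit_root_nonzero(2)[OF ur, of n], of m] by simp
    then have "(\<Sum>j<m. u ^ (a + ?P * j)) = u ^ a * ((1 - z ^ ?P) / (1 - u ^ ?P))"
      by (simp add: power_add power_mult sum_distrib_left[symmetric])
    then show ?thesis using unit_root_nonzero(2)[OF z, of n] by simp
  qed
  have inner: "(\<Sum>u\<in>?R. u ^ (a + ?P * j)) = (if j = q then of_nat m * z ^ d else 0)" if j: "j < m" for j
  proof (cases "j = q")
    case True
    have "u ^ (a + ?P * j) = z ^ d" if "u \<in> ?R" for u
    proof -
      have "u ^ (a + ?P * j) = (u ^ m) ^ d"
        unfolding True dm[symmetric] power_mult[symmetric] by (simp only: mult.commute)
      then show ?thesis using that by simp
    qed
    then have "(\<Sum>u\<in>?R. u ^ (a + ?P * j)) = (\<Sum>u\<in>?R. z ^ d)" by (rule sum.cong[OF refl])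
    also have "\<dots> = of_nat m * z ^ d" using card_nth_roots[OF m z0] by simp
    finally have sum_eq: "(\<Sum>u\<in>?R. u ^ (a + ?P * j)) = of_nat m * z ^ d" .
    show ?thesis unfolding if_P[OF True] by (rule sum_eq)
  next
    case False
    have "\<not> m dvd a + ?P * j"
    proof
      assume "m dvd a + ?P * j"
      then have "[a + ?P * j = a + ?P * q] (mod m)"
        unfolding dm[symmetric] by (simp add: cong_def)
      then have "[j = q] (mod m)"
        using cop by (simp add: cong_add_lcancel_nat cong_mult_lcancel_nat coprime_commute)
      then show False using j q False by (simp add: cong_less_modulus_unique_nat)
    qed
    then show ?thesis unfolding if_not_P[OF False] by (rule sum_power_nth_roots[OF m z0])
  qed
  have "(\<Sum>u\<in>?R. u ^ a / (1 - u ^ ?P)) = (\<Sum>u\<in>?R. (\<Sum>j<m. u ^ (a + ?P * j)) / (1 - z ^ ?P))"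
    using step by (rule sum.cong[OF refl])
  also have "\<dots> = (\<Sum>j<m. \<Sum>u\<in>?R. u ^ (a + ?P * j)) / (1 - z ^ ?P)"
    by (subst sum.swap) (simp add: sum_divide_distrib)
  also have "(\<Sum>j<m. \<Sum>u\<in>?R. u ^ (a + ?P * j)) = (\<Sum>j<m. if j = q then of_nat m * z ^ d else 0)"
    by (intro sum.cong refl inner) simp
  also have "\<dots> = of_nat m * z ^ d" using q by simp
  finally show ?thesis by (simp add: a_def)
qed

lemma coprime_of_nat_unit: "coprime m p \<Longrightarrow> (of_nat m :: 'k) \<in> G"
  using prime_p by (metis coprime_common_divisor_nat dvd_refl not_prime_1 of_nat_Zp_units_iff)

text \<open>In the Riemann sums of level \<open>n\<close> the coset of \<open>d m\<close> for the roots corresponds to the coset of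
  \<open>d\<close> for \<open>z\<close>. The factor \<open>m\<close> in the distribution relation is absorbed by the density, as
  \<open>m / (d m) = 1 / d\<close>; only the reduction of \<open>d m\<close> modulo \<open>p ^ n\<close> causes an error.\<close>

lemma nu_root_distribution:
  fixes z :: 'k
  assumes m: "m > 0" "coprime m p" and z: "unit_root z" and U: "clopen_in G U"
  shows "(\<Sum>u | u ^ m = z. nu_root u U) = nu_root z (slice U (of_nat m))"
proof -
  let ?R = "{u. u ^ m = z}" and ?V = "slice U (of_nat m)"
  have mG: "(of_nat m :: 'k) \<in> G" using coprime_of_nat_unit[OF m(2)] .
  obtain N where N: "N \<ge> 1" "has_level G N U" using clopen_has_level[OF is_dom_G U] by blast
  have V: "clopen_in G ?V" using has_level_clopen[OF slice_has_level[OF N(2) mG]] .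
  have ur: "unit_root u" if "u \<in> ?R" for u using unit_root_nth_root[of u m] that z m(1) by simp
  let ?S = "\<lambda>n. \<Sum>u\<in>?R. riemann_sum ZZ (inv_on U) (mu_measure p u) n"
  let ?T = "riemann_sum ZZ (inv_on ?V) (mu_measure p z)"
  have bound: "absv (?S n - ?T n) \<le> eps n" if n: "n \<ge> N" for n
  proof -
    let ?P = "p ^ n"
    have n1: "n \<ge> 1" using n N(1) by simp
    have P: "?P > 0" using p_ge_3 by simp
    have lev: "has_level G n U" using has_level_mono[OF N(2) n] .
    have "?S n = (\<Sum>u\<in>?R. \<Sum>a<?P. inv_on U (of_nat a) * (u ^ a / (1 - u ^ ?P)))"
      unfolding riemann_sum_def using mu_measure_coset[OF ur] by (intro sum.cong refl) auto
    also have "\<dots> = (\<Sum>a<?P. inv_on U (of_nat a) * (\<Sum>u\<in>?R. u ^ a / (1 - u ^ ?P)))"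
      by (subst sum.swap) (simp add: sum_distrib_left)
    also have "\<dots> = (\<Sum>d<?P. inv_on U (of_nat (d * m mod ?P)) * (\<Sum>u\<in>?R. u ^ (d * m mod ?P) / (1 - u ^ ?P)))"
      by (rule sum.reindex_bij_betw[OF mult_mod_bij, symmetric]) (use P m(2) in auto)
    also have "\<dots> = (\<Sum>d<?P. inv_on U (of_nat (d * m mod ?P)) * (of_nat m * z ^ d / (1 - z ^ ?P)))"
      by (intro sum.cong refl) (simp add: sum_roots_distribution[OF m(1) z _ m(2)])
    finally have S: "?S n = (\<Sum>d<?P. of_nat m * inv_on U (of_nat (d * m mod ?P)) * (z ^ d / (1 - z ^ ?P)))"
      by (simp add: mult_ac)
    have T: "?T n = (\<Sum>d<?P. inv_on ?V (of_nat d) * (z ^ d / (1 - z ^ ?P)))"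
      unfolding riemann_sum_def using mu_measure_coset[OF z] by (intro sum.cong refl) auto
    have "absv (of_nat m * inv_on U (of_nat (d * m mod ?P)) - inv_on ?V (of_nat d)) \<le> eps n" for d
    proof -
      have dm_G: "(of_nat (d * m mod ?P) :: 'k) \<in> G \<longleftrightarrow> (of_nat d :: 'k) \<in> G"
        unfolding of_nat_mod_dom[OF is_dom_G n1] using mG
        by (simp add: of_nat_Zp_units_iff prime_dvd_mult_iff[OF prime_p] del: of_nat_mult)
      have iff: "(of_nat (d * m mod ?P) :: 'k) \<in> U \<longleftrightarrow> (of_nat d :: 'k) \<in> ?V"
      proof (cases "(of_nat d :: 'k) \<in> G")
        case True
        have dmG: "(of_nat (d * m) :: 'k) \<in> G" using Zp_units_mult[OF True mG] by simp
        have "(of_nat (d * m mod ?P) :: 'k) \<in> U \<longleftrightarrow> of_nat (d * m) \<in> U"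
          using has_levelD[OF lev _ dmG absv_mod_diff] True dm_G by simp
        then show ?thesis using True by (simp add: slice_def)
      next
        case False
        then show ?thesis using dm_G has_level_subset[OF lev] by (auto simp: slice_def)
      qed
      show ?thesis
      proof (cases "(of_nat d :: 'k) \<in> ?V")
        case True
        then have dG: "(of_nat d :: 'k) \<in> G" by (simp add: slice_def)
        let ?x = "of_nat (d * m mod ?P) :: 'k"
        have xG: "?x \<in> G" using dG dm_G by simp
        have "inverse (of_nat d :: 'k) = of_nat m * inverse (of_nat (d * m))"
          using Zp_units_nonzero[OF mG] by simp
        then have "of_nat m * inv_on U ?x - inv_on ?V (of_nat d) = of_nat m * (inverse ?x - inverse (of_nat (d * m)))"
          using True iff by (simp add: inv_on_def right_diff_distrib)
        also have "absv \<dots> = absv (?x - of_nat (d * m))"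
          unfolding absv_mult using inverse_diff_le[OF xG, of "of_nat (d * m)"] Zp_units_mult[OF dG mG] mG
          by (simp add: Zp_units_iff)
        finally show ?thesis using absv_mod_diff[of "d * m" n] by simp
      next
        case False
        then show ?thesis using iff by (simp add: inv_on_def)
      qed
    qed
    then have "absv ((of_nat m * inv_on U (of_nat (d * m mod ?P)) - inv_on ?V (of_nat d)) * (z ^ d / (1 - z ^ ?P))) \<le> eps n" for d
      by (simp only: absv_mult unit_root_absv[OF z] mult_1_right)
    then show ?thesis
      unfolding S T sum_subtractf[symmetric] left_diff_distrib[symmetric] by (intro absv_sum_le) auto
  qed
  have L1: "(\<lambda>n. ?S n - ?T n) \<longlonglongrightarrow> 0"
    by (rule tendsto_absv_bound[OF eps_tendsto], rule eventually_sequentiallyI[of N]) (simp add: bound del: power_one_over)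
  have L2: "(\<lambda>n. ?S n - ?T n) \<longlonglongrightarrow> (\<Sum>u\<in>?R. nu_root u U) - nu_root z ?V"
    using U V by (auto simp: nu_root_def intro!: tendsto_diff tendsto_sum integral_tendsto bm_mu_measure ur z inv_on_unif_cont)
  have "(\<Sum>u\<in>?R. nu_root u U) - nu_root z ?V = 0"
    by (rule LIMSEQ_unique[OF L2 L1])
  then show ?thesis by simp
qed

text \<open>Push-forward along multiplication by \<open>m\<close> is convolution with a Dirac measure, so a character
  \<open>\<chi>\<close> turns it into multiplication by \<open>\<chi> m\<close>.\<close>

lemma sum_nu_root_conv:
  fixes z :: 'k
  assumes m: "m > 0" "coprime m p" and z: "unit_root z"
  shows "(\<lambda>U. \<Sum>u | u ^ m = z. 1 * nu_root u U) = measure_conv p (nu_root z) (dirac (of_nat m))"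
proof
  fix U
  show "(\<Sum>u | u ^ m = z. 1 * nu_root u U) = measure_conv p (nu_root z) (dirac (of_nat m)) U"
  proof (cases "clopen_in G U")
    case True
    then show ?thesis
      using nu_root_distribution[OF m z True] conv_dirac[OF bm_nu_root[OF z] coprime_of_nat_unit[OF m(2)] True] by simp
  qed (simp add: nu_root_def measure_conv_def)
qed

lemma integral_sum_nu_root:
  fixes z :: 'k
  assumes m: "m > 0" "coprime m p" and z: "unit_root z" and \<chi>: "unit_character \<chi>"
  shows "(\<Sum>u | u ^ m = z. padic_integral p G \<chi> (nu_root u)) = \<chi> (of_nat m) * padic_integral p G \<chi> (nu_root z)"
proof -
  have ur: "unit_root u" if "u ^ m = z" for u using unit_root_nth_root[of u m] that z m(1) by simp
  have "(\<Sum>u | u ^ m = z. 1 * padic_integral p G \<chi> (nu_root u)) = padic_integral p G \<chi> (\<lambda>U. \<Sum>u | u ^ m = z. 1 * nu_root u U)"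
    using ur by (intro integral_linear_combination[symmetric] finite_nth_roots m bm_nu_root unit_character_unif_cont \<chi> is_dom_G) auto
  also have "\<dots> = padic_integral p G \<chi> (nu_root z) * \<chi> (of_nat m)"
    unfolding sum_nu_root_conv[OF m z]
    by (simp add: integral_conv[OF \<chi> bm_nu_root[OF z] bm_dirac] integral_dirac[OF \<chi> coprime_of_nat_unit[OF m(2)]])
  finally show ?thesis by (simp add: mult.commute)
qed

end

section \<open>Refinement of presentations\<close>

definition extend_linear :: "('k::comm_ring_1 \<Rightarrow> 'k) \<Rightarrow> ('k \<Rightarrow>\<^sub>0 'k) \<Rightarrow> 'k"
  where "extend_linear f \<xi> = (\<Sum>z\<in>Poly_Mapping.keys \<xi>. Poly_Mapping.lookup \<xi> z * f z)"

lemma extend_linear_superset: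
  assumes "finite S" "Poly_Mapping.keys \<xi> \<subseteq> S"
  shows "extend_linear f \<xi> = (\<Sum>z\<in>S. Poly_Mapping.lookup \<xi> z * f z)"
  unfolding extend_linear_def
  by (rule sum.mono_neutral_left) (use assms in \<open>auto simp: in_keys_iff\<close>)

lemma extend_linear_add: "extend_linear f (\<xi> + \<eta>) = extend_linear f \<xi> + extend_linear f \<eta>"
proof -
  let ?S = "Poly_Mapping.keys \<xi> \<union> Poly_Mapping.keys \<eta>"
  have "extend_linear f (\<xi> + \<eta>) = (\<Sum>z\<in>?S. Poly_Mapping.lookup (\<xi> + \<eta>) z * f z)"
    by (intro extend_linear_superset) (auto simp: Poly_Mapping.keys_add)
  then show ?thesis
    by (simp add: extend_linear_superset[of ?S] lookup_add sum.distrib distrib_right)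
qed

lemma extend_linear_sum: "finite I \<Longrightarrow> extend_linear f (\<Sum>i\<in>I. g i) = (\<Sum>i\<in>I. extend_linear f (g i))"
  by (induction I rule: finite_induct) (auto simp: extend_linear_add, simp add: extend_linear_def)

lemma extend_linear_single: "extend_linear f (Poly_Mapping.single u a) = a * f u"
  by (subst extend_linear_superset[of "{u}"]) auto

lemma lookup_map_mult: "Poly_Mapping.lookup (Poly_Mapping.map (\<lambda>a. c * a) \<xi>) z = c * Poly_Mapping.lookup \<xi> z"
  for c :: "'k::comm_ring_1"
  by (simp add: Poly_Mapping.map.rep_eq when_def)

lemma extend_linear_map_mult: "extend_linear f (Poly_Mapping.map (\<lambda>a. c * a) \<xi>) = c * extend_linear f \<xi>"
proof -
  have "extend_linear f (Poly_Mapping.map (\<lambda>a. c * a) \<xi>) =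
      (\<Sum>z\<in>Poly_Mapping.keys \<xi>. Poly_Mapping.lookup (Poly_Mapping.map (\<lambda>a. c * a) \<xi>) z * f z)"
    by (intro extend_linear_superset) (auto simp: in_keys_iff lookup_map_mult)
  then show ?thesis
    by (simp add: lookup_map_mult extend_linear_def sum_distrib_left mult.assoc)
qed

lemma extend_linear_refine:
  fixes \<xi> :: "'k::complete_ultrametric_field \<Rightarrow>\<^sub>0 'k"
  assumes "m > 0"
  shows "extend_linear f (refine m \<xi>) =
    (\<Sum>z\<in>Poly_Mapping.keys \<xi>. Poly_Mapping.lookup \<xi> z * of_nat m * (\<Sum>u | u ^ m = z. f u))"
  unfolding refine_def
  by (simp add: extend_linear_sum finite_nth_roots[OF assms] extend_linear_single sum_distrib_left)

lemma extend_linear_apply_op: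
  fixes \<xi> :: "'k::complete_ultrametric_field \<Rightarrow>\<^sub>0 'k"
  shows "extend_linear f (apply_op C \<xi>) =
    (\<Sum>m\<in>Poly_Mapping.keys C. Poly_Mapping.lookup C m * extend_linear f (refine m \<xi>))"
  unfolding apply_op_def by (simp add: extend_linear_sum extend_linear_map_mult)

lemma keys_sum_subset: "finite I \<Longrightarrow> Poly_Mapping.keys (\<Sum>i\<in>I. g i) \<subseteq> (\<Union>i\<in>I. Poly_Mapping.keys (g i))"
  by (induction I rule: finite_induct) (use Poly_Mapping.keys_add in fastforce)+

lemma keys_refine:
  fixes \<xi> :: "'k::complete_ultrametric_field \<Rightarrow>\<^sub>0 'k"
  assumes "m > 0" "u \<in> Poly_Mapping.keys (refine m \<xi>)" shows "u ^ m \<in> Poly_Mapping.keys \<xi>"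
proof -
  have "Poly_Mapping.keys (refine m \<xi>) \<subseteq> (\<Union>z\<in>Poly_Mapping.keys \<xi>. \<Union>u\<in>{u. u ^ m = z}. {u})"
    unfolding refine_def
    by (rule order_trans[OF keys_sum_subset], simp, rule UN_mono, simp,
        rule order_trans[OF keys_sum_subset[OF finite_nth_roots[OF assms(1)]]], rule UN_mono) (auto split: if_splits)
  then show ?thesis using assms(2) by auto
qed

lemma keys_apply_op:
  fixes \<xi> :: "'k::complete_ultrametric_field \<Rightarrow>\<^sub>0 'k"
  assumes "u \<in> Poly_Mapping.keys (apply_op C \<xi>)"
  obtains m where "m \<in> Poly_Mapping.keys C" "u \<in> Poly_Mapping.keys (refine m \<xi>)"
proof -
  have "u \<in> (\<Union>m\<in>Poly_Mapping.keys C. Poly_Mapping.keys (Poly_Mapping.map (\<lambda>a. Poly_Mapping.lookup C m * a) (refine m \<xi>)))"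
    using assms unfolding apply_op_def by (rule subsetD[OF keys_sum_subset, rotated]) simp
  then obtain m where m: "m \<in> Poly_Mapping.keys C" "Poly_Mapping.lookup C m * Poly_Mapping.lookup (refine m \<xi>) u \<noteq> 0"
    by (auto simp: in_keys_iff lookup_map_mult)
  then have "u \<in> Poly_Mapping.keys (refine m \<xi>)" by (auto simp: in_keys_iff)
  then show ?thesis using m(1) that by blast
qed

section \<open>The exceptional component\<close>

context padic_ambient
begin

text \<open>The character \<open>\<omega>\<inverse>\<langle>x\<rangle>\<^sup>s\<close> of the exceptional component.\<close>

definition exc_char :: "'k \<Rightarrow> 'k \<Rightarrow> 'k"
  where "exc_char s x = (teich p x powi (- 1)) * padic_pow (principal p x) s"

lemma teich_one: "teich p (1::'k) = 1" and principal_one: "principal p (1::'k) = 1"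
proof -
  show "teich p (1::'k) = 1" by (rule teichI) (auto simp: principal_coset_iff)
  then show "principal p (1::'k) = 1" by (simp add: principal_def)
qed

lemma exc_char_one: "s \<in> ZZ \<Longrightarrow> exc_char s 1 = 1"
  using padic_pow_eq_one_iff[of 1 s] by (simp add: exc_char_def teich_one principal_one)

lemma exc_char_G:
  assumes "s \<in> ZZ" "x \<in> G" shows "exc_char s x \<in> G"
  unfolding exc_char_def power_int_minus power_int_1_right
  by (intro Zp_units_mult Zp_units_inverse teich(1) padic_pow_Zp principal(1) Zp_units_Zp[OF principal(2)] assms)

lemma exc_char_character:
  assumes s: "s \<in> ZZ" shows "unit_character (exc_char s)"
  unfolding unit_character_def
proof (intro conjI ballI impI)
  fix x y assume x: "x \<in> G" and y: "y \<in> G"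
  show "exc_char s (x * y) = exc_char s x * exc_char s y"
    unfolding exc_char_def teich_mult[OF x y] principal_mult_eq[OF x y]
      padic_pow_mult[OF principal(1)[OF x] principal(1)[OF y] s] by (simp add: power_int_minus)
next
  fix x assume "x \<in> G"
  then show "absv (exc_char s x) \<le> 1" using exc_char_G[OF s] by (simp add: Zp_units_iff)
next
  fix x y assume x: "x \<in> G" and y: "y \<in> G" and d: "absv (x - y) \<le> eps 1"
  have t: "absv (teich p x) = 1" "teich p y = teich p x"
    using teich(1)[OF x] teich_cong[OF x y d] by (auto simp: Zp_units_iff)
  have "exc_char s x - exc_char s y = inverse (teich p x) * (padic_pow (principal p x) s - padic_pow (principal p y) s)"
    by (simp add: exc_char_def t(2) power_int_minus right_diff_distrib)
  then have "absv (exc_char s x - exc_char s y) = absv (padic_pow (principal p x) s - padic_pow (principal p y) s)"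
    by (simp add: absv_mult absv_inverse t(1))
  also have "\<dots> \<le> absv (principal p x - principal p y)"
    by (rule padic_pow_diff_le[OF principal(1)[OF x] principal(1)[OF y] s])
  also have "\<dots> = absv (x - y)"
    by (simp add: principal_def t absv_divide flip: diff_divide_distrib)
  finally show "absv (exc_char s x - exc_char s y) \<le> absv (x - y)" .
qed

text \<open>This identity is special to the exceptional component: the factor \<open>m\<close> in the refinement operator
  cancels the Teichmueller part of the character.\<close>

lemma exc_char_mult_self:
  assumes "s \<in> ZZ" "x \<in> G" shows "x * exc_char s x = padic_pow (principal p x) (s + 1)"
proof -
  have "teich p x \<noteq> 0" using teich(1)[OF assms(2)] Zp_units_nonzero by blast
  then show ?thesis
    unfolding exc_char_def padic_pow_plus_one[OF principal(1)[OF assms(2)] assms(1)]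
    by (simp add: power_int_minus principal_def field_simps)
qed

lemma integral_r_elem_exc:
  assumes s: "s \<in> ZZ" and c: "admissible p c"
  shows "padic_integral p G (exc_char s) (r_elem c) = 1 - padic_pow (principal p (of_nat c)) (s + 1)"
  using integral_r_elem[OF exc_char_character[OF s], of c] c exc_char_one[OF s]
    exc_char_mult_self[OF s coprime_of_nat_unit, of c] by (simp add: admissible_def)

text \<open>An integer \<open>c > 1\<close> is not a root of unity, so its principal part is not \<open>1\<close>.\<close>

lemma principal_of_nat_neq_one:
  assumes "coprime c p" "c > 1" shows "principal p (of_nat c :: 'k) \<noteq> 1"
proof
  assume p1: "principal p (of_nat c :: 'k) = 1"
  have cG: "(of_nat c :: 'k) \<in> G" using coprime_of_nat_unit assms(1) .
  have "(of_nat c :: 'k) = teich p (of_nat c)" using principal(3)[OF cG] p1 by simp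
  then have "(of_nat (c ^ (p - 1)) :: 'k) = of_nat 1" using teich(2)[OF cG] by simp
  then have "c ^ (p - 1) = 1" by (simp only: of_nat_eq_iff)
  then show False using assms(2) p_ge_3 by simp
qed

lemma integral_r_elem_exc_nonzero:
  assumes s: "s \<in> ZZ - {- 1}" and c: "admissible p c"
  shows "padic_integral p G (exc_char s) (r_elem c) \<noteq> 0"
proof -
  have cp: "coprime c p" "c > 1" using c by (auto simp: admissible_def)
  have "s + 1 \<noteq> 0" using s by (auto simp: add_eq_0_iff2)
  moreover have "s + 1 \<in> ZZ" using s by (auto intro: Zp_add)
  ultimately show ?thesis
    using padic_pow_eq_one_iff[OF principal(1)[OF coprime_of_nat_unit[OF cp(1)]], of "s + 1"]
      principal_of_nat_neq_one[OF cp] integral_r_elem_exc[OF _ c, of s] s by auto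
qed

lemma bm_restrict_units:
  fixes \<Lambda> :: "'k set \<Rightarrow> 'k"
  assumes "\<Lambda> \<in> bounded_measures ZZ" shows "restrict_units \<Lambda> \<in> bounded_measures G"
proof -
  obtain B where B: "B > 0" "\<And>U. absv (\<Lambda> U) \<le> B" using bm_bound[OF assms] by blast
  have cl: "clopen_in ZZ U" if "clopen_in G U" for U :: "'k set"
    using clopen_has_level[OF is_dom_G that] has_level_clopen[OF level_G_ZZ] by metis
  show ?thesis
  proof (rule bounded_measuresI[of _ _ B])
    fix U V :: "'k set" assume a: "clopen_in G U" "clopen_in G V" "U \<inter> V = {}"
    then show "restrict_units \<Lambda> (U \<union> V) = restrict_units \<Lambda> U + restrict_units \<Lambda> V"
      using clopen_Un[OF is_dom_G a(1,2)] bm_add[OF assms cl[OF a(1)] cl[OF a(2)]] by (simp add: restrict_units_def)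
  qed (use B in \<open>auto simp: restrict_units_def\<close>)
qed

definition unit_root_support :: "('k \<Rightarrow>\<^sub>0 'k) \<Rightarrow> bool"
  where "unit_root_support \<xi> \<longleftrightarrow> (\<forall>z\<in>Poly_Mapping.keys \<xi>. unit_root z)"

lemma bm_nu_measure: "unit_root_support \<xi> \<Longrightarrow> nu_measure p \<xi> \<in> bounded_measures G"
  unfolding nu_measure_eq unit_root_support_def by (intro bm_linear_combination bm_nu_root) auto

lemma integral_nu_measure:
  assumes "unit_root_support \<xi>" "unit_character \<chi>"
  shows "padic_integral p G \<chi> (nu_measure p \<xi>) = extend_linear (\<lambda>z. padic_integral p G \<chi> (nu_root z)) \<xi>"
  unfolding nu_measure_eq extend_linear_def using assms
  by (intro integral_linear_combination bm_nu_root unit_character_unif_cont is_dom_G) (auto simp: unit_root_support_def)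

lemma unit_root_support_apply_op:
  assumes "unit_root_support \<xi>" "C \<in> normalized_ops p K" shows "unit_root_support (apply_op C \<xi>)"
  unfolding unit_root_support_def
proof
  fix u assume "u \<in> Poly_Mapping.keys (apply_op C \<xi>)"
  then obtain m where m: "m \<in> Poly_Mapping.keys C" "u \<in> Poly_Mapping.keys (refine m \<xi>)" by (rule keys_apply_op)
  then have "m > 0" using assms(2) by (auto simp: normalized_ops_def)
  then show "unit_root u"
    using keys_refine[OF _ m(2)] assms(1) unit_root_nth_root by (auto simp: unit_root_support_def)
qed

lemma integral_nu_apply_op:
  assumes \<xi>: "unit_root_support \<xi>" and C: "C \<in> normalized_ops p K" and s: "s \<in> ZZ"
  shows "padic_integral p G (exc_char s) (nu_measure p (apply_op C \<xi>)) =
    (\<Sum>m\<in>Poly_Mapping.keys C. Poly_Mapping.lookup C m * padic_pow (principal p (of_nat m)) (s + 1)) *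
    padic_integral p G (exc_char s) (nu_measure p \<xi>)"
proof -
  note \<chi> = exc_char_character[OF s]
  let ?I = "\<lambda>z. padic_integral p G (exc_char s) (nu_root z)"
  have "extend_linear ?I (refine m \<xi>) = padic_pow (principal p (of_nat m)) (s + 1) * extend_linear ?I \<xi>"
    if "m \<in> Poly_Mapping.keys C" for m
  proof -
    have m: "m > 0" "coprime m p" using that C by (auto simp: normalized_ops_def)
    have "extend_linear ?I (refine m \<xi>) =
      (\<Sum>z\<in>Poly_Mapping.keys \<xi>. Poly_Mapping.lookup \<xi> z * of_nat m * (exc_char s (of_nat m) * ?I z))"
      unfolding extend_linear_refine[OF m(1)]
      using \<xi> by (intro sum.cong refl) (simp add: integral_sum_nu_root[OF m _ \<chi>] unit_root_support_def)
    also have "\<dots> = (of_nat m * exc_char s (of_nat m)) * extend_linear ?I \<xi>"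
      by (simp add: extend_linear_def sum_distrib_left mult_ac)
    finally show ?thesis
      by (simp add: exc_char_mult_self[OF s coprime_of_nat_unit[OF m(2)]])
  qed
  then show ?thesis
    unfolding integral_nu_measure[OF \<xi> \<chi>] integral_nu_measure[OF unit_root_support_apply_op[OF \<xi> C] \<chi>]
      extend_linear_apply_op by (simp add: sum_distrib_right mult.assoc)
qed

lemma pm_mellin_pseudomeasure:
  assumes \<Lambda>: "\<Lambda> \<in> bounded_measures ZZ" and \<xi>: "unit_root_support \<xi>" and c: "admissible p c" and s: "s \<in> ZZ - {- 1}"
  shows "pm_mellin p (pseudomeasure p c \<Lambda> \<xi>) (- 1) s =
    padic_integral p G (exc_char s) (restrict_units \<Lambda>) * padic_integral p G (exc_char s) (nu_measure p \<xi>) /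
    (1 - padic_pow (principal p (of_nat c)) (s + 1))"
proof -
  have s': "s \<in> ZZ" using s by simp
  note \<chi> = exc_char_character[OF s']
  have e: "(\<lambda>x. (teich p x powi (- 1)) * padic_pow (principal p x) s) = exc_char s"
    by (simp add: fun_eq_iff exc_char_def)
  note frac = pm_mellin_frac[OF bm_conv[OF bm_restrict_units[OF \<Lambda>] bm_nu_measure[OF \<xi>]] c, of "- 1" s, unfolded e,
      OF \<chi> _ integral_r_elem_exc_nonzero[OF s]]
  show ?thesis
    unfolding pseudomeasure_def integral_conv[OF \<chi> bm_restrict_units[OF \<Lambda>] bm_nu_measure[OF \<xi>], symmetric]
      integral_r_elem_exc[OF s' c, symmetric]
    using exc_char_one[OF s'] by (intro frac) (simp_all add: exc_char_def)
qed

lemma pm_mellin_apply_op: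
  assumes \<Lambda>: "\<Lambda> \<in> bounded_measures ZZ" and \<xi>: "unit_root_support \<xi>" and c: "admissible p c"
    and s: "s \<in> ZZ - {- 1}" and C: "C \<in> normalized_ops p K"
  shows "pm_mellin p (pseudomeasure p c \<Lambda> (apply_op C \<xi>)) (- 1) s =
    (\<Sum>m\<in>Poly_Mapping.keys C. Poly_Mapping.lookup C m * padic_pow (principal p (of_nat m)) (s + 1)) *
    pm_mellin p (pseudomeasure p c \<Lambda> \<xi>) (- 1) s"
  unfolding pm_mellin_pseudomeasure[OF \<Lambda> \<xi> c s] pm_mellin_pseudomeasure[OF \<Lambda> unit_root_support_apply_op[OF \<xi> C] c s]
  using integral_nu_apply_op[OF \<xi> C, of s] s by (simp add: mult_ac)

lemma cyc_presentation_unit_root_support: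
  assumes "cyc_presentation p K \<xi>" shows "unit_root_support \<xi>"
  unfolding unit_root_support_def
proof
  fix z assume "z \<in> Poly_Mapping.keys \<xi>"
  then obtain n where "z \<noteq> 1" "n > 0" "z ^ n = 1" "coprime n p"
    using assms unfolding cyc_presentation_def by blast
  then show "unit_root z" using unit_root_order_coprime by blast
qed

end

section \<open>Subfields and their closedness\<close>

lemma subfieldD:
  assumes "is_subfield K"
  shows "1 \<in> K" "0 \<in> K" "x \<in> K \<Longrightarrow> y \<in> K \<Longrightarrow> x - y \<in> K" "x \<in> K \<Longrightarrow> y \<in> K \<Longrightarrow> x * y \<in> K"
    "x \<in> K \<Longrightarrow> inverse x \<in> K" "x \<in> K \<Longrightarrow> - x \<in> K" "x \<in> K \<Longrightarrow> y \<in> K \<Longrightarrow> x + y \<in> K"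
    "x \<in> K \<Longrightarrow> y \<in> K \<Longrightarrow> x / y \<in> K" "x \<in> K \<Longrightarrow> x ^ n \<in> K"
proof -
  show one: "1 \<in> K" and diff: "\<And>x y. x \<in> K \<Longrightarrow> y \<in> K \<Longrightarrow> x - y \<in> K"
    and mult: "\<And>x y. x \<in> K \<Longrightarrow> y \<in> K \<Longrightarrow> x * y \<in> K" and inv: "\<And>x. x \<in> K \<Longrightarrow> inverse x \<in> K"
    using assms by (auto simp: is_subfield_def)
  show zero: "0 \<in> K" using diff[OF one one] by simp
  show neg: "\<And>x. x \<in> K \<Longrightarrow> - x \<in> K" using diff[OF zero] by simp
  show "\<And>x y. x \<in> K \<Longrightarrow> y \<in> K \<Longrightarrow> x + y \<in> K" using diff neg by (metis diff_minus_eq_add)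
  show "\<And>x y. x \<in> K \<Longrightarrow> y \<in> K \<Longrightarrow> x / y \<in> K" using mult inv by (simp add: divide_inverse)
  show "x \<in> K \<Longrightarrow> x ^ n \<in> K" by (induction n) (auto intro: one mult)
qed

lemma subfield_sum: "is_subfield K \<Longrightarrow> (\<And>i. i \<in> I \<Longrightarrow> f i \<in> K) \<Longrightarrow> sum f I \<in> K"
  by (induction I rule: infinite_finite_induct) (auto intro: subfieldD)

lemma subfield_of_nat: "is_subfield K \<Longrightarrow> of_nat n \<in> K"
  by (induction n) (auto intro: subfieldD)

lemma subfield_of_int: "is_subfield K \<Longrightarrow> of_int n \<in> K"
  by (cases n rule: int_cases2) (auto intro: subfieldD subfield_of_nat)

lemma subfield_gbinomial:
  assumes "is_subfield K" "a \<in> K" shows "a gchoose n \<in> K"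
proof -
  have "(\<Prod>i<n. a - of_nat i) \<in> K"
    by (induction n) (auto intro: subfieldD subfield_of_nat assms)
  moreover have "fact n \<in> K"
    using subfield_of_nat[OF assms(1), of "fact n"] by simp
  ultimately show ?thesis
    by (simp add: gbinomial_prod_rev atLeast0LessThan subfieldD[OF assms(1)])
qed

lemma tendsto_inverse_ultrametric:
  fixes l :: "'k::complete_ultrametric_field"
  assumes f: "f \<longlonglongrightarrow> l" and l: "l \<noteq> 0"
  shows "(\<lambda>n. inverse (f n)) \<longlonglongrightarrow> inverse l"
proof -
  have "\<forall>\<^sub>F n in sequentially. dist (f n) l < absv l"
    using f l by (simp add: tendsto_iff)
  then have ev: "\<forall>\<^sub>F n in sequentially. absv (f n) = absv l"
    by eventually_elim (rule absv_eq_of_diff_less, simp add: dist_eq_dist_diff[symmetric])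
  have "((\<lambda>n. absv (f n - l) / (absv l * absv l)) \<longlonglongrightarrow> 0 / (absv l * absv l))"
    by (intro tendsto_divide tendsto_const f[unfolded tendsto_iff_absv]) (use l in simp)
  then have z: "((\<lambda>n. absv (f n - l) / (absv l * absv l)) \<longlonglongrightarrow> 0)" by simp
  show ?thesis
  proof (rule tendsto_absv_bound[OF z])
    show "\<forall>\<^sub>F n in sequentially. absv (inverse (f n) - inverse l) \<le> absv (f n - l) / (absv l * absv l)"
      using ev
    proof eventually_elim
      case (elim n)
      then have "f n \<noteq> 0" using l by auto
      then have "inverse (f n) - inverse l = (l - f n) / (f n * l)" using l by (simp add: field_simps)
      then show ?case using elim absv_diff_commute[of l "f n"] by (simp add: absv_divide absv_mult)
    qed
  qed
qed

lemma is_subfield_closure: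
  fixes F :: "'k::complete_ultrametric_field set"
  assumes F: "is_subfield F" shows "is_subfield (closure F)"
  unfolding is_subfield_def
proof (intro conjI ballI)
  show "1 \<in> closure F" using subfieldD(1)[OF F] closure_subset by blast
next
  fix x y assume "x \<in> closure F" "y \<in> closure F"
  then obtain f g where f: "\<forall>n. f n \<in> F" "f \<longlonglongrightarrow> x" and g: "\<forall>n. g n \<in> F" "g \<longlonglongrightarrow> y"
    unfolding closure_sequential by blast
  have "(\<lambda>n. f n - g n) \<longlonglongrightarrow> x - y" "(\<lambda>n. f n * g n) \<longlonglongrightarrow> x * y"
    by (intro tendsto_diff tendsto_mult f g)+
  moreover have "\<forall>n. f n - g n \<in> F" "\<forall>n. f n * g n \<in> F"
    using f(1) g(1) subfieldD[OF F] by auto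
  ultimately show "x - y \<in> closure F" "x * y \<in> closure F"
    unfolding closure_sequential by meson+
next
  fix x assume "x \<in> closure F"
  then obtain f where f: "\<forall>n. f n \<in> F" "f \<longlonglongrightarrow> x" unfolding closure_sequential by blast
  show "inverse x \<in> closure F"
  proof (cases "x = 0")
    case True
    then show ?thesis using \<open>x \<in> closure F\<close> by simp
  next
    case False
    have "\<forall>n. inverse (f n) \<in> F" using f(1) subfieldD[OF F] by auto
    then show ?thesis
      using tendsto_inverse_ultrametric[OF f(2) False] unfolding closure_sequential by meson
  qed
qed

lemma is_subfield_Qp: "is_subfield (Qp :: 'k::complete_ultrametric_field set)"
  unfolding Qp_def by (rule is_subfield_closure) (auto simp: is_subfield_def)

definition field_span :: "'k::complete_ultrametric_field set \<Rightarrow> 'k set \<Rightarrow> 'k set"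
  where "field_span F B = {x. \<exists>q. (\<forall>b\<in>B. q b \<in> F) \<and> x = (\<Sum>b\<in>B. q b * b)}"

lemma field_span_insert:
  assumes "finite B" "b \<notin> B"
  shows "x \<in> field_span F (insert b B) \<longleftrightarrow> (\<exists>w\<in>field_span F B. \<exists>q\<in>F. x = w + q * b)"
proof
  assume "x \<in> field_span F (insert b B)"
  then obtain q where q: "\<forall>b\<in>insert b B. q b \<in> F" "x = (\<Sum>b\<in>insert b B. q b * b)"
    unfolding field_span_def by blast
  then have "x = (\<Sum>b\<in>B. q b * b) + q b * b" using assms by (simp add: add.commute)
  moreover have "(\<Sum>b\<in>B. q b * b) \<in> field_span F B" using q(1) by (auto simp: field_span_def)
  ultimately show "\<exists>w\<in>field_span F B. \<exists>q\<in>F. x = w + q * b" using q(1) by blast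
next
  assume "\<exists>w\<in>field_span F B. \<exists>q\<in>F. x = w + q * b"
  then obtain r q where r: "\<forall>b\<in>B. r b \<in> F" "q \<in> F" "x = (\<Sum>b\<in>B. r b * b) + q * b"
    unfolding field_span_def by blast
  have "x = (\<Sum>c\<in>insert b B. (r(b := q)) c * c)"
    using assms r(3) by (simp add: add.commute) (rule sum.cong, auto)
  moreover have "\<forall>c\<in>insert b B. (r(b := q)) c \<in> F" using r by auto
  ultimately show "x \<in> field_span F (insert b B)" unfolding field_span_def by blast
qed

lemma field_span_add_scaled:
  assumes F: "is_subfield F" and "x \<in> field_span F B" "y \<in> field_span F B" "c \<in> F"
  shows "x + c * y \<in> field_span F B"
proof -
  obtain q r where q: "\<forall>b\<in>B. q b \<in> F" "x = (\<Sum>b\<in>B. q b * b)" and r: "\<forall>b\<in>B. r b \<in> F" "y = (\<Sum>b\<in>B. r b * b)"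
    using assms unfolding field_span_def by blast
  have "x + c * y = (\<Sum>b\<in>B. (q b + c * r b) * b)"
    by (simp add: q(2) r(2) sum.distrib sum_distrib_left distrib_right mult.assoc)
  moreover have "\<forall>b\<in>B. q b + c * r b \<in> F" using q r assms subfieldD[OF F] by auto
  ultimately show ?thesis unfolding field_span_def by (intro CollectI exI[of _ "\<lambda>b. q b + c * r b"]) auto
qed

text \<open>Induction on the number of generators. If \<open>b\<close> has positive distance \<open>\<delta>\<close> to the closed space
  \<open>W\<close>, then \<open>w + q b\<close> is at least as large as \<open>\<delta> q\<close>, so the coefficients of \<open>b\<close> in a convergent sequence
  in \<open>W + F b\<close> converge.\<close>

lemma closed_field_span:
  fixes F :: "'k::complete_ultrametric_field set"
  assumes F: "is_subfield F" "closed F" and B: "finite B"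
  shows "closed (field_span F B)"
  using B
proof (induction B rule: finite_induct)
  case empty
  have "field_span F {} = {0}" by (auto simp: field_span_def)
  then show ?case by simp
next
  case (insert b B)
  let ?W = "field_span F B"
  have W0: "0 \<in> ?W"
    unfolding field_span_def using subfieldD(2)[OF F(1)] by (intro CollectI exI[of _ "\<lambda>_. 0"]) auto
  show ?case
  proof (cases "b \<in> ?W")
    case True
    have "field_span F (insert b B) = ?W"
    proof (intro set_eqI iffI)
      fix x assume "x \<in> field_span F (insert b B)"
      then show "x \<in> ?W"
        using field_span_add_scaled[OF F(1) _ True] by (auto simp: field_span_insert[OF insert.hyps(1,2)])
    next
      fix x assume "x \<in> ?W"
      then show "x \<in> field_span F (insert b B)"
        using subfieldD(2)[OF F(1)] unfolding field_span_insert[OF insert.hyps(1,2)]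
        by (intro bexI[of _ x] bexI[of _ 0]) auto
    qed
    then show ?thesis using insert.IH by simp
  next
    case False
    then have "b \<in> - ?W" by simp
    moreover have "open (- ?W)" using insert.IH by (simp add: open_Compl)
    ultimately obtain \<delta> where d: "\<delta> > 0" "\<forall>y. dist y b < \<delta> \<longrightarrow> y \<in> - ?W"
      unfolding open_dist by blast
    have "\<delta> \<le> absv (w - b)" if "w \<in> ?W" for w
      using d(2) that dist_eq_dist_diff[of w b] by (metis ComplD linorder_not_le)
    note \<delta> = d(1) this
    have coeff: "absv q \<le> absv (w + q * b) / \<delta>" if "w \<in> ?W" "q \<in> F" for w q
    proof (cases "q = 0")
      case q0: False
      have "0 + (- inverse q) * w \<in> ?W"
        using that subfieldD[OF F(1)] by (intro field_span_add_scaled[OF F(1) W0]) auto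
      then have "\<delta> \<le> absv (0 + (- inverse q) * w - b)" by (rule \<delta>(2))
      also have "0 + (- inverse q) * w - b = - (inverse q) * (w + q * b)" using q0 by (simp add: algebra_simps)
      finally have "\<delta> \<le> absv (w + q * b) / absv q"
        by (simp add: absv_mult absv_inverse divide_inverse mult.commute)
      then show ?thesis using \<delta>(1) q0 by (simp add: field_simps)
    qed (use \<delta>(1) in simp)
    show ?thesis
      unfolding closed_sequential_limits
    proof (intro allI impI, elim conjE)
      fix f l assume f: "\<forall>n. f n \<in> field_span F (insert b B)" "f \<longlonglongrightarrow> l"
      then obtain w q where wq: "\<And>n. w n \<in> ?W" "\<And>n. q n \<in> F" "\<And>n. f n = w n + q n * b"
        unfolding field_span_insert[OF insert.hyps(1,2)] by metis
      have "(\<lambda>n. f (Suc n) - f n) \<longlonglongrightarrow> l - l" by (intro tendsto_diff LIMSEQ_Suc f)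
      then have "(\<lambda>n. absv (f (Suc n) - f n) / \<delta>) \<longlonglongrightarrow> absv (l - l) / \<delta>"
        using \<delta>(1) by (intro tendsto_divide tendsto_absv tendsto_const) auto
      then have z: "(\<lambda>n. absv (f (Suc n) - f n) / \<delta>) \<longlonglongrightarrow> 0" by simp
      have "(\<lambda>n. q (Suc n) - q n) \<longlonglongrightarrow> 0"
      proof (rule tendsto_absv_bound[OF z], rule always_eventually, rule allI)
        fix n
        have "w (Suc n) + (- 1) * w n \<in> ?W"
          by (rule field_span_add_scaled[OF F(1) wq(1) wq(1) subfieldD(6)[OF F(1) subfieldD(1)[OF F(1)]]])
        moreover have "q (Suc n) - q n \<in> F"
          by (rule subfieldD(3)[OF F(1) wq(2) wq(2)])
        ultimately show "absv (q (Suc n) - q n - 0) \<le> absv (f (Suc n) - f n) / \<delta>"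
          using coeff by (fastforce simp: wq(3) algebra_simps)
      qed
      then obtain r where r: "q \<longlonglongrightarrow> r" using convergent_ultrametric by blast
      have rF: "r \<in> F" by (rule closed_sequentially[OF F(2) _ r]) (use wq in simp)
      have "(\<lambda>n. f n - q n * b) \<longlonglongrightarrow> l - r * b" by (intro tendsto_diff tendsto_mult f r tendsto_const)
      then have "w \<longlonglongrightarrow> l - r * b" by (simp add: wq(3))
      then have "l - r * b \<in> ?W" by (rule closed_sequentially[OF insert.IH, rotated]) (use wq in simp)
      then show "l \<in> field_span F (insert b B)"
        unfolding field_span_insert[OF insert.hyps(1,2)] using rF
        by (intro bexI[of _ "l - r * b"] bexI[of _ r]) auto
    qed
  qed
qed

lemma finite_unramified_subfield: "finite_unramified K \<Longrightarrow> is_subfield K"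
  by (simp add: finite_unramified_def)

lemma finite_unramified_closed:
  fixes K :: "'k::complete_ultrametric_field set"
  assumes "finite_unramified K" shows "closed K"
proof -
  have K: "is_subfield K" "Qp \<subseteq> K" using assms by (auto simp: finite_unramified_def)
  have "\<exists>B. finite B \<and> B \<subseteq> K \<and> (\<forall>x\<in>K. \<exists>q. (\<forall>b\<in>B. q b \<in> Qp) \<and> x = (\<Sum>b\<in>B. q b * b))"
    using assms by (simp add: finite_unramified_def)
  then obtain B where B: "finite B" "B \<subseteq> K" "\<forall>x\<in>K. \<exists>q. (\<forall>b\<in>B. q b \<in> Qp) \<and> x = (\<Sum>b\<in>B. q b * b)"
    by (elim exE conjE)
  have "K = field_span Qp B"
  proof
    show "K \<subseteq> field_span Qp B" using B(3) by (auto simp: field_span_def)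
    show "field_span Qp B \<subseteq> K"
    proof
      fix x assume "x \<in> field_span Qp B"
      then obtain q where q: "\<forall>b\<in>B. q b \<in> Qp" "x = (\<Sum>b\<in>B. q b * b)" unfolding field_span_def by blast
      have "q b * b \<in> K" if "b \<in> B" for b
        by (rule subfieldD(4)[OF K(1)]) (use q(1) that B(2) K(2) in blast)+
      then show "x \<in> K" unfolding q(2) by (rule subfield_sum[OF K(1)])
    qed
  qed
  moreover have "closed (field_span Qp B)"
    by (rule closed_field_span[OF is_subfield_Qp _ B(1)]) (simp add: Qp_def)
  ultimately show ?thesis by simp
qed

lemma Zp_subset_finite_unramified: "finite_unramified K \<Longrightarrow> Zp \<subseteq> K"
  unfolding finite_unramified_def Zp_def Qp_def
  by (meson Ints_subset_Rats closure_mono order_trans)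

section \<open>Mahler expansion of locally constant functions\<close>

fun forward_diff :: "(nat \<Rightarrow> int) \<Rightarrow> nat \<Rightarrow> nat \<Rightarrow> int"
  where "forward_diff f 0 a = f a"
  | "forward_diff f (Suc k) a = forward_diff f k (Suc a) - forward_diff f k a"

lemma newton_expansion: "f (a + k) = (\<Sum>i\<le>k. int (k choose i) * forward_diff f i a)"
proof (induction k arbitrary: a)
  case (Suc k)
  let ?x = "\<lambda>i. forward_diff f i a"
  have "f (a + Suc k) = (\<Sum>i\<le>k. int (k choose i) * forward_diff f i (Suc a))"
    using Suc[of "Suc a"] by simp
  also have "\<dots> = (\<Sum>i\<le>k. int (k choose i) * ?x i) + (\<Sum>i\<le>k. int (k choose i) * ?x (Suc i))"
    by (simp add: sum.distrib[symmetric] algebra_simps)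
  also have "(\<Sum>i\<le>k. int (k choose i) * ?x i) = (\<Sum>i\<le>Suc k. int (k choose i) * ?x i)"
    by (simp add: binomial_eq_0)
  also have "\<dots> = ?x 0 + (\<Sum>i\<le>k. int (k choose Suc i) * ?x (Suc i))"
    by (subst sum.atMost_Suc_shift) simp
  also have "\<dots> + (\<Sum>i\<le>k. int (k choose i) * ?x (Suc i)) = (\<Sum>i\<le>Suc k. int (Suc k choose i) * ?x i)"
  proof -
    have "int (Suc k choose Suc i) * ?x (Suc i) = int (k choose Suc i) * ?x (Suc i) + int (k choose i) * ?x (Suc i)" for i
      by (simp add: distrib_right del: forward_diff.simps(2))
    then show ?thesis
      unfolding sum.atMost_Suc_shift[of "\<lambda>i. int (Suc k choose i) * ?x i" k]
      by (simp only: sum.distrib add.assoc binomial_n_0 of_nat_1 mult_1)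
  qed
  finally show ?case .
qed simp

lemma forward_diff_add: "forward_diff f (j + k) a = forward_diff (forward_diff f j) k a"
  by (induction k arbitrary: a) auto

lemma forward_diff_dvd: "(\<And>a. c dvd g a) \<Longrightarrow> c dvd forward_diff g k a"
  by (induction k arbitrary: a) auto

lemma forward_diff_cmult: "forward_diff (\<lambda>a. c * g a) k a = c * forward_diff g k a"
  by (induction k arbitrary: a) (auto simp: algebra_simps)

lemma forward_diff_periodic:
  assumes "\<And>a. f (a + N) = f a" shows "forward_diff f k (a + N) = forward_diff f k a"
  using assms by (induction k arbitrary: a) (auto simp flip: add_Suc)

lemma prime_dvd_prime_power_choose:
  fixes p :: nat
  assumes p: "prime p" and i: "0 < i" "i < p ^ n" shows "p dvd (p ^ n choose i)"
proof (rule ccontr)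
  assume "\<not> p dvd (p ^ n choose i)"
  then have "coprime (p ^ n) (p ^ n choose i)" using p by (simp add: prime_imp_coprime)
  moreover have "i * (p ^ n choose i) = p ^ n * (p ^ n - 1 choose (i - 1))"
    using i times_binomial_minus1_eq[of i "p ^ n"] by simp
  then have "p ^ n dvd i * (p ^ n choose i)" by simp
  ultimately have "p ^ n dvd i" using coprime_dvd_mult_left_iff by blast
  then show False using i by (auto dest: dvd_imp_le)
qed

text \<open>Modulo \<open>p\<close> only the extreme terms of the Newton expansion with \<open>p ^ n\<close> steps survive, and for a
  function of period \<open>p ^ n\<close> the first of them equals the left-hand side.\<close>

lemma prime_dvd_forward_diff:
  assumes p: "prime p" and f: "\<And>a. f (a + p ^ n) = f a"
  shows "int p dvd forward_diff f (p ^ n) a"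
proof -
  let ?N = "p ^ n"
  let ?t = "\<lambda>i. int (?N choose i) * forward_diff f i a"
  have N: "?N > 0" using prime_gt_0_nat[OF p] by simp
  have "{..?N} = insert 0 (insert ?N {0<..<?N})" using N by auto
  then have "f (a + ?N) = f a + (forward_diff f ?N a + (\<Sum>i\<in>{0<..<?N}. ?t i))"
    unfolding newton_expansion[of f a ?N] using N by simp
  then have "forward_diff f ?N a = - (\<Sum>i\<in>{0<..<?N}. ?t i)" using f[of a] by simp
  moreover have "int p dvd (\<Sum>i\<in>{0<..<?N}. ?t i)"
    by (intro dvd_sum dvd_mult2) (use prime_dvd_prime_power_choose[OF p] in auto)
  ultimately show ?thesis by simp
qed

text \<open>Each block of \<open>p ^ n\<close> differences contributes a factor \<open>p\<close>, because the quotient is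
  periodic again.\<close>

lemma prime_power_dvd_forward_diff:
  assumes p: "prime p" and f: "\<And>a. f (a + p ^ n) = f a" and k: "k \<ge> m * p ^ n"
  shows "int p ^ m dvd forward_diff f k a"
proof -
  have "int p ^ m dvd forward_diff f (m * p ^ n) a" for a
  proof (induction m arbitrary: a)
    case (Suc m)
    define g where "g a = forward_diff f (m * p ^ n) a div int p ^ m" for a
    have g: "forward_diff f (m * p ^ n) = (\<lambda>a. int p ^ m * g a)"
      using Suc by (simp add: g_def fun_eq_iff)
    have "g (a + p ^ n) = g a" for a
      by (simp add: g_def forward_diff_periodic[where f=f and N="p ^ n", OF f])
    then have "int p dvd forward_diff g (p ^ n) a" by (rule prime_dvd_forward_diff[OF p])
    moreover have "forward_diff f (Suc m * p ^ n) a = int p ^ m * forward_diff g (p ^ n) a"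
      using forward_diff_add[of f "m * p ^ n" "p ^ n" a] by (simp add: g forward_diff_cmult add.commute)
    ultimately show ?case by (simp add: mult.commute)
  qed simp
  then show ?thesis
    using k forward_diff_add[of f "m * p ^ n" "k - m * p ^ n" a] by (simp add: forward_diff_dvd)
qed

context padic_ambient
begin

text \<open>The case of Mahler's theorem for locally constant integer functions: the Newton expansion may be
  truncated uniformly, since its later coefficients are divisible by \<open>p ^ m\<close>.\<close>

lemma mahler_approximation:
  assumes f: "\<And>a. f (a + p ^ n) = f a"
  shows "absv (of_int (f a) - (\<Sum>k<m * p ^ n. of_int (forward_diff f k 0) * (of_nat a gchoose k)) :: 'k) \<le> eps m"
proof -
  let ?D = "m * p ^ n"
  let ?t = "\<lambda>k. of_int (forward_diff f k 0) * (of_nat a gchoose k) :: 'k"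
  define M where "M = max ?D (Suc a)"
  have b: "(of_nat a gchoose k :: 'k) = of_nat (a choose k)" for k by (simp add: binomial_gbinomial)
  have "of_int (f a) = (\<Sum>k\<le>a. ?t k)"
    using newton_expansion[of f 0 a] by (simp add: b mult.commute)
  also have "\<dots> = (\<Sum>k<M. ?t k)"
    by (rule sum.mono_neutral_left) (auto simp: M_def b binomial_eq_0)
  also have "\<dots> = (\<Sum>k<?D. ?t k) + (\<Sum>k\<in>{?D..<M}. ?t k)"
    by (subst sum.union_disjoint[symmetric]) (auto simp: M_def intro!: sum.cong)
  finally have e: "of_int (f a) - (\<Sum>k<?D. ?t k) = (\<Sum>k\<in>{?D..<M}. ?t k)" by simp
  have "absv (?t k) \<le> eps m" if "k \<in> {?D..<M}" for k
  proof -
    have "absv (of_int (forward_diff f k 0) :: 'k) \<le> eps m"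
      unfolding absv_of_int_le_iff using that by (intro prime_power_dvd_forward_diff[where f=f and n=n, OF prime_p f]) auto
    then have "absv (of_int (forward_diff f k 0) :: 'k) * absv (of_nat (a choose k) :: 'k) \<le> eps m * 1"
      by (intro mult_mono absv_of_nat_le) auto
    then show ?thesis by (simp add: absv_mult b)
  qed
  then show ?thesis unfolding e by (intro absv_sum_le) auto
qed

lemma unif_cont_continuous:
  assumes "continuous_on X f" "is_dom X" shows "unif_cont X f"
  unfolding unif_cont_def
proof (intro allI impI)
  fix e :: real assume "e > 0"
  moreover have "uniformly_continuous_on X f"
    using compact_uniformly_continuous assms is_dom_compact by blast
  ultimately obtain d where d: "d > 0" "\<forall>x\<in>X. \<forall>x'\<in>X. dist x' x < d \<longrightarrow> dist (f x') (f x) < e"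
    unfolding uniformly_continuous_on_def by blast
  obtain n where n: "eps n < d" using eps_less_obtain[OF d(1)] by blast
  have "osc_le X f n e"
    unfolding osc_le_def
  proof (intro allI impI)
    fix a b assume a: "of_nat a \<in> X" "of_nat b \<in> X" "absv (of_nat a - of_nat b :: 'k) \<le> eps n"
    then have "dist (of_nat a) (of_nat b :: 'k) < d" using n dist_eq_dist_diff[of "of_nat a" "of_nat b :: 'k"] by simp
    then have "dist (f (of_nat a)) (f (of_nat b)) < e" using d(2) a(1,2) by blast
    then show "absv (f (of_nat a) - f (of_nat b)) \<le> e"
      using dist_eq_dist_diff[of "f (of_nat a)" "f (of_nat b)"] by simp
  qed
  then show "\<exists>n. osc_le X f n e" by blast
qed

lemma unif_cont_gbinomial: "unif_cont ZZ (\<lambda>x. x gchoose k)"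
proof (rule unif_cont_continuous)
  show "continuous_on ZZ (\<lambda>x. x gchoose k)"
    unfolding continuous_on_sequentially by (auto simp: o_def intro!: tendsto_gbinomial)
qed simp

text \<open>The indicator function of a coset is a uniform limit of integral combinations of binomial
  coefficients, so the measure of the coset is a limit of such combinations of the moments.\<close>

lemma measure_coset_in_closed_subfield:
  fixes \<Lambda> :: "'k set \<Rightarrow> 'k"
  assumes K: "is_subfield K" "closed K" and \<Lambda>: "\<Lambda> \<in> bounded_measures ZZ"
    and moments: "\<And>k. padic_integral p ZZ (\<lambda>x. x gchoose k) \<Lambda> \<in> K" and a: "a < p ^ n"
  shows "\<Lambda> (Zp_coset p a n \<inter> ZZ) \<in> K"
proof -
  obtain B where B: "B > 0" "\<And>U. absv (\<Lambda> U) \<le> B" using bm_bound[OF \<Lambda>] by blast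
  define f :: "nat \<Rightarrow> int" where "f b = (if b mod p ^ n = a then 1 else 0)" for b
  let ?c = "\<lambda>k. of_int (forward_diff f k 0) :: 'k"
  let ?I = "\<lambda>k. padic_integral p ZZ (\<lambda>x. x gchoose k) \<Lambda>"
  let ?J = "\<lambda>m. \<Sum>k<m * p ^ n. ?c k * ?I k"
  have per: "f (b + p ^ n) = f b" for b by (simp add: f_def)
  let ?R = "\<lambda>k. riemann_sum ZZ (\<lambda>x. x gchoose k) \<Lambda>"
  have main: "absv (?J m - \<Lambda> (Zp_coset p a n \<inter> ZZ)) \<le> B * eps m" for m
  proof -
    have ev: "absv ((\<Sum>k<m * p ^ n. ?c k * ?R k N) - \<Lambda> (Zp_coset p a n \<inter> ZZ)) \<le> B * eps m" if N: "N \<ge> max 1 n" for N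
    proof -
      have lev: "has_level ZZ N (Zp_coset p a n \<inter> ZZ)"
        by (rule has_level_mono[OF coset_has_level[OF is_dom_ZZ]]) (use N in simp)
      have "\<Lambda> (Zp_coset p a n \<inter> ZZ) = (\<Sum>b | b < p ^ N \<and> of_nat b \<in> Zp_coset p a n \<inter> ZZ. \<Lambda> (Zp_coset p b N \<inter> ZZ))"
        by (rule bm_level_sum[OF \<Lambda> is_dom_ZZ lev]) (use N in simp)
      also have "\<dots> = (\<Sum>b<p ^ N. of_int (f b) * \<Lambda> (Zp_coset p b N \<inter> ZZ))"
        by (rule sum.mono_neutral_cong_left) (auto simp: f_def of_nat_in_coset_iff[OF a])
      finally have 1: "\<Lambda> (Zp_coset p a n \<inter> ZZ) = (\<Sum>b<p ^ N. of_int (f b) * \<Lambda> (Zp_coset p b N \<inter> ZZ))" .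
      have 2: "(\<Sum>k<m * p ^ n. ?c k * ?R k N) =
          (\<Sum>b<p ^ N. (\<Sum>k<m * p ^ n. ?c k * (of_nat b gchoose k)) * \<Lambda> (Zp_coset p b N \<inter> ZZ))"
        unfolding riemann_sum_def sum_distrib_left sum_distrib_right
        by (subst sum.swap) (simp add: mult.assoc)
      have "absv (((\<Sum>k<m * p ^ n. ?c k * (of_nat b gchoose k)) - of_int (f b)) * \<Lambda> (Zp_coset p b N \<inter> ZZ)) \<le> eps m * B" for b
        unfolding absv_mult using mahler_approximation[where f=f and n=n and a=b and m=m, OF per] B
        by (intro mult_mono) (simp_all only: absv_diff_commute[of _ "of_int (f b)"] zero_le_dist eps_nonneg)
      then have "absv ((\<Sum>k<m * p ^ n. ?c k * ?R k N) - \<Lambda> (Zp_coset p a n \<inter> ZZ)) \<le> eps m * B"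
        unfolding 1 2 sum_subtractf[symmetric] left_diff_distrib[symmetric] using B(1) by (intro absv_sum_le) auto
      then show ?thesis by (simp only: mult.commute)
    qed
    have lim: "(\<lambda>N. (\<Sum>k<m * p ^ n. ?c k * ?R k N) - \<Lambda> (Zp_coset p a n \<inter> ZZ)) \<longlonglongrightarrow> ?J m - \<Lambda> (Zp_coset p a n \<inter> ZZ)"
      by (intro tendsto_diff tendsto_sum tendsto_mult tendsto_const integral_tendsto \<Lambda> is_dom_ZZ unif_cont_gbinomial)
    show ?thesis
      by (rule absv_lim_le[OF lim eventually_sequentiallyI[OF ev]])
  qed
  have "(\<lambda>m. B * eps m) \<longlonglongrightarrow> B * 0" by (intro tendsto_mult tendsto_const eps_tendsto)
  then have z: "(\<lambda>m. B * eps m) \<longlonglongrightarrow> 0" by simp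
  have lim: "?J \<longlonglongrightarrow> \<Lambda> (Zp_coset p a n \<inter> ZZ)"
    by (rule tendsto_absv_bound[OF z], rule always_eventually, rule allI, rule main)
  have "?J m \<in> K" for m
    by (intro subfield_sum subfieldD(4) subfield_of_int moments K(1))
  then show ?thesis by (rule closed_sequentially[OF K(2) _ lim])
qed

end

section \<open>Power series over a subfield\<close>

definition fps_over :: "'k::complete_ultrametric_field set \<Rightarrow> 'k fps \<Rightarrow> bool"
  where "fps_over K f \<longleftrightarrow> (\<forall>n. f $ n \<in> K)"

lemma fps_over_mult: "is_subfield K \<Longrightarrow> fps_over K f \<Longrightarrow> fps_over K g \<Longrightarrow> fps_over K (f * g)"
  by (auto simp: fps_over_def fps_mult_nth intro!: subfield_sum subfieldD)

lemma fps_over_diff: "is_subfield K \<Longrightarrow> fps_over K f \<Longrightarrow> fps_over K g \<Longrightarrow> fps_over K (f - g)"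
  by (auto simp: fps_over_def intro!: subfieldD)

lemma fps_over_const: "is_subfield K \<Longrightarrow> c \<in> K \<Longrightarrow> fps_over K (fps_const c)"
  by (auto simp: fps_over_def intro!: subfieldD)

lemma fps_over_binomial: "is_subfield K \<Longrightarrow> a \<in> K \<Longrightarrow> fps_over K (fps_binomial a)"
  by (auto simp: fps_over_def intro!: subfield_gbinomial)

lemma fps_over_quotient:
  assumes K: "is_subfield K" and fg: "fps_over K (f * g)" and g: "fps_over K g" "g $ 0 \<noteq> 0"
  shows "fps_over K f"
  unfolding fps_over_def
proof
  fix n show "f $ n \<in> K"
  proof (induction n rule: less_induct)
    case (less n)
    have "(f * g) $ n = (\<Sum>i<n. f $ i * g $ (n - i)) + f $ n * g $ 0"
      by (simp add: fps_mult_nth atLeast0AtMost lessThan_Suc_atMost[symmetric])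
    then have "f $ n = ((f * g) $ n - (\<Sum>i<n. f $ i * g $ (n - i))) / g $ 0"
      using g(2) by simp
    moreover have "(f * g) $ n \<in> K" "g $ 0 \<in> K" using fg g by (auto simp: fps_over_def)
    moreover have "(\<Sum>i<n. f $ i * g $ (n - i)) \<in> K"
      using less g(1) by (auto simp: fps_over_def intro!: subfield_sum[OF K] subfieldD(4)[OF K])
    ultimately show ?case using subfieldD[OF K] by simp
  qed
qed

text \<open>The defining identity becomes one between power series with rational coefficients after
  multiplication by \<open>(1 + T) ^ c - 1 = T H\<close>, where \<open>H\<close> has the invertible constant term \<open>c\<close>.\<close>

lemma half_measure_moments:
  assumes K: "is_subfield K" and c: "c > 0" and \<Lambda>: "is_half_measure p c \<Lambda>"
  shows "padic_integral p Zp (\<lambda>x. x gchoose n) \<Lambda> \<in> K"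
proof -
  define A where "A = Abs_fps (\<lambda>n. padic_integral p Zp (\<lambda>x. x gchoose n) \<Lambda>)"
  define B where "B = fps_binomial (1 / 2 :: 'a)"
  define D where "D = fps_binomial (of_nat c / 2 :: 'a)"
  define H where "H = fps_shift 1 (fps_binomial (of_nat c :: 'a))"
  have X: "fps_binomial (of_nat c :: 'a) - 1 = fps_X * H"
    by (rule fps_ext) (simp add: H_def fps_X_mult_nth fps_one_nth)
  have H0: "H $ 0 \<noteq> 0" using c by (simp add: H_def)
  then have H: "fps_to_fls H \<noteq> 0" by (metis fps_to_fls_eq_0_iff fps_zero_nth)
  have "fps_to_fls (fps_binomial (of_nat c :: 'a)) - 1 = fps_to_fls (fps_binomial (of_nat c) - 1)"
    by simp
  also have "\<dots> = fls_X * fps_to_fls H" by (simp add: X fls_times_fps_to_fls)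
  finally have den: "fps_to_fls (fps_binomial (of_nat c :: 'a)) - 1 = fls_X * fps_to_fls H" .
  have "fps_to_fls A = fps_to_fls B / fls_X - of_nat c * (fps_to_fls D / (fls_X * fps_to_fls H))"
    using \<Lambda> unfolding is_half_measure_def A_def B_def D_def den[symmetric] by blast
  moreover have "a * (x * h) = b * h - m * d" if "a = b / x - m * (d / (x * h))" "x \<noteq> 0" "h \<noteq> 0"
    for a b d h m x :: "'a fls"
    using that(2,3) unfolding that(1) by (simp add: field_simps)
  ultimately have "fps_to_fls A * (fls_X * fps_to_fls H) = fps_to_fls B * fps_to_fls H - of_nat c * fps_to_fls D"
    using H fls_X_nonzero by blast
  then have "fps_to_fls (A * (fps_X * H)) = fps_to_fls (B * H - of_nat c * D)"
    by (simp add: fls_times_fps_to_fls)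
  then have e: "A * (fps_X * H) = B * H - of_nat c * D" by (simp only: fps_to_fls_eq_iff)
  have cK: "(of_nat c :: 'a) \<in> K" "(1 / 2 :: 'a) \<in> K" "(of_nat c / 2 :: 'a) \<in> K"
    using subfield_of_nat[OF K, of c] subfield_of_nat[OF K, of 2] subfieldD[OF K] by auto
  have HK: "fps_over K H"
    using fps_over_binomial[OF K cK(1)] by (simp add: fps_over_def H_def)
  have "fps_over K (B * H - fps_const (of_nat c) * D)"
    unfolding B_def D_def by (intro fps_over_diff fps_over_mult fps_over_const fps_over_binomial HK K cK)
  then have "fps_over K (fps_X * (A * H))"
    using e by (simp add: fps_of_nat mult_ac)
  then have "fps_over K (A * H)"
    unfolding fps_over_def by (metis fps_X_mult_nth diff_Suc_1 nat.simps(3))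
  then have "fps_over K A" by (rule fps_over_quotient[OF K _ HK H0])
  then show ?thesis by (simp add: fps_over_def A_def)
qed

context padic_ambient
begin

lemma integral_in_closed_subfield:
  assumes K: "is_subfield K" "closed K" and \<mu>: "\<mu> \<in> bounded_measures X" "is_dom X" and f: "unif_cont X f"
    and fK: "\<And>a. of_nat a \<in> X \<Longrightarrow> f (of_nat a) \<in> K"
    and \<mu>K: "\<And>a n. n \<ge> 1 \<Longrightarrow> a < p ^ n \<Longrightarrow> of_nat a \<in> X \<Longrightarrow> \<mu> (Zp_coset p a n \<inter> X) \<in> K"
  shows "padic_integral p X f \<mu> \<in> K"
proof -
  have lim: "(\<lambda>n. riemann_sum X f \<mu> (Suc n)) \<longlonglongrightarrow> padic_integral p X f \<mu>"
    by (rule LIMSEQ_Suc) (rule integral_tendsto[OF \<mu> f])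
  have "f (of_nat a) * \<mu> (Zp_coset p a (Suc n) \<inter> X) \<in> K" if "a < p ^ Suc n" for a n
  proof (cases "of_nat a \<in> X")
    case True
    then show ?thesis by (intro subfieldD(4)[OF K(1)] fK \<mu>K that) auto
  next
    case False
    then show ?thesis using coset_empty[OF \<mu>(2) _ False, of "Suc n"] \<mu>(1) subfieldD(2)[OF K(1)] by simp
  qed
  then have "riemann_sum X f \<mu> (Suc n) \<in> K" for n
    unfolding riemann_sum_def by (intro subfield_sum[OF K(1)]) simp
  then show ?thesis by (rule closed_sequentially[OF K(2) _ lim])
qed

lemma nu_root_in_subfield:
  assumes K: "is_subfield K" "closed K" and z: "unit_root z" "z \<in> K"
  shows "nu_root z U \<in> K"
proof (cases "clopen_in G U")
  case True
  have "padic_integral p ZZ (inv_on U) (mu_measure p z) \<in> K"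
  proof (rule integral_in_closed_subfield[OF K bm_mu_measure[OF z(1)] is_dom_ZZ inv_on_unif_cont[OF True]])
    show "inv_on U (of_nat a) \<in> K" for a
      using subfieldD[OF K(1)] subfield_of_nat[OF K(1)] by (simp add: inv_on_def)
    show "mu_measure p z (Zp_coset p a n \<inter> ZZ) \<in> K" if "a < p ^ n" for a n
      unfolding mu_measure_coset[OF z(1) that] using subfieldD[OF K(1)] z(2) by simp
  qed
  then show ?thesis using True by (simp add: nu_root_def)
next
  case False
  then show ?thesis unfolding nu_root_def using subfieldD(2)[OF K(1)] by simp
qed

text \<open>The integrals are limits of Riemann sums over the closed field \<open>K\<close>: the half measure has its values
  there by Mahler expansion, and those of \<open>\<nu>\<close> come from the explicit values of \<open>\<mu>\<^sub>z\<close>.\<close>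

lemma pm_mellin_in_subfield:
  assumes K: "finite_unramified K" and \<xi>: "cyc_presentation p K \<xi>" and c: "admissible p c"
    and \<Lambda>: "is_half_measure p c \<Lambda>" and s: "s \<in> ZZ - {- 1}"
  shows "pm_mellin p (pseudomeasure p c \<Lambda> \<xi>) (- 1) s \<in> K"
proof -
  note Ks = finite_unramified_subfield[OF K] and Kc = finite_unramified_closed[OF K] and ZK = Zp_subset_finite_unramified[OF K]
  have s': "s \<in> ZZ" using s by simp
  have \<Lambda>b: "\<Lambda> \<in> bounded_measures ZZ" using \<Lambda> by (simp add: is_half_measure_def)
  note us = cyc_presentation_unit_root_support[OF \<xi>]
  have c0: "c > 0" "coprime c p" using c by (auto simp: admissible_def)
  note uc = unit_character_unif_cont[OF exc_char_character[OF s']]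
  have charK: "exc_char s x \<in> K" if "x \<in> G" for x
    using exc_char_G[OF s' that] Zp_units_Zp ZK by blast
  have "padic_integral p G (exc_char s) (restrict_units \<Lambda>) \<in> K"
  proof (rule integral_in_closed_subfield[OF Ks Kc bm_restrict_units[OF \<Lambda>b] is_dom_G uc charK])
    fix a n :: nat assume n: "n \<ge> 1" "a < p ^ n" "of_nat a \<in> G"
    have "Zp_coset p a n \<inter> G = Zp_coset p a n \<inter> ZZ"
    proof -
      have "x \<in> G" if "x \<in> Zp_coset p a n" "x \<in> ZZ" for x
        using is_dom_cong[OF is_dom_G n(3) that(2) _ n(1)] that(1) absv_diff_commute[of x "of_nat a"]
        by (simp add: Zp_coset_iff)
      then show ?thesis using Zp_units_Zp by blast
    qed
    then show "restrict_units \<Lambda> (Zp_coset p a n \<inter> G) \<in> K"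
      using measure_coset_in_closed_subfield[OF Ks Kc \<Lambda>b half_measure_moments[OF Ks c0(1) \<Lambda>] n(2)]
        clopen_coset[OF is_dom_G, of a n] by (simp add: restrict_units_def)
  qed
  moreover have "padic_integral p G (exc_char s) (nu_measure p \<xi>) \<in> K"
  proof (rule integral_in_closed_subfield[OF Ks Kc bm_nu_measure[OF us] is_dom_G uc charK])
    fix a n :: nat
    have "nu_measure p \<xi> U \<in> K" for U
      unfolding nu_measure_eq using \<xi> us
      by (auto intro!: subfield_sum[OF Ks] subfieldD(4)[OF Ks] nu_root_in_subfield[OF Ks Kc]
          simp: cyc_presentation_def valuation_ring_def unit_root_support_def)
    then show "nu_measure p \<xi> (Zp_coset p a n \<inter> G) \<in> K" .
  qed
  moreover have "padic_pow (principal p (of_nat c)) (s + 1) \<in> K"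
    using padic_pow_Zp[OF principal(1) Zp_units_Zp[OF principal(2)] Zp_add[OF s' one_Zp], of "of_nat c"]
      coprime_of_nat_unit[OF c0(2)] Zp_units_Zp ZK by blast
  ultimately show ?thesis
    unfolding pm_mellin_pseudomeasure[OF \<Lambda>b us c s] using subfieldD[OF Ks] by auto
qed

end

section \<open>Hermite interpolation over a subfield\<close>

definition poly_over :: "'k::complete_ultrametric_field set \<Rightarrow> 'k poly \<Rightarrow> bool"
  where "poly_over K P \<longleftrightarrow> (\<forall>i. coeff P i \<in> K)"

lemma poly_over_pCons: "is_subfield K \<Longrightarrow> poly_over K (pCons a P) \<longleftrightarrow> a \<in> K \<and> poly_over K P"
  unfolding poly_over_def by (auto simp: coeff_pCons split: nat.splits)

lemma poly_over_zero: "is_subfield K \<Longrightarrow> poly_over K 0"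
  by (simp add: poly_over_def subfieldD(2))

lemma poly_over_one: "is_subfield K \<Longrightarrow> poly_over K 1"
  by (auto simp: poly_over_def coeff_1 intro: subfieldD)

lemma poly_over_add: "is_subfield K \<Longrightarrow> poly_over K P \<Longrightarrow> poly_over K Q \<Longrightarrow> poly_over K (P + Q)"
  by (auto simp: poly_over_def intro!: subfieldD(7))

lemma poly_over_mult: "is_subfield K \<Longrightarrow> poly_over K P \<Longrightarrow> poly_over K Q \<Longrightarrow> poly_over K (P * Q)"
  unfolding poly_over_def coeff_mult by (intro allI subfield_sum subfieldD(4)) auto

lemma poly_over_power: "is_subfield K \<Longrightarrow> poly_over K P \<Longrightarrow> poly_over K (P ^ n)"
  by (induction n) (auto intro: poly_over_one poly_over_mult)

lemma poly_over_prod: "is_subfield K \<Longrightarrow> (\<And>i. i \<in> I \<Longrightarrow> poly_over K (f i)) \<Longrightarrow> poly_over K (prod f I)"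
  by (induction I rule: infinite_finite_induct) (auto intro: poly_over_one poly_over_mult)

lemma poly_over_pcompose:
  assumes K: "is_subfield K" and "poly_over K P" "poly_over K Q" shows "poly_over K (pcompose P Q)"
  using assms(2)
proof (induction P)
  case (pCons a P)
  then show ?case
    using assms(3) by (auto simp: pcompose_pCons poly_over_pCons[OF K] poly_over_zero[OF K]
      intro!: poly_over_add[OF K] poly_over_mult[OF K])
qed simp

text \<open>The Taylor expansion of \<open>P\<close> at \<open>x\<close> in the coordinate \<open>X / x - 1\<close>.\<close>

definition jet :: "'k::field \<Rightarrow> 'k poly \<Rightarrow> 'k fps"
  where "jet x P = fps_of_poly (pcompose P [:x, x:])"

lemma jet_add: "jet x (P + Q) = jet x P + jet x Q"
  by (simp add: jet_def pcompose_add fps_of_poly_add)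

lemma jet_mult: "jet x (P * Q) = jet x P * jet x Q"
  by (simp add: jet_def pcompose_mult fps_of_poly_mult)

lemma jet_power: "jet x (P ^ n) = jet x P ^ n"
proof (induction n)
  case 0
  show ?case by (simp add: jet_def pcompose_1)
next
  case (Suc n)
  then show ?case by (simp only: power_Suc jet_mult)
qed

lemma jet_nth_0: "jet x P $ 0 = poly P x"
  by (simp add: jet_def poly_0_coeff_0[symmetric] poly_pcompose)

lemma jet_over: "is_subfield K \<Longrightarrow> x \<in> K \<Longrightarrow> poly_over K P \<Longrightarrow> fps_over K (jet x P)"
  using poly_over_pcompose[of K P "[:x, x:]"] by (auto simp: jet_def fps_over_def poly_over_def coeff_pCons subfieldD(2) split: nat.splits)

lemma jet_eq_sum:
  assumes "degree P \<le> N"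
  shows "jet x P = (\<Sum>i\<le>N. fps_const (coeff P i) * (fps_const x * (1 + fps_X)) ^ i)"
proof -
  have lin: "fps_of_poly [:x, x:] = fps_const x * (1 + fps_X)"
    by (simp add: fps_of_poly_pCons algebra_simps)
  show ?thesis
    using assms
  proof (induction P arbitrary: N)
    case 0
    show ?case by (simp add: jet_def)
  next
    case (pCons a P)
    have "jet x (pCons a P) = fps_const a + fps_const x * (1 + fps_X) * jet x P"
      by (simp add: jet_def pcompose_pCons fps_of_poly_add fps_of_poly_mult lin fps_of_poly_const)
    show ?case
    proof (cases N)
      case 0
      then have "P = 0" using pCons.prems by (simp split: if_splits)
      then show ?thesis using 0 by (simp add: jet_def fps_of_poly_const)
    next
      case (Suc N')
      then have "degree P \<le> N'" using pCons.prems by (simp split: if_splits)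
      then have "jet x P = (\<Sum>i\<le>N'. fps_const (coeff P i) * (fps_const x * (1 + fps_X)) ^ i)" by (rule pCons.IH)
      then show ?thesis
        unfolding \<open>jet x (pCons a P) = _\<close> Suc sum.atMost_Suc_shift
        by (simp add: sum_distrib_left mult_ac)
    qed
  qed
qed

text \<open>Correcting the interpolant by a multiple of \<open>\<Prod>(X - y)^Q\<close> does not change its jets at
  the previous points; the factor is found by dividing power series at the new point.\<close>

lemma hermite_interpolation:
  fixes x :: "'i \<Rightarrow> 'k::complete_ultrametric_field"
  assumes K: "is_subfield K" and I: "finite I" and inj: "inj_on x I"
    and xK: "\<And>i. i \<in> I \<Longrightarrow> x i \<in> K \<and> x i \<noteq> 0" and tK: "\<And>i. i \<in> I \<Longrightarrow> fps_over K (t i)"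
  shows "\<exists>P. poly_over K P \<and> (\<forall>i\<in>I. \<forall>q<Q. jet (x i) P $ q = t i $ q)"
  using I inj xK tK
proof (induction I rule: finite_induct)
  case empty
  show ?case using poly_over_zero[OF K] by blast
next
  case (insert i I)
  then obtain P where P: "poly_over K P" "\<forall>j\<in>I. \<forall>q<Q. jet (x j) P $ q = t j $ q" by auto
  have xi: "x i \<in> K" "x i \<noteq> 0" using insert.prems(2) by auto
  define N where "N = (\<Prod>j\<in>I. [:- x j, 1:] ^ Q)"
  have NK: "poly_over K N"
    unfolding N_def using insert.prems(2)
    by (intro poly_over_prod[OF K] poly_over_power[OF K])
      (simp add: poly_over_pCons[OF K] poly_over_zero[OF K] subfieldD(1,6)[OF K])
  have "poly N (x i) \<noteq> 0"
    unfolding N_def poly_prod poly_power using insert.prems(1) insert.hyps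
    by (auto simp: prod_zero_iff inj_on_def)
  then have N0: "jet (x i) N $ 0 \<noteq> 0" by (simp add: jet_nth_0)
  \<comment> \<open>The jet at \<open>x i\<close> that the correction factor \<open>R\<close> must have.\<close>
  define r where "r = (t i - jet (x i) P) * inverse (jet (x i) N)"
  have r: "r * jet (x i) N = t i - jet (x i) P"
    unfolding r_def using inverse_mult_eq_1[OF N0] by (simp add: mult.assoc)
  have "fps_over K (r * jet (x i) N)"
    unfolding r by (intro fps_over_diff[OF K] insert.prems(3) jet_over[OF K xi(1) P(1)]) simp
  then have rK: "fps_over K r" by (rule fps_over_quotient[OF K _ jet_over[OF K xi(1) NK] N0])
  define R0 where "R0 = (\<Sum>n<Q. monom (r $ n) n)"
  have R0_coeff: "coeff R0 n = (if n < Q then r $ n else 0)" for n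
    by (simp add: R0_def coeff_sum)
  have R0K: "poly_over K R0"
    using rK subfieldD(2)[OF K] by (auto simp: poly_over_def R0_coeff fps_over_def)
  define R where "R = pcompose R0 [:- 1, 1 / x i:]"
  have RK: "poly_over K R"
    unfolding R_def using subfieldD(8)[OF K subfieldD(1)[OF K] xi(1)]
    by (intro poly_over_pcompose[OF K R0K])
      (simp add: poly_over_pCons[OF K] poly_over_zero[OF K] subfieldD(1,6)[OF K])
  have "pcompose R [:x i, x i:] = pcompose R0 (pcompose [:- 1, 1 / x i:] [:x i, x i:])"
    by (simp add: R_def pcompose_assoc)
  also have "pcompose [:- 1, 1 / x i:] [:x i, x i:] = [:0, 1:]"
    using xi(2) by (simp add: pcompose_pCons)
  finally have jR: "jet (x i) R = fps_of_poly R0" by (simp add: jet_def pcompose_idR)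
  have "jet (x i) (P + N * R) $ q = t i $ q" if q: "q < Q" for q
  proof -
    have "(fps_of_poly R0 * jet (x i) N) $ q = (r * jet (x i) N) $ q"
      unfolding fps_mult_nth using q by (intro sum.cong refl) (simp add: R0_coeff)
    then have "(jet (x i) N * fps_of_poly R0) $ q = (t i - jet (x i) P) $ q" by (simp add: r mult.commute)
    then show ?thesis by (simp add: jet_add jet_mult jR)
  qed
  moreover have "jet (x j) (P + N * R) $ q = t j $ q" if j: "j \<in> I" and q: "q < Q" for j q
  proof -
    have "N = [:- x j, 1:] ^ Q * (\<Prod>j\<in>I - {j}. [:- x j, 1:] ^ Q)"
      unfolding N_def using insert.hyps(1) j by (rule prod.remove)
    then obtain N' where N': "N * R = [:- x j, 1:] ^ Q * N'" using mult.assoc by blast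
    have "pcompose [:- x j, 1:] [:x j, x j:] = [:0, x j:]" by (simp add: pcompose_pCons)
    then have "jet (x j) [:- x j, 1:] = fps_const (x j) * fps_X"
      by (simp add: jet_def fps_of_poly_pCons mult.commute)
    then have "jet (x j) (N * R) = fps_X ^ Q * (fps_const (x j) ^ Q * jet (x j) N')"
      unfolding N' jet_mult jet_power by (simp add: power_mult_distrib mult_ac)
    then have "jet (x j) (N * R) $ q = 0"
      using q by (simp only: fps_X_power_mult_nth if_True)
    then show ?thesis using P(2) j q by (simp add: jet_add)
  qed
  ultimately show ?case
    using poly_over_add[OF K P(1) poly_over_mult[OF K NK RK]] by (intro exI[of _ "P + N * R"]) auto
qed

section \<open>Convergent expansions\<close>

definition fps_sums :: "'k::complete_ultrametric_field fps \<Rightarrow> 'k \<Rightarrow> 'k \<Rightarrow> bool"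
  where "fps_sums f y v \<longleftrightarrow> (\<lambda>n. f $ n * y ^ n) sums v"

lemma fps_sums_add: "fps_sums f y v \<Longrightarrow> fps_sums g y w \<Longrightarrow> fps_sums (f + g) y (v + w)"
  unfolding fps_sums_def using sums_add[of "\<lambda>n. f $ n * y ^ n" v "\<lambda>n. g $ n * y ^ n" w] by (simp add: distrib_right)

lemma fps_sums_const_mult: "fps_sums f y v \<Longrightarrow> fps_sums (fps_const c * f) y (c * v)"
  unfolding fps_sums_def using sums_cmult[of "\<lambda>n. f $ n * y ^ n" v c] by (simp add: mult.assoc)

lemma fps_sums_X_mult: assumes "fps_sums f y v" shows "fps_sums (fps_X * f) y (y * v)"
proof -
  have "(\<lambda>n. y * (f $ n * y ^ n)) sums (y * v)" using assms unfolding fps_sums_def by (rule sums_cmult)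
  then have "(\<lambda>n. (fps_X * f) $ Suc n * y ^ Suc n) sums (y * v)" by (simp add: mult_ac)
  from sums_Suc[OF this] show ?thesis by (simp add: fps_sums_def)
qed

lemma fps_sums_zero: "fps_sums 0 y 0"
  by (simp add: fps_sums_def)

lemma fps_sums_sum: "(\<And>i. i \<in> I \<Longrightarrow> fps_sums (f i) y (v i)) \<Longrightarrow> fps_sums (\<Sum>i\<in>I. f i) y (\<Sum>i\<in>I. v i)"
  by (induction I rule: infinite_finite_induct) (auto intro: fps_sums_add fps_sums_zero)

lemma fps_sums_mult_jet_one:
  assumes "fps_sums f y v" "degree P \<le> N"
  shows "fps_sums (f * jet 1 P) y ((\<Sum>i\<le>N. coeff P i * (1 + y) ^ i) * v)"
proof -
  have pow: "fps_sums ((1 + fps_X) ^ i * f) y ((1 + y) ^ i * v)" for i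
  proof (induction i)
    case (Suc i)
    have "(1 + fps_X) ^ Suc i * f = (1 + fps_X) ^ i * f + fps_X * ((1 + fps_X) ^ i * f)" by (simp add: algebra_simps)
    moreover have "(1 + y) ^ Suc i * v = (1 + y) ^ i * v + y * ((1 + y) ^ i * v)" by (simp add: algebra_simps)
    ultimately show ?case
      using fps_sums_add[OF Suc fps_sums_X_mult[OF Suc]] by (simp only:)
  qed (use assms in simp)
  have "fps_sums (\<Sum>i\<le>N. fps_const (coeff P i) * ((1 + fps_X) ^ i * f)) y (\<Sum>i\<le>N. coeff P i * ((1 + y) ^ i * v))"
    by (intro fps_sums_sum fps_sums_const_mult pow)
  then show ?thesis
    by (simp add: jet_eq_sum[OF assms(2)] sum_distrib_left sum_distrib_right mult_ac)
qed

text \<open>The power series \<open>Y F\<close>, if \<open>F\<close> has at most a simple pole.\<close>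

definition regular_part :: "'k::zero fls \<Rightarrow> 'k fps"
  where "regular_part F = Abs_fps (\<lambda>n. fls_nth F (int n - 1))"

lemma sums_simple_pole_iff:
  fixes y :: "'k::complete_ultrametric_field"
  assumes "y \<noteq> 0"
  shows "(\<lambda>n. fls_nth F (int n - 1) * y powi (int n - 1)) sums v \<longleftrightarrow> fps_sums (regular_part F) y (y * v)"
proof -
  have e: "y * y powi (int n - 1) = y ^ n" for n
    using assms by (simp add: power_int_diff)
  show ?thesis
  proof
    assume "(\<lambda>n. fls_nth F (int n - 1) * y powi (int n - 1)) sums v"
    from sums_cmult[OF this, of y]
    show "fps_sums (regular_part F) y (y * v)"
      by (simp add: fps_sums_def regular_part_def mult.left_commute[of y] e)
  next
    assume "fps_sums (regular_part F) y (y * v)"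
    from sums_cmult[OF this[unfolded fps_sums_def], of "inverse y"]
    have "(\<lambda>n. inverse y * (regular_part F $ n * y ^ n)) sums (inverse y * (y * v))" .
    moreover have "inverse y * (y * v) = v" using assms by (simp add: mult.assoc[symmetric])
    moreover have "inverse y * (regular_part F $ n * y ^ n) = fls_nth F (int n - 1) * y powi (int n - 1)" for n
      unfolding e[symmetric] using assms by (simp add: regular_part_def field_simps)
    ultimately show "(\<lambda>n. fls_nth F (int n - 1) * y powi (int n - 1)) sums v" by (simp only:)
  qed
qed

context padic_ambient
begin

text \<open>After division by \<open>Y ^ N\<close> the remainder of order \<open>N\<close> differs from the \<open>N\<close>-th coefficient by
  a multiple of \<open>Y\<close>. The values at a sequence of points tending to zero thus determine the coefficients,
  and coefficients inherit membership in a closed field from points and values.\<close>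

lemma fps_nth_limit:
  assumes Y: "\<And>k. absv (Y k) = eps (Suc k)" and f: "\<And>k. fps_sums f (Y k) (v k)"
  shows "(\<lambda>k. (v k - (\<Sum>n<N. f $ n * Y k ^ n)) / Y k ^ N) \<longlonglongrightarrow> f $ N"
proof -
  \<comment> \<open>Convergence at \<open>Y 0\<close>, the largest of the points, bounds all coefficients at once.\<close>
  have "(\<lambda>n. f $ n * Y 0 ^ n) \<longlonglongrightarrow> 0"
    using f[of 0] unfolding fps_sums_def by (rule sums_tendsto_zero)
  then have "bounded (range (\<lambda>n. f $ n * Y 0 ^ n))" by (rule convergent_imp_bounded)
  then obtain B where B: "\<And>n. absv (f $ n * Y 0 ^ n) \<le> B"
    unfolding bounded_any_center[of _ 0] by (auto simp: dist_commute)
  have B0: "0 \<le> B" using B[of 0] zero_le_dist order_trans by blast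
  have Y0: "Y k \<noteq> 0" for k using Y[of k] eps_pos[of "Suc k"] by (metis absv_zero_iff less_irrefl)
  have tail: "absv (v k - (\<Sum>n<Suc N. f $ n * Y k ^ n)) \<le> B * eps k ^ Suc N" for k
  proof -
    let ?d = "\<lambda>n. f $ n * Y k ^ n + - 1 * (if n \<in> {..<Suc N} then f $ n * Y k ^ n else 0)"
    have "?d sums (v k + - 1 * (\<Sum>n\<in>{..<Suc N}. f $ n * Y k ^ n))"
      using f[of k] unfolding fps_sums_def by (intro sums_add sums_cmult sums_If_finite_set) auto
    moreover have "v k + - 1 * (\<Sum>n\<in>{..<Suc N}. f $ n * Y k ^ n) = v k - (\<Sum>n<Suc N. f $ n * Y k ^ n)" by simp
    ultimately have s: "?d sums (v k - (\<Sum>n<Suc N. f $ n * Y k ^ n))" by (simp only:)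
    have "absv (?d n) \<le> B * eps k ^ Suc N" for n
    proof (cases "n < Suc N")
      case False
      have "absv (Y k) ^ n = absv (Y 0) ^ n * eps k ^ n"
        unfolding Y by (simp add: power_mult_distrib[symmetric])
      then have "absv (?d n) = absv (f $ n * Y 0 ^ n) * eps k ^ n"
        using False by (simp add: absv_mult absv_power)
      also have "\<dots> \<le> B * eps k ^ Suc N"
        using False eps_le_one[of k] by (intro mult_mono B power_decreasing B0) auto
      finally show ?thesis .
    qed (use B0 in simp)
    then show ?thesis by (rule absv_sums_le[OF s])
  qed
  have "(\<lambda>k. B * real p ^ N * eps k) \<longlonglongrightarrow> B * real p ^ N * 0" by (intro tendsto_mult tendsto_const eps_tendsto)
  then have z: "(\<lambda>k. B * real p ^ N * eps k) \<longlonglongrightarrow> 0" by simp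
  show ?thesis
  proof (rule tendsto_absv_bound[OF z], rule always_eventually, rule allI)
    fix k
    have "(v k - (\<Sum>n<N. f $ n * Y k ^ n)) / Y k ^ N - f $ N = (v k - (\<Sum>n<Suc N. f $ n * Y k ^ n)) / Y k ^ N"
      using Y0[of k] by (simp add: field_simps)
    then have "absv ((v k - (\<Sum>n<N. f $ n * Y k ^ n)) / Y k ^ N - f $ N) \<le> B * eps k ^ Suc N / eps (Suc k) ^ N"
      using tail[of k] by (simp only: absv_divide absv_power Y divide_right_mono eps_nonneg zero_le_power)
    also have "B * eps k ^ Suc N / eps (Suc k) ^ N = B * real p ^ N * eps k"
    proof -
      have "eps (Suc k) ^ N = (1 / real p) ^ N * eps k ^ N" by (simp only: power_Suc power_mult_distrib)
      then show ?thesis using p_ge_3 by (simp add: field_simps)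
    qed
    finally show "absv ((v k - (\<Sum>n<N. f $ n * Y k ^ n)) / Y k ^ N - f $ N) \<le> B * real p ^ N * eps k" .
  qed
qed

lemma fps_nth_in_closed_subfield:
  assumes K: "is_subfield K" "closed K" and Y: "\<And>k. absv (Y k) = eps (Suc k)" and f: "\<And>k. fps_sums f (Y k) (v k)"
    and YK: "\<And>k. Y k \<in> K" and vK: "\<And>k. v k \<in> K"
  shows "f $ N \<in> K"
proof (induction N rule: less_induct)
  case (less N)
  have "(v k - (\<Sum>n<N. f $ n * Y k ^ n)) / Y k ^ N \<in> K" for k
    using less by (intro subfieldD(8)[OF K(1)] subfieldD(3)[OF K(1)] subfieldD(9)[OF K(1)] vK YK subfield_sum[OF K(1)] subfieldD(4)[OF K(1)]) auto
  then show ?case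
    by (rule closed_sequentially[OF K(2) _ fps_nth_limit[OF Y f]])
qed

subsection \<open>The coordinate of the exceptional component\<close>

definition coord :: "'k \<Rightarrow> 'k"
  where "coord s = padic_pow (1 + of_nat p) (s + 1) - 1"

lemma absv_coord: "s \<in> ZZ \<Longrightarrow> absv (coord s) = absv (s + 1) * eps 1"
  using absv_padic_pow_minus_one[of "1 + of_nat p" "s + 1"] one_plus_p(1) Zp_add[of s 1] by (simp add: coord_def)

lemma coord_nonzero: "s \<in> ZZ - {- 1} \<Longrightarrow> coord s \<noteq> 0"
  using absv_coord[of s] p_ge_3 by (auto simp: add_eq_0_iff2)

lemma coord_Zp: "s \<in> ZZ \<Longrightarrow> coord s \<in> ZZ"
  unfolding coord_def
  using one_plus_p by (intro Zp_diff Zp_units_Zp[OF padic_pow_Zp] Zp_add) auto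

text \<open>Points \<open>s = p ^ k - 1\<close> that tend to the pole \<open>- 1\<close>.\<close>

definition pole_seq :: "nat \<Rightarrow> 'k"
  where "pole_seq k = of_nat (p ^ k) - 1"

lemma pole_seq: "pole_seq k \<in> ZZ - {- 1}" "pole_seq k + 1 = of_nat (p ^ k)"
  using p_ge_3 Zp_diff[OF of_nat_Zp[of "p ^ k"] one_Zp] by (auto simp: pole_seq_def)

lemma absv_coord_pole_seq: "absv (coord (pole_seq k)) = eps (Suc k)"
  using absv_coord[of "pole_seq k"] pole_seq[of k] absv_p_power[of k] by simp

lemma expansion_fps_sums:
  assumes F: "exceptional_expansion p c \<Lambda> \<xi> F" and s: "s \<in> ZZ - {- 1}"
  shows "fps_sums (regular_part F) (coord s) (coord s * pm_mellin p (pseudomeasure p c \<Lambda> \<xi>) (- 1) s)"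
  using F s coord_nonzero[OF s] unfolding exceptional_expansion_def coord_def
  by (subst sums_simple_pole_iff[symmetric]) auto

lemma expansion_over:
  fixes K :: "'k set"
  assumes K: "finite_unramified K" and \<xi>: "cyc_presentation p K \<xi>" and c: "admissible p c"
    and \<Lambda>: "is_half_measure p c \<Lambda>" and F: "exceptional_expansion p c \<Lambda> \<xi> F"
  shows "fps_over K (regular_part F)"
  unfolding fps_over_def
proof
  note Ks = finite_unramified_subfield[OF K]
  fix N
  have YK: "coord (pole_seq k) \<in> K" for k
    using coord_Zp pole_seq(1) Zp_subset_finite_unramified[OF K] by blast
  show "regular_part F $ N \<in> K"
    by (rule fps_nth_in_closed_subfield[OF Ks finite_unramified_closed[OF K] absv_coord_pole_seq expansion_fps_sums[OF F pole_seq(1)] YK])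
      (intro subfieldD(4)[OF Ks] YK pm_mellin_in_subfield[OF K \<xi> c \<Lambda> pole_seq(1)])
qed

text \<open>The residue is the limit of \<open>Y\<close> times the component. At \<open>s = p ^ k - 1\<close> the multiplier is
  \<open>\<Sum>c\<^sub>m \<langle>m\<rangle> ^ (p ^ k)\<close>, which tends to \<open>\<Sum>c\<^sub>m = 1\<close>.\<close>

lemma residue_rigid:
  assumes \<Lambda>: "\<Lambda> \<in> bounded_measures ZZ" and \<xi>: "unit_root_support \<xi>" and c: "admissible p c"
    and C: "C \<in> normalized_ops p K"
    and F: "exceptional_expansion p c \<Lambda> \<xi> F" and F': "exceptional_expansion p c \<Lambda> (apply_op C \<xi>) F'"
  shows "fls_nth F' (- 1) = fls_nth F (- 1)"
proof -
  let ?Y = "\<lambda>k. coord (pole_seq k)"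
  let ?v = "\<lambda>k. pm_mellin p (pseudomeasure p c \<Lambda> \<xi>) (- 1) (pole_seq k)"
  let ?h = "\<lambda>k. \<Sum>m\<in>Poly_Mapping.keys C. Poly_Mapping.lookup C m * padic_pow (principal p (of_nat m)) (pole_seq k + 1)"
  have "(\<lambda>k. ?Y k * ?v k) \<longlonglongrightarrow> regular_part F $ 0"
    using fps_nth_limit[of ?Y "regular_part F" _ 0, OF absv_coord_pole_seq expansion_fps_sums[OF F pole_seq(1)]] by simp
  moreover have "?h \<longlonglongrightarrow> (\<Sum>m\<in>Poly_Mapping.keys C. Poly_Mapping.lookup C m * 1)"
  proof (intro tendsto_sum tendsto_mult tendsto_const)
    fix m assume "m \<in> Poly_Mapping.keys C"
    then have "coprime m p" using C by (auto simp: normalized_ops_def)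
    then have u: "absv (principal p (of_nat m) - 1 :: 'k) \<le> eps 1"
      using principal(1) coprime_of_nat_unit by blast
    show "(\<lambda>k. padic_pow (principal p (of_nat m) :: 'k) (pole_seq k + 1)) \<longlonglongrightarrow> 1"
    proof (rule tendsto_absv_bound[OF eps_tendsto], rule always_eventually, rule allI)
      fix k
      have "absv (padic_pow (principal p (of_nat m)) (pole_seq k + 1) - 1 :: 'k) = eps k * absv (principal p (of_nat m) - 1 :: 'k)"
        unfolding pole_seq(2) using absv_padic_pow_minus_one[OF u of_nat_Zp[of "p ^ k"]] absv_p_power[of k] by simp
      also have "\<dots> \<le> eps k * 1" using u eps_le_one[of 1] by (intro mult_left_mono) auto
      finally show "absv (padic_pow (principal p (of_nat m)) (pole_seq k + 1) - 1 :: 'k) \<le> eps k" by simp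
    qed
  qed
  then have "?h \<longlonglongrightarrow> 1" using C by (simp add: normalized_ops_def)
  ultimately have "(\<lambda>k. ?h k * (?Y k * ?v k)) \<longlonglongrightarrow> 1 * regular_part F $ 0" by (intro tendsto_mult)
  moreover have "?h k * (?Y k * ?v k) = ?Y k * pm_mellin p (pseudomeasure p c \<Lambda> (apply_op C \<xi>)) (- 1) (pole_seq k)" for k
    unfolding pm_mellin_apply_op[OF \<Lambda> \<xi> c pole_seq(1) C] by (simp add: mult_ac)
  ultimately have L1: "(\<lambda>k. ?Y k * pm_mellin p (pseudomeasure p c \<Lambda> (apply_op C \<xi>)) (- 1) (pole_seq k)) \<longlonglongrightarrow> regular_part F $ 0"
    by simp
  have L2: "(\<lambda>k. ?Y k * pm_mellin p (pseudomeasure p c \<Lambda> (apply_op C \<xi>)) (- 1) (pole_seq k)) \<longlonglongrightarrow> regular_part F' $ 0"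
    using fps_nth_limit[of ?Y "regular_part F'" _ 0, OF absv_coord_pole_seq expansion_fps_sums[OF F' pole_seq(1)]] by simp
  show ?thesis
    using LIMSEQ_unique[OF L2 L1] by (simp add: regular_part_def)
qed

section \<open>Operators supported on powers of \<open>1 + p\<close>\<close>

text \<open>For \<open>m = (1 + p) ^ i\<close> one has \<open>\<langle>m\<rangle> = m\<close> and \<open>\<ell>\<^sub>m = i\<close>, so the multiplier on the component
  \<open>e\<close> is the polynomial \<open>P\<close> evaluated at \<open>(1 + p) ^ e (1 + Y)\<close>.\<close>

definition poly_op :: "'k poly \<Rightarrow> nat \<Rightarrow>\<^sub>0 'k"
  where "poly_op P = (\<Sum>i\<le>degree P. Poly_Mapping.single ((1 + p) ^ i) (coeff P i))"

lemma inj_powers: "inj (\<lambda>i. (1 + p) ^ i)"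
  using p_ge_3 by (intro injI) (auto dest: power_inject_exp[THEN iffD1, rotated])

lemma lookup_poly_op: "Poly_Mapping.lookup (poly_op P) ((1 + p) ^ i) = coeff P i"
proof -
  have "Poly_Mapping.lookup (poly_op P) ((1 + p) ^ i) = (\<Sum>j\<le>degree P. if j = i then coeff P j else 0)"
    unfolding poly_op_def lookup_sum lookup_single when_def
    by (intro sum.cong refl) (metis inj_powers injD)
  then show ?thesis by (simp add: coeff_eq_0)
qed

lemma keys_poly_op: "Poly_Mapping.keys (poly_op P) \<subseteq> (\<lambda>i. (1 + p) ^ i) ` {..degree P}"
  unfolding poly_op_def by (rule order_trans[OF keys_sum_subset]) (auto split: if_splits)

lemma sum_poly_op:
  assumes "\<And>m. g m 0 = 0"
  shows "(\<Sum>m\<in>Poly_Mapping.keys (poly_op P). g m (Poly_Mapping.lookup (poly_op P) m)) =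
    (\<Sum>i\<le>degree P. g ((1 + p) ^ i) (coeff P i))"
proof -
  have "(\<Sum>m\<in>Poly_Mapping.keys (poly_op P). g m (Poly_Mapping.lookup (poly_op P) m)) =
     (\<Sum>m\<in>(\<lambda>i. (1 + p) ^ i) ` {..degree P}. g m (Poly_Mapping.lookup (poly_op P) m))"
    by (rule sum.mono_neutral_left) (use keys_poly_op assms in \<open>auto simp: in_keys_iff\<close>)
  also have "\<dots> = (\<Sum>i\<le>degree P. g ((1 + p) ^ i) (Poly_Mapping.lookup (poly_op P) ((1 + p) ^ i)))"
    by (subst sum.reindex[OF inj_on_subset[OF inj_powers subset_UNIV]]) simp
  finally show ?thesis unfolding lookup_poly_op .
qed

lemma poly_op_normalized:
  assumes "poly_over K P" "poly P 1 = 1" shows "poly_op P \<in> normalized_ops p K"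
proof -
  have "coprime (1 + p) p" by simp
  then have cop: "coprime ((1 + p) ^ i) p" for i by simp
  have "(\<Sum>m\<in>Poly_Mapping.keys (poly_op P). Poly_Mapping.lookup (poly_op P) m) = poly P 1"
    using sum_poly_op[of "\<lambda>m a. a" P] by (simp add: poly_altdef)
  moreover have "m \<ge> 1 \<and> coprime m p \<and> Poly_Mapping.lookup (poly_op P) m \<in> K" if m: "m \<in> Poly_Mapping.keys (poly_op P)" for m
  proof -
    obtain i where "m = (1 + p) ^ i" using keys_poly_op m by blast
    then show ?thesis using cop[of i] assms(1) lookup_poly_op[of P i] by (simp add: poly_over_def Suc_leI)
  qed
  ultimately show ?thesis using assms(2) by (simp add: normalized_ops_def)
qed

lemma multiplier_poly_op: "multiplier p (poly_op P) e = jet (of_nat ((1 + p) ^ e)) P"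
proof -
  have "multiplier p (poly_op P) e =
      (\<Sum>i\<le>degree P. fps_const (coeff P i * of_nat ((1 + p) ^ i) ^ e) * fps_binomial (ell p ((1 + p) ^ i)))"
    unfolding multiplier_def
    by (rule sum_poly_op[of "\<lambda>m a. fps_const (a * of_nat m ^ e) * fps_binomial (ell p m)"]) simp
  also have "\<dots> = (\<Sum>i\<le>degree P. fps_const (coeff P i) * (fps_const (of_nat ((1 + p) ^ e)) * (1 + fps_X)) ^ i)"
  proof (rule sum.cong[OF refl])
    fix i
    have "(of_nat ((1 + p) ^ i) ^ e :: 'k) = of_nat ((1 + p) ^ e) ^ i"
      unfolding of_nat_power[symmetric] by (simp add: power_mult[symmetric] mult.commute)
    then show "fps_const (coeff P i * of_nat ((1 + p) ^ i) ^ e) * fps_binomial (ell p ((1 + p) ^ i)) =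
       fps_const (coeff P i) * (fps_const (of_nat ((1 + p) ^ e)) * (1 + fps_X)) ^ i"
      unfolding ell_power_one_plus_p fps_binomial_of_nat power_mult_distrib fps_const_power
      by (simp only: fps_const_mult[symmetric] mult.assoc)
  qed
  also have "\<dots> = jet (of_nat ((1 + p) ^ e)) P" by (rule jet_eq_sum[symmetric]) simp
  finally show ?thesis .
qed

lemma expansion_poly_op:
  assumes \<Lambda>: "\<Lambda> \<in> bounded_measures ZZ" and \<xi>: "unit_root_support \<xi>" and c: "admissible p c"
    and P: "poly_over K P" "poly P 1 = 1" and F: "exceptional_expansion p c \<Lambda> \<xi> F"
  shows "exceptional_expansion p c \<Lambda> (apply_op (poly_op P) \<xi>) (fls_shift 1 (fps_to_fls (regular_part F * jet 1 P)))"
    (is "exceptional_expansion _ _ _ _ ?F'")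
  unfolding exceptional_expansion_def
proof (intro conjI ballI allI impI)
  fix n :: int assume "n < - 1"
  then show "fls_nth ?F' n = 0" by simp
next
  fix s :: 'k assume s: "s \<in> ZZ - {- 1}"
  have s1: "s + 1 \<in> ZZ" using s by (auto intro: Zp_add)
  have u: "absv (1 + of_nat p - 1 :: 'k) \<le> eps 1" using one_plus_p(1) by simp
  let ?v = "pm_mellin p (pseudomeasure p c \<Lambda> \<xi>) (- 1) s"
  let ?h = "\<Sum>i\<le>degree P. coeff P i * (1 + coord s) ^ i"
  have "(\<Sum>m\<in>Poly_Mapping.keys (poly_op P). Poly_Mapping.lookup (poly_op P) m * padic_pow (principal p (of_nat m)) (s + 1)) =
      (\<Sum>i\<le>degree P. coeff P i * padic_pow (principal p (of_nat ((1 + p) ^ i))) (s + 1))"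
    by (rule sum_poly_op[of "\<lambda>m a. a * padic_pow (principal p (of_nat m)) (s + 1)"]) simp
  also have "\<dots> = ?h"
    unfolding principal_one_plus_p_power padic_pow_power[OF u s1] by (simp add: coord_def)
  finally have v': "pm_mellin p (pseudomeasure p c \<Lambda> (apply_op (poly_op P) \<xi>)) (- 1) s = ?h * ?v"
    using pm_mellin_apply_op[OF \<Lambda> \<xi> c s poly_op_normalized[OF P]] by simp
  have reg: "regular_part ?F' = regular_part F * jet 1 P"
    by (rule fps_ext) (simp add: regular_part_def)
  have "fps_sums (regular_part ?F') (coord s) (coord s * (?h * ?v))"
    unfolding reg using fps_sums_mult_jet_one[OF expansion_fps_sums[OF F s] order_refl, of P] by (simp add: mult_ac)
  then have "(\<lambda>n. fls_nth ?F' (int n - 1) * coord s powi (int n - 1)) sums (?h * ?v)"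
    by (simp only: sums_simple_pole_iff[OF coord_nonzero[OF s]])
  then show "(\<lambda>n. fls_nth ?F' (int n - 1) * (padic_pow (1 + of_nat p) (s + 1) - 1) powi (int n - 1))
      sums pm_mellin p (pseudomeasure p c \<Lambda> (apply_op (poly_op P) \<xi>)) (- 1) s"
    by (simp only: v' coord_def)
qed

text \<open>The prescribed jet determines the multiplier on the exceptional component by division of power
  series over \<open>K\<close>; equality of the polar coefficients means that its constant term is \<open>1\<close>, which is
  the normalization. The multipliers on the components \<open>0 \<le> e \<le> p - 2\<close> are the expansions of
  one polynomial at the distinct points \<open>(1 + p) ^ e\<close>.\<close>

lemma exceptional_jets:
  fixes K :: "'k set"
  assumes K: "finite_unramified K" and \<xi>: "cyc_presentation p K \<xi>" and c: "admissible p c"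
    and \<Lambda>: "is_half_measure p c \<Lambda>" and F: "exceptional_expansion p c \<Lambda> \<xi> F" and F0: "fls_nth F (- 1) \<noteq> 0"
    and b: "\<forall>i\<le>M. b i \<in> K" and d: "\<forall>e\<in>{1..p - 2}. \<forall>q\<le>N. d e q \<in> K"
  shows "\<exists>C\<in>normalized_ops p K. \<exists>F'.
       exceptional_expansion p c \<Lambda> (apply_op C \<xi>) F' \<and>
       fls_nth F' (- 1) = fls_nth F (- 1) \<and>
       (\<forall>i\<le>M. fls_nth F' (int i) = b i) \<and>
       (\<forall>e\<in>{1..p - 2}. \<forall>q\<le>N. fps_nth (multiplier p C e) q = d e q)"
proof -
  note Ks = finite_unramified_subfield[OF K]
  define f where "f = regular_part F"
  have fK: "fps_over K f" unfolding f_def using expansion_over[OF K \<xi> c \<Lambda> F] .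
  have f0: "f $ 0 = fls_nth F (- 1)" "f $ 0 \<noteq> 0" using F0 by (auto simp: f_def regular_part_def)
  define g where "g = Abs_fps (\<lambda>n. if n = 0 then f $ 0 else if n \<le> Suc M then b (n - 1) else 0)"
  have gK: "fps_over K g"
    unfolding fps_over_def g_def using fK b subfieldD(2)[OF Ks] by (auto simp: fps_over_def)
  define h where "h = g * inverse f"
  have hf: "h * f = g" unfolding h_def using inverse_mult_eq_1[OF f0(2)] by (simp add: mult.assoc)
  have hK: "fps_over K h" by (rule fps_over_quotient[OF Ks _ fK f0(2)]) (simp add: hf gK)
  have h0: "h $ 0 = 1"
    using f0(2) arg_cong[OF hf, of "\<lambda>f. f $ 0"] by (simp add: g_def)
  define t where "t e = (if e = 0 then h else Abs_fps (\<lambda>q. if q \<le> N then d e q else 0))" for e :: nat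
  define x where "x e = (of_nat ((1 + p) ^ e) :: 'k)" for e :: nat
  have inj: "inj_on x {..p - 2}"
    by (rule inj_onI) (use inj_powers in \<open>simp only: x_def of_nat_eq_iff injD\<close>)
  \<comment> \<open>The order \<open>M + N + 2\<close> covers the coefficients up to \<open>M + 1\<close> for \<open>e = 0\<close> (the pole shifts indices
    by one) and up to \<open>N\<close> for the other components.\<close>
  have "\<exists>P. poly_over K P \<and> (\<forall>e\<in>{..p - 2}. \<forall>q<M + N + 2. jet (x e) P $ q = t e $ q)"
  proof (rule hermite_interpolation[OF Ks _ inj])
    show "x e \<in> K \<and> x e \<noteq> 0" for e
      unfolding x_def using subfield_of_nat[OF Ks] by (simp only: of_nat_eq_0_iff) simp
    show "fps_over K (t e)" if "e \<in> {..p - 2}" for e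
      using hK d that subfieldD(2)[OF Ks] by (auto simp: t_def fps_over_def)
  qed simp
  then obtain P where P: "poly_over K P" "\<And>e q. e \<le> p - 2 \<Longrightarrow> q < M + N + 2 \<Longrightarrow> jet (x e) P $ q = t e $ q"
    by auto
  have jet1: "jet 1 P $ q = h $ q" if "q < M + N + 2" for q
    using P(2)[of 0 q] that by (simp add: x_def t_def)
  have P1: "poly P 1 = 1" using jet1[of 0] h0 by (simp add: jet_nth_0)
  define F' where "F' = fls_shift 1 (fps_to_fls (f * jet 1 P))"
  have prod: "(f * jet 1 P) $ q = g $ q" if "q \<le> Suc M" for q
  proof -
    have "(f * jet 1 P) $ q = (f * h) $ q"
      unfolding fps_mult_nth using that by (intro sum.cong refl) (simp add: jet1)
    then show ?thesis using hf by (simp add: mult.commute)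
  qed
  have \<Lambda>b: "\<Lambda> \<in> bounded_measures ZZ" using \<Lambda> by (simp add: is_half_measure_def)
  show ?thesis
  proof (intro bexI[of _ "poly_op P"] exI[of _ F'] conjI allI impI ballI)
    show "poly_op P \<in> normalized_ops p K" by (rule poly_op_normalized[OF P(1) P1])
    show "exceptional_expansion p c \<Lambda> (apply_op (poly_op P) \<xi>) F'"
      unfolding F'_def f_def
      by (rule expansion_poly_op[OF \<Lambda>b cyc_presentation_unit_root_support[OF \<xi>] c P(1) P1 F])
    show "fls_nth F' (- 1) = fls_nth F (- 1)"
      using prod[of 0] by (simp add: F'_def g_def f0(1))
    show "fls_nth F' (int i) = b i" if "i \<le> M" for i
      using prod[of "Suc i"] that by (simp add: F'_def g_def nat_add_distrib)
    show "multiplier p (poly_op P) e $ q = d e q" if "e \<in> {1..p - 2}" "q \<le> N" for e q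
    proof -
      have "multiplier p (poly_op P) e = jet (x e) P" by (simp only: multiplier_poly_op x_def)
      then show ?thesis using P(2)[of e q] that by (simp add: t_def)
    qed
  qed
qed

lemma rigid_iff:
  fixes K :: "'k set"
  assumes K: "finite_unramified K" and \<xi>: "cyc_presentation p K \<xi>" and c: "admissible p c"
    and \<Lambda>: "is_half_measure p c \<Lambda>" and F: "exceptional_expansion p c \<Lambda> \<xi> F" and F0: "fls_nth F (- 1) \<noteq> 0"
    and n: "n \<ge> - 1"
  shows "rigid_coeff p K c \<Lambda> \<xi> n \<longleftrightarrow> n = - 1"
proof
  assume "n = - 1"
  moreover have "\<Lambda> \<in> bounded_measures ZZ" using \<Lambda> by (simp add: is_half_measure_def)
  ultimately show "rigid_coeff p K c \<Lambda> \<xi> n"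
    unfolding rigid_coeff_def using residue_rigid[OF _ cyc_presentation_unit_root_support[OF \<xi>] c] by blast
next
  assume rigid: "rigid_coeff p K c \<Lambda> \<xi> n"
  show "n = - 1"
  proof (rule ccontr)
    assume "n \<noteq> - 1"
    then have n0: "n = int (nat n)" using n by simp
    note Ks = finite_unramified_subfield[OF K]
    define b where "b i = fls_nth F (int i) + 1" for i
    have "fls_nth F (int i) = regular_part F $ Suc i" for i by (simp add: regular_part_def)
    then have "b i \<in> K" for i
      unfolding b_def using expansion_over[OF K \<xi> c \<Lambda> F] subfieldD[OF Ks] by (simp add: fps_over_def)
    then obtain C F' where C: "C \<in> normalized_ops p K" "exceptional_expansion p c \<Lambda> (apply_op C \<xi>) F'"
      "\<forall>i\<le>nat n. fls_nth F' (int i) = b i"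
      using exceptional_jets[OF K \<xi> c \<Lambda> F F0, of "nat n" b 0 "\<lambda>_ _. 0"] subfieldD(2)[OF Ks] by blast
    then have "fls_nth F' n = fls_nth F n" using rigid F unfolding rigid_coeff_def by blast
    moreover have "fls_nth F' n = fls_nth F n + 1" using C(3) n0 b_def by (metis order_refl)
    ultimately show False by simp
  qed
qed

end

theorem corollary5p11:
  fixes p c :: nat
    and K :: "'k::complete_ultrametric_field set"
    and \<Lambda> :: "'k set \<Rightarrow> 'k"
    and \<xi> :: "'k \<Rightarrow>\<^sub>0 'k"
    and F :: "'k fls"
  assumes "prime p" and "odd p"
    and "absv (of_nat p :: 'k) = 1 / real p"
    and "finite_unramified K"
    and "cyc_presentation p K \<xi>"
    and "admissible p c" and "is_half_measure p c \<Lambda>"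
    and "exceptional_expansion p c \<Lambda> \<xi> F"
    and "fls_nth F (- 1) \<noteq> 0"
  shows "(\<forall>M (b :: nat \<Rightarrow> 'k). (\<forall>i\<le>M. b i \<in> K) \<longrightarrow>
            (\<exists>C\<in>normalized_ops p K. \<exists>F'.
               exceptional_expansion p c \<Lambda> (apply_op C \<xi>) F' \<and>
               fls_nth F' (- 1) = fls_nth F (- 1) \<and>
               (\<forall>i\<le>M. fls_nth F' (int i) = b i)))
       \<and> (\<forall>M N (b :: nat \<Rightarrow> 'k) (d :: nat \<Rightarrow> nat \<Rightarrow> 'k).
            (\<forall>i\<le>M. b i \<in> K) \<longrightarrow> (\<forall>e\<in>{1..p - 2}. \<forall>q\<le>N. d e q \<in> K) \<longrightarrow>
            (\<exists>C\<in>normalized_ops p K. \<exists>F'.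
               exceptional_expansion p c \<Lambda> (apply_op C \<xi>) F' \<and>
               fls_nth F' (- 1) = fls_nth F (- 1) \<and>
               (\<forall>i\<le>M. fls_nth F' (int i) = b i) \<and>
               (\<forall>e\<in>{1..p - 2}. \<forall>q\<le>N. fps_nth (multiplier p C e) q = d e q)))
       \<and> (\<forall>n\<ge>- 1. rigid_coeff p K c \<Lambda> \<xi> n \<longleftrightarrow> n = - 1)"
proof -
  interpret padic_ambient p "TYPE('k)"
    using assms(1-3) by unfold_locales
  note jets = exceptional_jets[OF assms(4-9)] and rigid = rigid_iff[OF assms(4-9)]
  have zero: "\<forall>e\<in>{1..p - 2}. \<forall>q\<le>0. (0 :: 'k) \<in> K"
    using subfieldD(2)[OF finite_unramified_subfield[OF assms(4)]] by simp
  show ?thesis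
  proof (intro conjI allI impI)
    fix M and b :: "nat \<Rightarrow> 'k" assume "\<forall>i\<le>M. b i \<in> K"
    from jets[OF this zero]
    show "\<exists>C\<in>normalized_ops p K. \<exists>F'. exceptional_expansion p c \<Lambda> (apply_op C \<xi>) F' \<and>
       fls_nth F' (- 1) = fls_nth F (- 1) \<and> (\<forall>i\<le>M. fls_nth F' (int i) = b i)" by blast
  next
    fix M N and b :: "nat \<Rightarrow> 'k" and d :: "nat \<Rightarrow> nat \<Rightarrow> 'k"
    assume "\<forall>i\<le>M. b i \<in> K" "\<forall>e\<in>{1..p - 2}. \<forall>q\<le>N. d e q \<in> K"
    then show "\<exists>C\<in>normalized_ops p K. \<exists>F'. exceptional_expansion p c \<Lambda> (apply_op C \<xi>) F' \<and>
       fls_nth F' (- 1) = fls_nth F (- 1) \<and> (\<forall>i\<le>M. fls_nth F' (int i) = b i) \<and>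
       (\<forall>e\<in>{1..p - 2}. \<forall>q\<le>N. fps_nth (multiplier p C e) q = d e q)" by (rule jets)
  next
    fix n :: int assume "n \<ge> - 1"
    then show "rigid_coeff p K c \<Lambda> \<xi> n \<longleftrightarrow> n = - 1" by (rule rigid)
  qed
qed

end
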